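(* Let $X$ be a complete simplicial toric variety of dimension $n$ over an algebraically closed field $\mathbb K$ with torsion-free class group and homogeneous coordinate ring $S$. Let $Y\subseteq \mathbb T^n$ be a reduced complete intersection subscheme of $X$, contained in the dense torus $\mathbb T^n$ of $X$, such that $I(Y)$ is generated by $n$ homogeneous polynomials with semi-ample degrees $\alpha_1,\dots,\alpha_n$. Then for any $\alpha\in\mathcal A$ we have $$H_Y(\alpha)=\sum_{s=0}^{n}(-1)^s\sum_{I\subseteq\{1,\dots,n\},\,|I|=s}|P_{\alpha-\alpha_I}\cap M|,$$ where $\alpha_I=\sum_{i\in I}\alpha_i$. Moreover: (i) if $\alpha\not\succeq\alpha_i$ for every $i\in\{1,\dots,n\}$, then $H_Y(\alpha)=|P_\alpha\cap M|$; (ii) $H_Y(\alpha)\le H_Y(\alpha')$ for all $\alpha\preceq\alpha'$; (iii) $H_Y(\alpha)=|Y|$ for all $\alpha\succeq\alpha_1+\cdots+\alpha_n$.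
   Context: Let $\Sigma\subset N_{\mathbb R}$ be the (complete, simplicial) fan of $X$, $N$ a lattice of rank $n$ with dual lattice $M$, $v_1,\dots,v_r\in N$ the primitive generators of the rays $\rho_1,\dots,\rho_r$ of $\Sigma$, and $D_1,\dots,D_r$ the corresponding torus-invariant prime Weil divisors. Put $\mathcal A=\mathrm{Cl}(X)$. The homogeneous coordinate ring is $S=\mathbb K[x_1,\dots,x_r]=\bigoplus_{\alpha\in\mathcal A}S_\alpha$, graded by $\deg(x_j)=\beta_j:=[D_j]\in\mathcal A$; "homogeneous" refers to this grading. $\mathbb N\beta\subset\mathcal A$ is the semigroup (with $0$) generated by $\beta_1,\dots,\beta_r$, and $\alpha\preceq\alpha'$ means $\alpha'-\alpha\in\mathbb N\beta$. The irrelevant ideal is $B=\langle \prod_{\rho_i\not\subset\sigma}x_i : \sigma\in\Sigma\rangle$, and $\pi:\mathbb K^r\setminus V(B)\to X$ is the geometric quotient map; the dense torus of $X$ is $\mathbb T^n=\pi((\mathbb K^* )^r)$. For a reduced closed subscheme $Y\subset X$, $I(Y)\subset S$ is the unique radical $B$-saturated homogeneous ideal defining $Y$. $Y$ is a complete intersection if $I(Y)$ is generated by a regular sequence of homogeneous polynomials $F_1,\dots,F_k$, $k$ being the codimension of $Y$ in $X$. The multigraded Hilbert function is $H_Y(\alpha)=\dim_{\mathbb K}(S/I(Y))_\alpha$. For $D=\sum_j a_jD_j$ put $P_D=\{m\in M_{\mathbb R}:\langle m,v_j\rangle\ge -a_j,\ 1\le j\le r\}$; up to lattice translation it depends only on the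 class $\alpha=[D]$, and $P_\alpha$ denotes any such $P_D$. A degree $\alpha$ is semi-ample if it is the class of a Cartier divisor $D$ with $\mathcal O(D)$ generated by global sections. $|Y|$ is the number of points of $Y$. *)

theory Defs
  imports
    "HOL-Analysis.Analysis"
    "HOL-Library.Poly_Mapping"
    "HOL-Computational_Algebra.Polynomial"
    "HOL-Algebra.Coset"
    "HOL-Algebra.FiniteProduct"
begin

text \<open>
  The lattices \<open>N\<close> and \<open>M\<close> are both \<open>int ^ 'n\<close>, paired by the standard pairing, and
  \<open>N\<^sub>\<real> = M\<^sub>\<real> = real ^ 'n\<close>.
\<close>

definition real_vec :: "int ^ 'n \<Rightarrow> real ^ 'n" where
  "real_vec w = (\<chi> i. of_int (w $ i))"

definition pairing :: "int ^ 'n \<Rightarrow> int ^ 'n \<Rightarrow> int" where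
  "pairing m w = (\<Sum>i\<in>UNIV. m $ i * w $ i)"

definition rational_polyhedral_cone :: "(real ^ 'n) set \<Rightarrow> bool" where
  "rational_polyhedral_cone \<sigma> \<longleftrightarrow> (\<exists>W. finite W \<and> \<sigma> = convex_cone hull (real_vec ` W))"

definition strongly_convex :: "(real ^ 'n) set \<Rightarrow> bool" where
  "strongly_convex \<sigma> \<longleftrightarrow> \<sigma> \<inter> uminus ` \<sigma> = {0}"

text \<open>The empty set is a face in the sense of \<open>face_of\<close>, but it is not a cone.\<close>

definition fan :: "(real ^ 'n) set set \<Rightarrow> bool" where
  "fan \<Sigma> \<longleftrightarrow> finite \<Sigma> \<and> \<Sigma> \<noteq> {} \<and>
     (\<forall>\<sigma>\<in>\<Sigma>. rational_polyhedral_cone \<sigma> \<and> strongly_convex \<sigma>) \<and>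
     (\<forall>\<sigma>\<in>\<Sigma>. \<forall>\<tau>. \<tau> face_of \<sigma> \<and> \<tau> \<noteq> {} \<longrightarrow> \<tau> \<in> \<Sigma>) \<and>
     (\<forall>\<sigma>\<in>\<Sigma>. \<forall>\<tau>\<in>\<Sigma>. (\<sigma> \<inter> \<tau>) face_of \<sigma> \<and> (\<sigma> \<inter> \<tau>) face_of \<tau>)"

definition complete_fan :: "(real ^ 'n) set set \<Rightarrow> bool" where
  "complete_fan \<Sigma> \<longleftrightarrow> fan \<Sigma> \<and> \<Union>\<Sigma> = UNIV"

definition simplicial_fan :: "(real ^ 'n) set set \<Rightarrow> bool" where
  "simplicial_fan \<Sigma> \<longleftrightarrow> fan \<Sigma> \<and> (\<forall>\<sigma>\<in>\<Sigma>. \<exists>W. independent W \<and> \<sigma> = convex_cone hull W)"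

definition ray :: "('r \<Rightarrow> int ^ 'n) \<Rightarrow> 'r \<Rightarrow> (real ^ 'n) set" where
  "ray v j = convex_cone hull {real_vec (v j)}"

definition primitive :: "int ^ 'n \<Rightarrow> bool" where
  "primitive w \<longleftrightarrow> (\<forall>k w'. w = (\<chi> i. k * w' $ i) \<longrightarrow> \<bar>k\<bar> = 1)"

definition primitive_ray_generators :: "(real ^ 'n) set set \<Rightarrow> ('r \<Rightarrow> int ^ 'n) \<Rightarrow> bool" where
  "primitive_ray_generators \<Sigma> v \<longleftrightarrow>
     bij_betw (ray v) UNIV {\<rho>\<in>\<Sigma>. dim \<rho> = 1} \<and> (\<forall>j. primitive (v j))"

text \<open>
  A torus-invariant Weil divisor \<open>\<Sum>j. D j \<cdot> D\<^sub>j\<close> is its coefficient function.  The class group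
  is the cokernel of \<open>M \<rightarrow> \<int>\<^sup>r\<close>, \<open>m \<mapsto> div \<chi>\<^sup>m = \<Sum>j. \<langle>m, v\<^sub>j\<rangle> D\<^sub>j\<close>; it is written multiplicatively.
\<close>

type_synonym 'r divisor = "'r \<Rightarrow> int"

definition divisor_group :: "'r divisor monoid" where
  "divisor_group = \<lparr>carrier = UNIV, mult = (\<lambda>D E j. D j + E j), one = (\<lambda>j. 0)\<rparr>"

definition principal_divisors :: "('r \<Rightarrow> int ^ 'n) \<Rightarrow> 'r divisor set" where
  "principal_divisors v = range (\<lambda>m j. pairing m (v j))"

definition Cl :: "('r \<Rightarrow> int ^ 'n) \<Rightarrow> 'r divisor set monoid" where
  "Cl v = divisor_group Mod principal_divisors v"

definition divisor_class :: "('r \<Rightarrow> int ^ 'n) \<Rightarrow> 'r divisor \<Rightarrow> 'r divisor set" where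
  "divisor_class v D = principal_divisors v #>\<^bsub>divisor_group\<^esub> D"

definition torsion_free :: "('a, 'b) monoid_scheme \<Rightarrow> bool" where
  "torsion_free G \<longleftrightarrow>
     (\<forall>x\<in>carrier G. \<forall>k::nat. k > 0 \<and> x [^]\<^bsub>G\<^esub> k = \<one>\<^bsub>G\<^esub> \<longrightarrow> x = \<one>\<^bsub>G\<^esub>)"

definition class_diff ::
    "('r \<Rightarrow> int ^ 'n) \<Rightarrow> 'r divisor set \<Rightarrow> 'r divisor set \<Rightarrow> 'r divisor set" where
  "class_diff v \<alpha> \<beta> = \<alpha> \<otimes>\<^bsub>Cl v\<^esub> inv\<^bsub>Cl v\<^esub> \<beta>"

type_synonym ('r, 'k) cox_ring = "('r \<Rightarrow>\<^sub>0 nat) \<Rightarrow>\<^sub>0 'k"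

definition monomial_degree :: "('r \<Rightarrow> int ^ 'n) \<Rightarrow> ('r \<Rightarrow>\<^sub>0 nat) \<Rightarrow> 'r divisor set" where
  "monomial_degree v u = divisor_class v (\<lambda>j. int (Poly_Mapping.lookup u j))"

definition graded_piece ::
    "('r \<Rightarrow> int ^ 'n) \<Rightarrow> 'r divisor set \<Rightarrow> ('r, 'k::field) cox_ring set" where
  "graded_piece v \<alpha> = {f. \<forall>u\<in>Poly_Mapping.keys f. monomial_degree v u = \<alpha>}"

definition homogeneous :: "('r \<Rightarrow> int ^ 'n) \<Rightarrow> ('r, 'k::field) cox_ring \<Rightarrow> bool" where
  "homogeneous v f \<longleftrightarrow> (\<exists>\<alpha>\<in>carrier (Cl v). f \<in> graded_piece v \<alpha>)"

definition class_semigroup :: "('r \<Rightarrow> int ^ 'n) \<Rightarrow> 'r divisor set set" where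
  "class_semigroup v = range (monomial_degree v)"

definition class_le :: "('r \<Rightarrow> int ^ 'n) \<Rightarrow> 'r divisor set \<Rightarrow> 'r divisor set \<Rightarrow> bool" where
  "class_le v \<alpha> \<beta> \<longleftrightarrow> class_diff v \<beta> \<alpha> \<in> class_semigroup v"

text \<open>Ideals are the subspaces of a ring viewed as a module over itself.\<close>

lemma module_times: "module ((*) :: 'a::comm_ring_1 \<Rightarrow> 'a \<Rightarrow> 'a)"
  by unfold_locales (simp_all add: algebra_simps)

abbreviation is_ideal :: "'a::comm_ring_1 set \<Rightarrow> bool" where
  "is_ideal \<equiv> module.subspace (*)"

abbreviation ideal_gen :: "'a::comm_ring_1 set \<Rightarrow> 'a set" where
  "ideal_gen \<equiv> module.span (*)"

definition homogeneous_ideal :: "('r \<Rightarrow> int ^ 'n) \<Rightarrow> ('r, 'k::field) cox_ring set \<Rightarrow> bool" where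
  "homogeneous_ideal v I \<longleftrightarrow> is_ideal I \<and> ideal_gen {f\<in>I. homogeneous v f} = I"

definition radical_ideal :: "'a::comm_ring_1 set \<Rightarrow> bool" where
  "radical_ideal I \<longleftrightarrow> is_ideal I \<and> (\<forall>f k. f ^ k \<in> I \<longrightarrow> f \<in> I)"

definition saturated_ideal :: "'a::comm_ring_1 set \<Rightarrow> 'a set \<Rightarrow> bool" where
  "saturated_ideal B I \<longleftrightarrow> is_ideal I \<and> (\<forall>f. (\<forall>b\<in>B. f * b \<in> I) \<longrightarrow> f \<in> I)"

definition regular_sequence :: "'a::comm_ring_1 list \<Rightarrow> bool" where
  "regular_sequence Fs \<longleftrightarrow>
     (\<forall>i<length Fs. \<forall>g. g * Fs ! i \<in> ideal_gen (set (take i Fs)) \<longrightarrow> g \<in> ideal_gen (set (take i Fs))) \<and>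
     ideal_gen (set Fs) \<noteq> UNIV"

definition irrelevant_ideal ::
    "(real ^ 'n) set set \<Rightarrow> ('r::finite \<Rightarrow> int ^ 'n) \<Rightarrow> ('r, 'k::field) cox_ring set" where
  "irrelevant_ideal \<Sigma> v =
     ideal_gen ((\<lambda>\<sigma>. \<Prod>j | \<not> ray v j \<subseteq> \<sigma>. Poly_Mapping.single (Poly_Mapping.single j 1) 1) ` \<Sigma>)"

definition poly_eval :: "('r::finite \<Rightarrow> 'k::field) \<Rightarrow> ('r, 'k) cox_ring \<Rightarrow> 'k" where
  "poly_eval x f = (\<Sum>u\<in>Poly_Mapping.keys f. Poly_Mapping.lookup f u * (\<Prod>j\<in>UNIV. x j ^ Poly_Mapping.lookup u j))"

definition zero_set :: "('r::finite, 'k::field) cox_ring set \<Rightarrow> ('r \<Rightarrow> 'k) set" where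
  "zero_set J = {x. \<forall>f\<in>J. poly_eval x f = 0}"

definition mult_group :: "'k::field monoid" where
  "mult_group = \<lparr>carrier = - {0}, mult = (*), one = 1\<rparr>"

text \<open>
  The points of \<open>X\<close> are the orbits on \<open>K\<^sup>r - V(B)\<close> of the group \<open>Hom(Cl(X), K\<^sup>*)\<close>, where \<open>g\<close>
  multiplies the \<open>j\<close>-th coordinate by \<open>g [D\<^sub>j]\<close>; \<open>orbit v\<close> is the quotient map \<open>\<pi>\<close>.
\<close>

definition orbit :: "('r \<Rightarrow> int ^ 'n) \<Rightarrow> ('r \<Rightarrow> 'k::field) \<Rightarrow> ('r \<Rightarrow> 'k) set" where
  "orbit v x =
     {(\<lambda>j. g (monomial_degree v (Poly_Mapping.single j 1)) * x j) | g. g \<in> hom (Cl v) mult_group}"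

definition dense_torus :: "('r \<Rightarrow> int ^ 'n) \<Rightarrow> ('r \<Rightarrow> 'k::field) set set" where
  "dense_torus v = orbit v ` {x. \<forall>j. x j \<noteq> 0}"

definition closed_subset_of_ideal ::
    "(real ^ 'n) set set \<Rightarrow> ('r::finite \<Rightarrow> int ^ 'n) \<Rightarrow> ('r, 'k::field) cox_ring set
       \<Rightarrow> ('r \<Rightarrow> 'k) set set" where
  "closed_subset_of_ideal \<Sigma> v I = orbit v ` (zero_set I - zero_set (irrelevant_ideal \<Sigma> v))"

text \<open>
  \<open>I\<close> is the ideal \<open>I(Y)\<close> of the reduced closed subscheme with set of closed points \<open>Y\<close>.
\<close>

definition is_ideal_of ::
    "(real ^ 'n) set set \<Rightarrow> ('r::finite \<Rightarrow> int ^ 'n) \<Rightarrow> ('r \<Rightarrow> 'k::field) set set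
       \<Rightarrow> ('r, 'k) cox_ring set \<Rightarrow> bool" where
  "is_ideal_of \<Sigma> v Y I \<longleftrightarrow>
     homogeneous_ideal v I \<and> radical_ideal I \<and> saturated_ideal (irrelevant_ideal \<Sigma> v) I \<and>
     closed_subset_of_ideal \<Sigma> v I = Y"

definition complete_intersection_ideal ::
    "('r \<Rightarrow> int ^ 'n) \<Rightarrow> ('r, 'k::field) cox_ring set \<Rightarrow> nat \<Rightarrow> bool" where
  "complete_intersection_ideal v I k \<longleftrightarrow>
     (\<exists>Gs. length Gs = k \<and> (\<forall>G\<in>set Gs. homogeneous v G) \<and> regular_sequence Gs \<and>
           ideal_gen (set Gs) = I)"

text \<open>The residue classes of the elements of \<open>E\<close> form a \<open>K\<close>-basis of the image of \<open>V\<close> modulo \<open>I\<close>.\<close>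

definition basis_modulo ::
    "('r, 'k::field) cox_ring set \<Rightarrow> ('r, 'k) cox_ring set \<Rightarrow> ('r, 'k) cox_ring set \<Rightarrow> bool" where
  "basis_modulo V I E \<longleftrightarrow> finite E \<and> E \<subseteq> V \<and>
     (\<forall>c. (\<Sum>e\<in>E. Poly_Mapping.single 0 (c e) * e) \<in> I \<longrightarrow> (\<forall>e\<in>E. c e = 0)) \<and>
     (\<forall>f\<in>V. \<exists>c. f - (\<Sum>e\<in>E. Poly_Mapping.single 0 (c e) * e) \<in> I)"

definition hilbert_function ::
    "('r \<Rightarrow> int ^ 'n) \<Rightarrow> ('r, 'k::field) cox_ring set \<Rightarrow> 'r divisor set \<Rightarrow> nat" where
  "hilbert_function v I \<alpha> = (THE d. \<exists>E. basis_modulo (graded_piece v \<alpha>) I E \<and> card E = d)"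

definition lattice_points :: "(real ^ 'n) set \<Rightarrow> (real ^ 'n) set" where
  "lattice_points P = P \<inter> range real_vec"

definition divisor_polytope :: "('r \<Rightarrow> int ^ 'n) \<Rightarrow> 'r divisor \<Rightarrow> (real ^ 'n) set" where
  "divisor_polytope v D = {m. \<forall>j. m \<bullet> real_vec (v j) \<ge> - of_int (D j)}"

definition class_polytope :: "('r \<Rightarrow> int ^ 'n) \<Rightarrow> 'r divisor set \<Rightarrow> (real ^ 'n) set" where
  "class_polytope v \<alpha> = divisor_polytope v (SOME D. D \<in> \<alpha>)"

text \<open>
  \<open>(int ^ 'n) \<Rightarrow>\<^sub>0 'k\<close> is the coordinate ring of the dense torus, the key \<open>m\<close> standing for the
  character \<open>\<chi>\<^sup>m\<close>.  Since \<open>\<chi>\<^sup>m\<close> has order \<open>\<langle>m, v\<^sub>j\<rangle>\<close> along \<open>D\<^sub>j\<close>, the set \<open>local_sections \<sigma> v D\<close> is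
  \<open>\<Gamma>(U\<^sub>\<sigma>, \<O>(D))\<close> on the affine chart \<open>U\<^sub>\<sigma>\<close>; for \<open>D = 0\<close> it is the coordinate ring of \<open>U\<^sub>\<sigma>\<close>.
\<close>

definition local_sections ::
    "(real ^ 'n) set \<Rightarrow> ('r \<Rightarrow> int ^ 'n) \<Rightarrow> 'r divisor \<Rightarrow> ((int ^ 'n) \<Rightarrow>\<^sub>0 'k::field) set" where
  "local_sections \<sigma> v D = {f. \<forall>m\<in>Poly_Mapping.keys f. \<forall>j. ray v j \<subseteq> \<sigma> \<longrightarrow> pairing m (v j) \<ge> - D j}"

definition global_sections ::
    "(real ^ 'n) set set \<Rightarrow> ('r \<Rightarrow> int ^ 'n) \<Rightarrow> 'r divisor \<Rightarrow> ((int ^ 'n) \<Rightarrow>\<^sub>0 'k::field) set" where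
  "global_sections \<Sigma> v D = (\<Inter>\<sigma>\<in>\<Sigma>. local_sections \<sigma> v D)"

definition globally_generated ::
    "'k::field itself \<Rightarrow> (real ^ 'n) set set \<Rightarrow> ('r \<Rightarrow> int ^ 'n) \<Rightarrow> 'r divisor \<Rightarrow> bool" where
  "globally_generated _ \<Sigma> v D \<longleftrightarrow>
     (\<forall>\<sigma>\<in>\<Sigma>. \<forall>f \<in> (local_sections \<sigma> v D :: ((int ^ 'n) \<Rightarrow>\<^sub>0 'k) set).
        \<exists>T. finite T \<and> T \<subseteq> global_sections \<Sigma> v D \<and>
          (\<exists>h. (\<forall>s\<in>T. h s \<in> local_sections \<sigma> v (\<lambda>j. 0)) \<and> f = (\<Sum>s\<in>T. h s * s)))"

text \<open>
  Locally principal: on the chart \<open>U\<^sub>\<sigma>\<close> a torus-invariant divisor is principal only as the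
  divisor of a character.
\<close>

definition cartier :: "(real ^ 'n) set set \<Rightarrow> ('r \<Rightarrow> int ^ 'n) \<Rightarrow> 'r divisor \<Rightarrow> bool" where
  "cartier \<Sigma> v D \<longleftrightarrow> (\<forall>\<sigma>\<in>\<Sigma>. \<exists>m. \<forall>j. ray v j \<subseteq> \<sigma> \<longrightarrow> pairing m (v j) = D j)"

definition semi_ample ::
    "'k::field itself \<Rightarrow> (real ^ 'n) set set \<Rightarrow> ('r \<Rightarrow> int ^ 'n) \<Rightarrow> 'r divisor set \<Rightarrow> bool" where
  "semi_ample K \<Sigma> v \<alpha> \<longleftrightarrow>
     (\<exists>D. cartier \<Sigma> v D \<and> globally_generated K \<Sigma> v D \<and> \<alpha> = divisor_class v D)"

end

theory Submission
  imports Defs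
begin

text \<open>
  Let \<open>G\<^sub>1, \<dots>, G\<^sub>n\<close> be the homogeneous regular sequence generating \<open>I(Y)\<close>.  Peeling off one \<open>G\<^sub>i\<close> at
  a time shows that the Hilbert function is the alternating sum of the numbers of monomials, with
  shifts by the degrees of the \<open>G\<^sub>i\<close>.  Since a relation between the \<open>G\<^sub>i\<close> has no constant terms, the
  change of generators between the \<open>G\<^sub>i\<close> and the \<open>F\<^sub>i\<close> is invertible modulo the ideal of the
  variables, so the degrees of the \<open>G\<^sub>i\<close> are \<open>\<alpha>\<^sub>1, \<dots>, \<alpha>\<^sub>n\<close> up to order.

  By the Nullstellensatz and saturation, \<open>I(Y)\<close> consists of the polynomials vanishing on \<open>Y\<close>; as \<open>Y\<close>
  lies in the torus, the variables are nonzerodivisors modulo \<open>I(Y)\<close>, whence monotonicity, and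
  interpolation of the points by characters gives the value \<open>|Y|\<close> in the degrees \<open>C (D\<^sub>1 + \<dots> + D\<^sub>r)\<close>
  with \<open>C\<close> large.

  For (iii) it remains to see that the Hilbert function is constant on \<open>\<alpha>\<^sub>1 + \<dots> + \<alpha>\<^sub>n + \<beta>\<close> with \<open>\<beta>\<close>
  semi-ample, and that some such degree dominates \<open>C (D\<^sub>1 + \<dots> + D\<^sub>r)\<close>.  The first claim comes from
  writing the indicator function of a polytope as a signed sum of indicator functions of half-open
  cones (Brion, Lawrence, Varchenko): the exponential sum of each cone has a pole of order \<open>n\<close>, which
  the \<open>n\<close>-fold difference cancels.  Consequently the alternating count is multilinear and nonzero, so
  the polytope of \<open>K (\<alpha>\<^sub>1 + \<dots> + \<alpha>\<^sub>n)\<close> has at least \<open>(K/2)\<^sup>n\<close> lattice points, too many for all of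
  them to lie on the facets when \<open>K\<close> is large.
\<close>


subsection \<open>The class group\<close>

text \<open>The hypotheses supply two generating systems. The relations of the regular sequence
  \<open>Gs\<close> are under control, while the degrees of the list \<open>Fs\<close> are
  semi-ample; hence the matching of degrees.

  An Euler characteristic with vanishing theorems is the usual route to (iii). Its substitute here,
  the signed cone decomposition, is available only for nef divisors. In degree \<alpha>1 + ... +
  \<alpha>n + \<beta> all shifted degrees in the alternating sum are again sums of some \<alpha>i
  and \<beta>, hence nef. This is why constancy is shown there and only then passed on to all larger
  degrees by monotonicity.

  Semi-ample degrees may lie on the boundary of the effective cone, and then no multiple of their
  sum would dominate D1 + ... + Dr. This is excluded by positivity: \<open>1 \<notin> I\<close>
  gives H(0) \<ge> 1, and monotonicity carries this to \<alpha>1 + ... + \<alpha>n, where H is the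
  alternating count up to sign. Finiteness of Y is obtained along the way, from a bound on the size
  of its finite subsets.\<close>

lemma pairing_add_left: "pairing (a + b) w = pairing a w + pairing b w"
  by (simp add: pairing_def distrib_right sum.distrib)

lemma pairing_uminus_left: "pairing (- a) w = - pairing a w"
  by (simp add: pairing_def sum_negf)

lemma pairing_diff_left: "pairing (a - b) w = pairing a w - pairing b w"
  by (simp add: pairing_def left_diff_distrib sum_subtractf)

lemma pairing_zero_left [simp]: "pairing 0 w = 0"
  by (simp add: pairing_def)

lemma comm_group_divisor_group: "comm_group (divisor_group :: 'r divisor monoid)"
proof (rule comm_groupI)
  fix x :: "'r divisor"
  show "\<exists>y\<in>carrier divisor_group. y \<otimes>\<^bsub>divisor_group\<^esub> x = \<one>\<^bsub>divisor_group\<^esub>"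
    by (rule bexI[of _ "\<lambda>j. - x j"]) (auto simp: divisor_group_def)
qed (auto simp: divisor_group_def algebra_simps)

lemma carrier_divisor_group [simp]: "carrier divisor_group = UNIV"
  and mult_divisor_group [simp]: "D \<otimes>\<^bsub>divisor_group\<^esub> E = (\<lambda>j. D j + E j)"
  and one_divisor_group [simp]: "\<one>\<^bsub>divisor_group\<^esub> = (\<lambda>j. 0)"
  by (auto simp: divisor_group_def)

lemma inv_divisor_group [simp]: "inv\<^bsub>divisor_group\<^esub> D = (\<lambda>j. - D j)"
proof -
  interpret comm_group divisor_group by (rule comm_group_divisor_group)
  show ?thesis by (rule inv_equality) auto
qed

lemma subgroup_principal_divisors: "subgroup (principal_divisors v) divisor_group"
proof (rule subgroup.intro)
  show "principal_divisors v \<subseteq> carrier divisor_group" by simp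
  show "x \<otimes>\<^bsub>divisor_group\<^esub> y \<in> principal_divisors v"
    if "x \<in> principal_divisors v" "y \<in> principal_divisors v" for x y
  proof -
    from that obtain a b where "x = (\<lambda>j. pairing a (v j))" "y = (\<lambda>j. pairing b (v j))"
      unfolding principal_divisors_def by blast
    hence "x \<otimes>\<^bsub>divisor_group\<^esub> y = (\<lambda>j. pairing (a + b) (v j))" by (simp add: pairing_add_left)
    thus ?thesis unfolding principal_divisors_def by (rule range_eqI)
  qed
  show "\<one>\<^bsub>divisor_group\<^esub> \<in> principal_divisors v"
    unfolding principal_divisors_def by (rule range_eqI[of _ _ 0]) simp
  show "inv\<^bsub>divisor_group\<^esub> x \<in> principal_divisors v" if "x \<in> principal_divisors v" for x
  proof -
    from that obtain a where "x = (\<lambda>j. pairing a (v j))"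
      unfolding principal_divisors_def by blast
    hence "inv\<^bsub>divisor_group\<^esub> x = (\<lambda>j. pairing (- a) (v j))" by (simp add: pairing_uminus_left)
    thus ?thesis unfolding principal_divisors_def by (rule range_eqI)
  qed
qed

lemma normal_principal_divisors: "normal (principal_divisors v) divisor_group"
  by (rule comm_group.subgroup_imp_normal[OF comm_group_divisor_group subgroup_principal_divisors])

lemma comm_group_Cl: "comm_group (Cl v)"
  unfolding Cl_def
  by (rule comm_group.abelian_FactGroup[OF comm_group_divisor_group subgroup_principal_divisors])

lemma mem_divisor_class_iff: "D \<in> divisor_class v E \<longleftrightarrow> (\<exists>m. \<forall>j. D j = E j + pairing m (v j))"
  unfolding divisor_class_def r_coset_def principal_divisors_def
  by (auto simp: fun_eq_iff algebra_simps)

lemma divisor_class_eq_iff: "divisor_class v D = divisor_class v E \<longleftrightarrow> (\<exists>m. \<forall>j. D j = E j + pairing m (v j))"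
proof
  have "D \<in> divisor_class v D" unfolding mem_divisor_class_iff by (rule exI[of _ 0]) simp
  thus "\<exists>m. \<forall>j. D j = E j + pairing m (v j)" if "divisor_class v D = divisor_class v E"
    using that by (simp add: mem_divisor_class_iff)
next
  assume "\<exists>m. \<forall>j. D j = E j + pairing m (v j)"
  hence "D \<in> divisor_class v E" by (simp add: mem_divisor_class_iff)
  thus "divisor_class v D = divisor_class v E"
    unfolding divisor_class_def using group.repr_independence[of divisor_group D "principal_divisors v" E]
      subgroup_principal_divisors comm_group.axioms(2)[OF comm_group_divisor_group]
    by (metis UNIV_I carrier_divisor_group)
qed

lemma self_mem_divisor_class: "D \<in> divisor_class v D"
  unfolding mem_divisor_class_iff by (rule exI[of _ 0]) simp

lemma mem_divisor_class_iff_eq: "D \<in> divisor_class v E \<longleftrightarrow> divisor_class v D = divisor_class v E"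
  by (simp add: mem_divisor_class_iff divisor_class_eq_iff)

lemma carrier_Cl: "carrier (Cl v) = range (divisor_class v)"
  unfolding Cl_def carrier_FactGroup by (simp add: divisor_class_def[abs_def])

lemma divisor_class_in_Cl [simp]: "divisor_class v D \<in> carrier (Cl v)"
  by (simp add: carrier_Cl)

lemma Cl_mult: "divisor_class v D \<otimes>\<^bsub>Cl v\<^esub> divisor_class v E = divisor_class v (\<lambda>j. D j + E j)"
  unfolding Cl_def mult_FactGroup divisor_class_def
  using normal.rcos_sum[OF normal_principal_divisors, of D E v] by simp

lemma Cl_one: "\<one>\<^bsub>Cl v\<^esub> = divisor_class v (\<lambda>j. 0)"
proof -
  interpret comm_group "Cl v" by (rule comm_group_Cl)
  have "divisor_class v (\<lambda>j. 0) \<otimes>\<^bsub>Cl v\<^esub> divisor_class v (\<lambda>j. 0) = divisor_class v (\<lambda>j. 0)"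
    by (simp add: Cl_mult)
  thus ?thesis using r_cancel_one[of "divisor_class v (\<lambda>j. 0)" "divisor_class v (\<lambda>j. 0)"] by simp
qed

lemma Cl_inv: "inv\<^bsub>Cl v\<^esub> divisor_class v D = divisor_class v (\<lambda>j. - D j)"
proof -
  interpret comm_group "Cl v" by (rule comm_group_Cl)
  show ?thesis by (rule inv_equality) (simp_all add: Cl_mult Cl_one)
qed

lemma class_diff_divisor_class:
  "class_diff v (divisor_class v D) (divisor_class v E) = divisor_class v (\<lambda>j. D j - E j)"
  by (simp add: class_diff_def Cl_inv Cl_mult)

lemma finprod_Cl:
  assumes "finite J"
  shows "finprod (Cl v) (\<lambda>i. divisor_class v (D i)) J = divisor_class v (\<lambda>j. \<Sum>i\<in>J. D i j)"
proof -
  interpret comm_group "Cl v" by (rule comm_group_Cl)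
  show ?thesis using assms
    by (induction J rule: finite_induct) (auto simp: Cl_one Cl_mult Pi_def)
qed

lemma Cl_hom_sum:
  assumes "g \<in> hom (Cl v) mult_group"
  shows "g (divisor_class v (\<lambda>j. D j + E j)) = g (divisor_class v D) * g (divisor_class v E)"
    and "g (divisor_class v D) \<noteq> 0" and "g (divisor_class v (\<lambda>j. 0)) = 1"
proof -
  show m: "g (divisor_class v (\<lambda>j. D j + E j)) = g (divisor_class v D) * g (divisor_class v E)" for D E
    using hom_mult[OF assms, of "divisor_class v D" "divisor_class v E"]
    by (simp add: Cl_mult mult_group_def)
  show nz: "g (divisor_class v D) \<noteq> 0" for D
    using hom_in_carrier[OF assms, of "divisor_class v D"] by (simp add: mult_group_def)
  show "g (divisor_class v (\<lambda>j. 0)) = 1"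
    using m[of "\<lambda>j. 0" "\<lambda>j. 0"] nz[of "\<lambda>j. 0"] by simp
qed


subsection \<open>Polynomials\<close>

lemma poly_mapping_sum_single: "f = (\<Sum>u\<in>Poly_Mapping.keys f. Poly_Mapping.single u (Poly_Mapping.lookup f u))"
  by (rule poly_mapping_eqI)
     (auto simp: lookup_sum lookup_single when_def in_keys_iff sum.delta)

lemma poly_mapping_additive_induct [case_names single add]:
  assumes "\<And>u c. P (Poly_Mapping.single u c)" and "\<And>f g. P f \<Longrightarrow> P g \<Longrightarrow> P (f + g)"
  shows "P (f :: 'a \<Rightarrow>\<^sub>0 'b::comm_monoid_add)"
proof -
  have "P (\<Sum>u\<in>A. Poly_Mapping.single u (Poly_Mapping.lookup f u))" if "finite A" for A
    using that
  proof (induction A)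
    case empty
    show ?case using assms(1)[of undefined 0] by simp
  next
    case (insert x F)
    then show ?case using assms by simp
  qed
  from this[of "Poly_Mapping.keys f"] show ?thesis
    by (subst poly_mapping_sum_single) simp
qed

interpretation ideal: module "(*) :: 'a::comm_ring_1 \<Rightarrow> 'a \<Rightarrow> 'a"
  by (rule module_times)

text \<open>As a simplification rule this reverses \<open>mult.assoc\<close>.\<close>

declare ideal.scale_scale [simp del]

text \<open>Coefficients are indexed by position. This tolerates repeated entries and fits the
  prefixes \<open>take k\<close> of a regular sequence.\<close>

lemma ideal_gen_list:
  "f \<in> ideal_gen (set Gs) \<longleftrightarrow> (\<exists>a. f = (\<Sum>i<length Gs. a i * Gs ! i))"
  for f :: "'a::comm_ring_1"
proof
  let ?A = "{f. \<exists>a. f = (\<Sum>i<length Gs. a i * Gs ! i)}"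
  have "is_ideal ?A"
  proof (rule ideal.subspaceI)
    show "0 \<in> ?A" by (auto intro: exI[of _ "\<lambda>i. 0"])
    show "x + y \<in> ?A" if "x \<in> ?A" "y \<in> ?A" for x y
    proof -
      from that obtain a b where "x = (\<Sum>i<length Gs. a i * Gs ! i)" "y = (\<Sum>i<length Gs. b i * Gs ! i)"
        by blast
      hence "x + y = (\<Sum>i<length Gs. (a i + b i) * Gs ! i)" by (simp add: distrib_right sum.distrib)
      thus ?thesis by (intro CollectI exI)
    qed
    show "c * x \<in> ?A" if "x \<in> ?A" for c x
    proof -
      from that obtain a where "x = (\<Sum>i<length Gs. a i * Gs ! i)" by blast
      hence "c * x = (\<Sum>i<length Gs. (c * a i) * Gs ! i)" by (simp only: sum_distrib_left mult.assoc)
      thus ?thesis by (intro CollectI exI)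
    qed
  qed
  moreover have "set Gs \<subseteq> ?A"
  proof
    fix g assume "g \<in> set Gs"
    then obtain k where k: "k < length Gs" "g = Gs ! k" by (auto simp: in_set_conv_nth)
    have "g = (\<Sum>i<length Gs. (if i = k then 1 else 0) * Gs ! i)"
      using k by (simp add: if_distrib[of "\<lambda>x. x * _"] sum.delta cong: if_cong)
    thus "g \<in> ?A" by (auto intro: exI[of _ "\<lambda>i. if i = k then 1 else 0"])
  qed
  ultimately have "ideal_gen (set Gs) \<subseteq> ?A" by (rule ideal.span_minimal[rotated])
  thus "f \<in> ideal_gen (set Gs) \<Longrightarrow> \<exists>a. f = (\<Sum>i<length Gs. a i * Gs ! i)" by blast
next
  show "\<exists>a. f = (\<Sum>i<length Gs. a i * Gs ! i) \<Longrightarrow> f \<in> ideal_gen (set Gs)"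
    by (elim exE, hypsubst, intro ideal.span_sum ideal.span_scale ideal.span_base) simp
qed

section \<open>Evaluation of polynomials at elements of a commutative algebra\<close>

locale algebra_map =
  fixes h :: "'k::field \<Rightarrow> 'a::comm_ring_1"
  assumes h_add: "h (a + b) = h a + h b" and h_mult: "h (a * b) = h a * h b" and h_one: "h 1 = 1"
begin

lemma h_zero: "h 0 = 0"
  using h_add[of 0 0] by simp

text \<open>A general target algebra serves two purposes: with the field itself this is
  \<open>poly_eval\<close>, and in the Nullstellensatz polynomials are evaluated at elements of
  \<open>S[T]\<close>.\<close>

definition ev :: "('i \<Rightarrow> 'a) \<Rightarrow> (('i::finite \<Rightarrow>\<^sub>0 nat) \<Rightarrow>\<^sub>0 'k) \<Rightarrow> 'a" where
  "ev x f = (\<Sum>u\<in>Poly_Mapping.keys f. h (Poly_Mapping.lookup f u) * (\<Prod>j\<in>UNIV. x j ^ Poly_Mapping.lookup u j))"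

lemma ev_superset:
  assumes "finite A" "Poly_Mapping.keys f \<subseteq> A"
  shows "ev x f = (\<Sum>u\<in>A. h (Poly_Mapping.lookup f u) * (\<Prod>j\<in>UNIV. x j ^ Poly_Mapping.lookup u j))"
  unfolding ev_def by (rule sum.mono_neutral_left) (use assms in \<open>auto simp: in_keys_iff h_zero\<close>)

lemma ev_add: "ev x (f + g) = ev x f + ev x g"
proof -
  let ?A = "Poly_Mapping.keys f \<union> Poly_Mapping.keys g"
  have "ev x (f + g) = (\<Sum>u\<in>?A. h (Poly_Mapping.lookup (f + g) u) * (\<Prod>j\<in>UNIV. x j ^ Poly_Mapping.lookup u j))"
    by (rule ev_superset) (simp_all add: keys_add)
  also have "\<dots> = ev x f + ev x g"
    by (subst (1 2) ev_superset[where A = ?A])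
       (simp_all add: lookup_add h_add distrib_right sum.distrib)
  finally show ?thesis .
qed

lemma ev_single: "ev x (Poly_Mapping.single u c) = h c * (\<Prod>j\<in>UNIV. x j ^ Poly_Mapping.lookup u j)"
  by (subst ev_superset[where A = "{u}"]) auto

lemma ev_zero [simp]: "ev x 0 = 0"
  by (simp add: ev_def)

lemma ev_one [simp]: "ev x 1 = 1"
  using ev_single[of x 0 1] by (simp add: h_one)

lemma ev_const: "ev x (Poly_Mapping.single 0 c) = h c"
  by (simp add: ev_single)

lemma ev_var: "ev x (Poly_Mapping.single (Poly_Mapping.single j 1) 1) = x j"
proof -
  have "(\<Prod>i\<in>UNIV. x i ^ Poly_Mapping.lookup (Poly_Mapping.single j 1) i) = (\<Prod>i\<in>UNIV. if i = j then x i else 1)"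
    by (rule prod.cong) (auto simp: lookup_single when_def)
  thus ?thesis by (simp add: ev_single h_one)
qed

lemma ev_mult: "ev x (f * g) = ev x f * ev x g"
proof (induction f rule: poly_mapping_additive_induct)
  case (single u c)
  show ?case
  proof (induction g rule: poly_mapping_additive_induct)
    case (single w d)
    show ?case
      by (simp add: mult_single ev_single h_mult lookup_add power_add prod.distrib algebra_simps)
  qed (simp add: distrib_left ev_add)
qed (simp add: distrib_right ev_add)

lemma ev_diff: "ev x (f - g) = ev x f - ev x g"
  using ev_add[of x "f - g" g] by simp

lemma ev_sum: "ev x (sum f A) = (\<Sum>i\<in>A. ev x (f i))"
  by (induction A rule: infinite_finite_induct) (auto simp: ev_add)

lemma ev_power: "ev x (f ^ n) = ev x f ^ n"
  by (induction n) (auto simp: ev_mult)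

lemma ev_prod: "ev x (prod f A) = (\<Prod>i\<in>A. ev x (f i))"
  by (induction A rule: infinite_finite_induct) (auto simp: ev_mult)

end

interpretation self_algebra: algebra_map "\<lambda>c::'k::field. c"
  by unfold_locales auto

lemma poly_eval_eq_ev: "poly_eval = self_algebra.ev"
  by (intro ext) (simp add: poly_eval_def self_algebra.ev_def)

lemmas poly_eval_add = self_algebra.ev_add[folded poly_eval_eq_ev]
  and poly_eval_mult = self_algebra.ev_mult[folded poly_eval_eq_ev]
  and poly_eval_diff = self_algebra.ev_diff[folded poly_eval_eq_ev]
  and poly_eval_sum = self_algebra.ev_sum[folded poly_eval_eq_ev]
  and poly_eval_power = self_algebra.ev_power[folded poly_eval_eq_ev]
  and poly_eval_prod = self_algebra.ev_prod[folded poly_eval_eq_ev]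
  and poly_eval_single = self_algebra.ev_single[folded poly_eval_eq_ev]
  and poly_eval_zero = self_algebra.ev_zero[folded poly_eval_eq_ev]
  and poly_eval_one = self_algebra.ev_one[folded poly_eval_eq_ev]

subsection \<open>The grading\<close>

abbreviation monom_of :: "('r \<Rightarrow>\<^sub>0 nat) \<Rightarrow> ('r, 'k::field) cox_ring" where
  "monom_of u \<equiv> Poly_Mapping.single u 1"

lemma monomial_degree_in_Cl [simp]: "monomial_degree v u \<in> carrier (Cl v)"
  by (simp add: monomial_degree_def)

lemma monomial_degree_add:
  "monomial_degree v (u + w) = monomial_degree v u \<otimes>\<^bsub>Cl v\<^esub> monomial_degree v w"
  by (simp add: monomial_degree_def Cl_mult lookup_add)

lemma graded_piece_zero [simp]: "0 \<in> graded_piece v \<alpha>"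
  by (simp add: graded_piece_def)

lemma graded_piece_add: "f \<in> graded_piece v \<alpha> \<Longrightarrow> g \<in> graded_piece v \<alpha> \<Longrightarrow> f + g \<in> graded_piece v \<alpha>"
  using keys_add[of f g] unfolding graded_piece_def by blast

lemma graded_piece_sum: "(\<And>i. i \<in> A \<Longrightarrow> f i \<in> graded_piece v \<alpha>) \<Longrightarrow> sum f A \<in> graded_piece v \<alpha>"
  by (induction A rule: infinite_finite_induct) (auto intro: graded_piece_add)

lemma graded_piece_mult:
  assumes "f \<in> graded_piece v \<alpha>" "g \<in> graded_piece v \<beta>"
  shows "f * g \<in> graded_piece v (\<alpha> \<otimes>\<^bsub>Cl v\<^esub> \<beta>)"
  unfolding graded_piece_def
proof (rule CollectI, rule ballI)
  fix u assume "u \<in> Poly_Mapping.keys (f * g)"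
  from subsetD[OF keys_mult this] obtain a b
    where "u = a + b" "a \<in> Poly_Mapping.keys f" "b \<in> Poly_Mapping.keys g"
    by (elim CollectE exE conjE)
  thus "monomial_degree v u = \<alpha> \<otimes>\<^bsub>Cl v\<^esub> \<beta>"
    using assms by (simp add: graded_piece_def monomial_degree_add)
qed

lemma graded_piece_monom: "Poly_Mapping.single u c \<in> graded_piece v (monomial_degree v u)"
  by (auto simp: graded_piece_def)

lemma graded_piece_scale:
  assumes "f \<in> graded_piece v \<alpha>"
  shows "Poly_Mapping.single 0 c * f \<in> graded_piece v \<alpha>"
proof -
  have "Poly_Mapping.keys (Poly_Mapping.single 0 c * f) \<subseteq> Poly_Mapping.keys f"
  proof
    fix u assume "u \<in> Poly_Mapping.keys (Poly_Mapping.single 0 c * f)"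
    from subsetD[OF keys_mult this] obtain a b
      where "u = a + b" "a \<in> Poly_Mapping.keys (Poly_Mapping.single 0 c)" "b \<in> Poly_Mapping.keys f"
      by (elim CollectE exE conjE)
    moreover from this(2) have "a = 0" by (simp split: if_splits)
    ultimately show "u \<in> Poly_Mapping.keys f" by simp
  qed
  thus ?thesis using assms by (auto simp: graded_piece_def)
qed

lemma graded_piece_diff:
  assumes "f \<in> graded_piece v \<alpha>" "g \<in> graded_piece v \<alpha>"
  shows "f - g \<in> graded_piece v \<alpha>"
proof -
  have "f - g = f + Poly_Mapping.single 0 (- 1) * g"
    by (simp add: single_uminus)
  thus ?thesis using graded_piece_add[OF assms(1) graded_piece_scale[OF assms(2), of "- 1"]] by (simp only:)
qed

lemma graded_piece_power:
  assumes "f \<in> graded_piece v (divisor_class v D)"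
  shows "f ^ k \<in> graded_piece v (divisor_class v (\<lambda>j. int k * D j))"
proof (induction k)
  case 0
  show ?case using graded_piece_monom[of "0 :: 'a \<Rightarrow>\<^sub>0 nat" 1 v] by (simp add: monomial_degree_def)
next
  case (Suc k)
  from graded_piece_mult[OF assms this] show ?case by (simp add: Cl_mult algebra_simps)
qed

lemma graded_piece_prod:
  assumes "\<And>i. i \<in> A \<Longrightarrow> f i \<in> graded_piece v (divisor_class v (D i))"
  shows "prod f A \<in> graded_piece v (divisor_class v (\<lambda>j. \<Sum>i\<in>A. D i j))"
  using assms
proof (induction A rule: infinite_finite_induct)
  case (insert x F)
  from graded_piece_mult[OF insert.prems[of x] insert.IH] insert.prems insert.hyps
  show ?case by (auto simp: Cl_mult)
qed (use graded_piece_monom[of "0 :: 'b \<Rightarrow>\<^sub>0 nat" 1 v] in \<open>auto simp: monomial_degree_def\<close>)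

definition hom_component :: "('r \<Rightarrow> int ^ 'n) \<Rightarrow> 'r divisor set \<Rightarrow> ('r, 'k::field) cox_ring \<Rightarrow> ('r, 'k) cox_ring" where
  "hom_component v \<alpha> = Poly_Mapping.mapp (\<lambda>u c. if monomial_degree v u = \<alpha> then c else 0)"

lemma lookup_hom_component:
  "Poly_Mapping.lookup (hom_component v \<alpha> f) u = (if monomial_degree v u = \<alpha> then Poly_Mapping.lookup f u else 0)"
  by (auto simp: hom_component_def lookup_mapp when_def in_keys_iff)

lemma hom_component_mem: "hom_component v \<alpha> f \<in> graded_piece v \<alpha>"
  by (auto simp: graded_piece_def in_keys_iff lookup_hom_component split: if_splits)

lemma hom_component_add: "hom_component v \<alpha> (f + g) = hom_component v \<alpha> f + hom_component v \<alpha> g"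
  by (rule poly_mapping_eqI) (simp add: lookup_add lookup_hom_component)

lemma hom_component_sum: "hom_component v \<alpha> (sum f A) = (\<Sum>i\<in>A. hom_component v \<alpha> (f i))"
proof (induction A rule: infinite_finite_induct)
  case empty
  show ?case by (rule poly_mapping_eqI) (simp add: lookup_hom_component)
next
  case (infinite A)
  show ?case using infinite by (simp, intro poly_mapping_eqI) (simp add: lookup_hom_component)
qed (simp add: hom_component_add)

lemma hom_component_id: "f \<in> graded_piece v \<alpha> \<Longrightarrow> hom_component v \<alpha> f = f"
  by (rule poly_mapping_eqI) (auto simp: lookup_hom_component graded_piece_def in_keys_iff)

lemma hom_component_other:
  "f \<in> graded_piece v \<beta> \<Longrightarrow> \<alpha> \<noteq> \<beta> \<Longrightarrow> hom_component v \<alpha> f = 0"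
  by (rule poly_mapping_eqI) (auto simp: lookup_hom_component graded_piece_def in_keys_iff)

text \<open>In the class group \<delta> can be cancelled, so a monomial of \<open>a\<close>
  contributes to degree \<alpha> of the product exactly if its own degree is \<alpha> -
  \<delta>.\<close>

lemma hom_component_mult:
  assumes "G \<in> graded_piece v \<delta>" "\<delta> \<in> carrier (Cl v)" "\<alpha> \<in> carrier (Cl v)"
  shows "hom_component v \<alpha> (a * G) = hom_component v (class_diff v \<alpha> \<delta>) a * G"
proof (induction a rule: poly_mapping_additive_induct)
  case (single u c)
  interpret comm_group "Cl v" by (rule comm_group_Cl)
  have m: "Poly_Mapping.single u c * G \<in> graded_piece v (monomial_degree v u \<otimes>\<^bsub>Cl v\<^esub> \<delta>)"
    by (rule graded_piece_mult[OF graded_piece_monom assms(1)])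
  have eq: "class_diff v \<alpha> \<delta> = monomial_degree v u \<longleftrightarrow> monomial_degree v u \<otimes>\<^bsub>Cl v\<^esub> \<delta> = \<alpha>"
    unfolding class_diff_def using assms(2,3) monomial_degree_in_Cl[of v u]
    by (metis inv_solve_right)
  show ?case
  proof (cases "monomial_degree v u \<otimes>\<^bsub>Cl v\<^esub> \<delta> = \<alpha>")
    case True
    hence "class_diff v \<alpha> \<delta> = monomial_degree v u" using eq by simp
    hence "hom_component v (class_diff v \<alpha> \<delta>) (Poly_Mapping.single u c) = Poly_Mapping.single u c"
      using hom_component_id[OF graded_piece_monom, of v u c] by simp
    thus ?thesis using hom_component_id[OF m] True by simp
  next
    case False
    hence "class_diff v \<alpha> \<delta> \<noteq> monomial_degree v u" using eq by simp
    from hom_component_other[OF graded_piece_monom this]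
    have "hom_component v (class_diff v \<alpha> \<delta>) (Poly_Mapping.single u c) = 0" .
    moreover from hom_component_other[OF m] False
    have "hom_component v \<alpha> (Poly_Mapping.single u c * G) = 0" by metis
    ultimately show ?thesis by simp
  qed
qed (simp add: distrib_right hom_component_add)

text \<open>Taking the component of degree \<alpha> in an arbitrary representation leaves
  \<open>f\<close> unchanged and replaces each coefficient by its component in the complementary
  degree.\<close>

lemma homogeneous_ideal_representation:
  assumes "f \<in> graded_piece v \<alpha>" "\<alpha> \<in> carrier (Cl v)" "f \<in> ideal_gen (set Gs)"
    and "\<And>i. i < length Gs \<Longrightarrow> Gs ! i \<in> graded_piece v (\<delta> i)"
    and "\<And>i. i < length Gs \<Longrightarrow> \<delta> i \<in> carrier (Cl v)"
  obtains a where "f = (\<Sum>i<length Gs. a i * Gs ! i)"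
    and "\<And>i. a i \<in> graded_piece v (class_diff v \<alpha> (\<delta> i))"
proof -
  from assms(3) obtain b where b: "f = (\<Sum>i<length Gs. b i * Gs ! i)" by (auto simp: ideal_gen_list)
  have "f = hom_component v \<alpha> f" using hom_component_id[OF assms(1)] by simp
  also have "\<dots> = (\<Sum>i<length Gs. hom_component v \<alpha> (b i * Gs ! i))"
    by (subst b) (rule hom_component_sum)
  also have "\<dots> = (\<Sum>i<length Gs. hom_component v (class_diff v \<alpha> (\<delta> i)) (b i) * Gs ! i)"
    by (rule sum.cong) (use assms in \<open>auto intro: hom_component_mult\<close>)
  finally show ?thesis
    by (rule that) (rule hom_component_mem)
qed


subsection \<open>Dimension modulo an ideal\<close>

abbreviation scale_poly :: "'k::field \<Rightarrow> ('r, 'k) cox_ring \<Rightarrow> ('r, 'k) cox_ring" where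
  "scale_poly c f \<equiv> Poly_Mapping.single 0 c * f"

interpretation vs: vector_space "scale_poly :: 'k::field \<Rightarrow> ('r, 'k) cox_ring \<Rightarrow> _"
  by unfold_locales
     (simp_all add: distrib_left distrib_right single_add mult_single mult.assoc[symmetric])

declare vs.scale_scale [simp del]

definition independent_modulo :: "('r, 'k::field) cox_ring set \<Rightarrow> ('r, 'k) cox_ring set \<Rightarrow> bool" where
  "independent_modulo I L \<longleftrightarrow> finite L \<and> (\<forall>c. (\<Sum>e\<in>L. scale_poly (c e) e) \<in> I \<longrightarrow> (\<forall>e\<in>L. c e = 0))"

lemma basis_modulo_iff:
  "basis_modulo V I E \<longleftrightarrow> independent_modulo I E \<and> E \<subseteq> V \<and>
     (\<forall>f\<in>V. \<exists>c. f - (\<Sum>e\<in>E. scale_poly (c e) e) \<in> I)"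
  by (auto simp: basis_modulo_def independent_modulo_def)

lemma sum_scale_Un:
  assumes "finite A" "finite B" "A \<inter> B = {}"
  shows "(\<Sum>e\<in>A \<union> B. scale_poly (c e) e) = (\<Sum>e\<in>A. scale_poly (c e) e) + (\<Sum>e\<in>B. scale_poly (c e) e)"
  by (rule sum.union_disjoint) (use assms in auto)

context
  fixes V I :: "('r, 'k::field) cox_ring set" and S :: "('r, 'k) cox_ring set"
  assumes V: "vs.subspace V" and I: "is_ideal I" and S: "finite S" "V \<subseteq> vs.span S"
begin

lemma finite_independent: "vs.independent B \<Longrightarrow> B \<subseteq> V \<Longrightarrow> finite B"
  using vs.independent_span_bound[OF S(1), of B] S(2) by auto

text \<open>Vectors of \<open>V \<inter> I\<close> added to a set that is independent modulo
  \<open>I\<close> keep it independent in the ordinary sense, so the exchange theorem can be used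
  without forming a quotient space.\<close>

lemma independent_modulo_Un:
  assumes L: "independent_modulo I L" "L \<subseteq> V"
    and B: "vs.independent B" "B \<subseteq> V \<inter> I"
  shows "L \<inter> B = {}" and "vs.independent (L \<union> B)"
proof -
  have fL: "finite L" and fB: "finite B"
    using L(1) finite_independent[OF B(1)] B(2) by (auto simp: independent_modulo_def)
  show disj: "L \<inter> B = {}"
  proof (rule ccontr)
    assume "L \<inter> B \<noteq> {}"
    then obtain e where e: "e \<in> L" "e \<in> B" by blast
    have "(\<Sum>x\<in>L. scale_poly (if x = e then 1 else 0) x) = (\<Sum>x\<in>L. if x = e then x else 0)"
      by (rule sum.cong) auto
    also have "\<dots> = e" using e fL by simp
    also have "e \<in> I" using e B by blast
    finally have "(\<Sum>x\<in>L. scale_poly (if x = e then 1 else 0) x) \<in> I" .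
    moreover have all: "\<forall>c. (\<Sum>x\<in>L. scale_poly (c x) x) \<in> I \<longrightarrow> (\<forall>x\<in>L. c x = 0)"
      using L(1) unfolding independent_modulo_def by blast
    from spec[OF all, of "\<lambda>x. if x = e then 1 else 0"]
    have "(\<Sum>x\<in>L. scale_poly (if x = e then 1 else 0) x) \<in> I
      \<longrightarrow> (\<forall>x\<in>L. (if x = e then 1 else 0) = (0::'k))" .
    ultimately have "\<forall>x\<in>L. (if x = e then 1 else 0) = (0::'k)" by blast
    thus False using e(1) by auto
  qed
  show "vs.independent (L \<union> B)"
  proof (rule vs.independent_if_scalars_zero)
    fix c x
    assume z: "(\<Sum>x\<in>L \<union> B. scale_poly (c x) x) = 0" and x: "x \<in> L \<union> B"
    have eq: "(\<Sum>x\<in>L. scale_poly (c x) x) = - (\<Sum>x\<in>B. scale_poly (c x) x)"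
      using z sum_scale_Un[OF fL fB disj, of c] by (simp add: eq_neg_iff_add_eq_0)
    have "(\<Sum>x\<in>B. scale_poly (c x) x) \<in> I"
      using B(2) by (intro ideal.subspace_sum[OF I] ideal.subspace_scale[OF I]) auto
    hence "(\<Sum>x\<in>L. scale_poly (c x) x) \<in> I" unfolding eq by (rule ideal.subspace_neg[OF I])
    hence L0: "\<forall>x\<in>L. c x = 0" using L(1) unfolding independent_modulo_def by blast
    hence "(\<Sum>x\<in>L. scale_poly (c x) x) = 0" by simp
    hence "(\<Sum>x\<in>B. scale_poly (c x) x) = 0" using eq by simp
    hence "\<forall>x\<in>B. c x = 0" using vs.independentD[OF B(1) fB subset_refl] by blast
    thus "c x = 0" using L0 x by blast
  qed (use fL fB in auto)
qed

text \<open>Enlarged by the same basis of \<open>V \<inter> I\<close>, the set \<open>E\<close>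
  spans \<open>V\<close> and \<open>L\<close> is independent in it. The exchange bound holds for the
  enlarged sets, and the common part cancels.\<close>

lemma independent_modulo_card_le:
  assumes "basis_modulo V I E" "independent_modulo I L" "L \<subseteq> V"
  shows "card L \<le> card E"
proof -
  obtain B where B: "B \<subseteq> V \<inter> I" "vs.independent B" "V \<inter> I \<subseteq> vs.span B"
    using vs.basis_exists by metis
  have E: "independent_modulo I E" "E \<subseteq> V" using assms(1) by (auto simp: basis_modulo_iff)
  have fB: "finite B" using B finite_independent by blast
  have fE: "finite E" and fL: "finite L" using E(1) assms(2) by (auto simp: independent_modulo_def)
  note uE = independent_modulo_Un[OF E B(2,1)] and uL = independent_modulo_Un[OF assms(2,3) B(2,1)]
  have "V \<subseteq> vs.span (E \<union> B)"
  proof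
    fix f assume "f \<in> V"
    then obtain c where c: "f - (\<Sum>e\<in>E. scale_poly (c e) e) \<in> I"
      using assms(1) by (auto simp: basis_modulo_iff)
    have "(\<Sum>e\<in>E. scale_poly (c e) e) \<in> V"
      using E(2) by (intro vs.subspace_sum[OF V] vs.subspace_scale[OF V]) auto
    with \<open>f \<in> V\<close> have "f - (\<Sum>e\<in>E. scale_poly (c e) e) \<in> V" by (rule vs.subspace_diff[OF V])
    with c B(3) have "f - (\<Sum>e\<in>E. scale_poly (c e) e) \<in> vs.span B" by blast
    hence 1: "f - (\<Sum>e\<in>E. scale_poly (c e) e) \<in> vs.span (E \<union> B)"
      using vs.span_mono[of B "E \<union> B"] by blast
    have 2: "(\<Sum>e\<in>E. scale_poly (c e) e) \<in> vs.span (E \<union> B)"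
      by (intro vs.span_sum vs.span_scale vs.span_base) auto
    from vs.span_add[OF 1 2] show "f \<in> vs.span (E \<union> B)" by simp
  qed
  moreover have "L \<union> B \<subseteq> V" using assms(3) B(1) by blast
  ultimately have "L \<union> B \<subseteq> vs.span (E \<union> B)" by (rule subset_trans[rotated])
  from vs.independent_span_bound[OF _ uL(2) this] fE fB have "card (L \<union> B) \<le> card (E \<union> B)" by simp
  thus ?thesis using uE(1) uL(1) fE fL fB by (simp add: card_Un_disjoint)
qed

text \<open>A basis of \<open>V \<inter> I\<close> extends to one of \<open>V\<close>; the vectors
  added in this extension represent a basis of the image of \<open>V\<close>.\<close>

lemma basis_modulo_exists: "\<exists>E. basis_modulo V I E"
proof -
  obtain B where B: "B \<subseteq> V \<inter> I" "vs.independent B" "V \<inter> I \<subseteq> vs.span B"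
    using vs.basis_exists by metis
  obtain C where C: "B \<subseteq> C" "C \<subseteq> V" "vs.independent C" "V \<subseteq> vs.span C"
    using vs.maximal_independent_subset_extend[of B V] B by blast
  have fC: "finite C" using C finite_independent by blast
  hence fB: "finite B" using C(1) finite_subset by blast
  let ?E = "C - B"
  have "independent_modulo I ?E" unfolding independent_modulo_def
  proof (intro conjI allI impI)
    fix c assume "(\<Sum>e\<in>?E. scale_poly (c e) e) \<in> I"
    moreover have "(\<Sum>e\<in>?E. scale_poly (c e) e) \<in> V"
      using C(2) by (intro vs.subspace_sum[OF V] vs.subspace_scale[OF V]) auto
    ultimately have "(\<Sum>e\<in>?E. scale_poly (c e) e) \<in> vs.span B" using B(3) by blast
    then obtain d where d: "(\<Sum>e\<in>?E. scale_poly (c e) e) = (\<Sum>e\<in>B. scale_poly (d e) e)"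
      using vs.span_finite[OF fB] by auto
    \<comment> \<open>The minus sign on \<open>B\<close> brings both expansions of the same vector
      to one side, giving a relation on all of \<open>C\<close>.\<close>
    define g where "g = (\<lambda>e. if e \<in> B then - d e else c e)"
    have "(\<Sum>e\<in>?E \<union> B. scale_poly (g e) e) = (\<Sum>e\<in>?E. scale_poly (g e) e) + (\<Sum>e\<in>B. scale_poly (g e) e)"
      by (rule sum_scale_Un) (use fC fB in auto)
    also have "(\<Sum>e\<in>?E. scale_poly (g e) e) = (\<Sum>e\<in>?E. scale_poly (c e) e)"
      by (rule sum.cong) (auto simp: g_def)
    also have "(\<Sum>e\<in>B. scale_poly (g e) e) = - (\<Sum>e\<in>B. scale_poly (d e) e)"
      unfolding sum_negf[symmetric] by (rule sum.cong) (auto simp: g_def)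
    finally have "(\<Sum>e\<in>C. scale_poly (g e) e) = 0" using d C(1) by (simp add: Un_absorb2)
    hence "\<forall>e\<in>C. g e = 0" using vs.independentD[OF C(3) fC subset_refl] by blast
    thus "\<forall>e\<in>?E. c e = 0" by (auto simp: g_def)
  qed (use fC in auto)
  moreover have "\<exists>c. f - (\<Sum>e\<in>?E. scale_poly (c e) e) \<in> I" if "f \<in> V" for f
  proof -
    from that C(4) obtain c where c: "f = (\<Sum>e\<in>C. scale_poly (c e) e)"
      using vs.span_finite[OF fC] by auto
    have "f = (\<Sum>e\<in>?E. scale_poly (c e) e) + (\<Sum>e\<in>B. scale_poly (c e) e)"
      unfolding c by (rule sum.subset_diff[OF C(1) fC])
    moreover have "(\<Sum>e\<in>B. scale_poly (c e) e) \<in> I"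
      using B(1) by (intro ideal.subspace_sum[OF I] ideal.subspace_scale[OF I]) auto
    ultimately show ?thesis by (intro exI[of _ c]) simp
  qed
  ultimately have "basis_modulo V I ?E" using C(2) by (auto simp: basis_modulo_iff)
  thus ?thesis ..
qed

end

text \<open>Multiplication by an element that can be cancelled modulo \<open>I\<close> is injective
  on residue classes. The next member of a regular sequence is such an element, and so is a monomial
  modulo the ideal of a subset of the torus. The coefficient form comes first because it also yields
  injectivity, through the relation \<open>a * g - b * g = 0\<close>.\<close>

lemma independent_modulo_mult:
  assumes "independent_modulo I E" "0 \<in> I" and cancel: "\<And>a. a * g \<in> I \<Longrightarrow> a \<in> I"
  shows "(\<Sum>e\<in>E. scale_poly (c e) (e * g)) \<in> I \<Longrightarrow> \<forall>e\<in>E. c e = 0"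
    "inj_on (\<lambda>e. e * g) E" "independent_modulo I ((\<lambda>e. e * g) ` E)"
proof -
  have fin: "finite E" and ind: "\<And>c. (\<Sum>e\<in>E. scale_poly (c e) e) \<in> I \<Longrightarrow> \<forall>e\<in>E. c e = 0"
    using assms(1) by (auto simp: independent_modulo_def)
  show indep: "\<forall>e\<in>E. c e = 0" if "(\<Sum>e\<in>E. scale_poly (c e) (e * g)) \<in> I" for c
  proof (rule ind, rule cancel)
    show "(\<Sum>e\<in>E. scale_poly (c e) e) * g \<in> I"
      using that by (simp add: sum_distrib_right mult.assoc)
  qed
  show inj: "inj_on (\<lambda>e. e * g) E"
  proof (rule inj_onI, rule ccontr)
    fix a b assume ab: "a \<in> E" "b \<in> E" "a * g = b * g" "a \<noteq> b"
    define c where "c = (\<lambda>e. if e = a then 1 else if e = b then - 1 else (0::'b))"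
    have "(\<Sum>e\<in>E. scale_poly (c e) (e * g)) = (\<Sum>e\<in>{a, b}. scale_poly (c e) (e * g))"
      by (rule sum.mono_neutral_right) (use ab fin in \<open>auto simp: c_def\<close>)
    also have "\<dots> = a * g - b * g" using ab(4) by (simp add: c_def single_uminus)
    also have "\<dots> = 0" using ab(3) by simp
    finally have "(\<Sum>e\<in>E. scale_poly (c e) (e * g)) \<in> I" using assms(2) by simp
    from bspec[OF indep[OF this] ab(1)] show False by (simp add: c_def)
  qed
  show "independent_modulo I ((\<lambda>e. e * g) ` E)"
    unfolding independent_modulo_def
  proof (intro conjI allI impI)
    show "finite ((\<lambda>e. e * g) ` E)" using fin by simp
    fix c assume "(\<Sum>e\<in>(\<lambda>e. e * g) ` E. scale_poly (c e) e) \<in> I"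
    hence "\<forall>e\<in>E. c (e * g) = 0" by (intro indep) (simp add: sum.reindex[OF inj])
    thus "\<forall>e\<in>(\<lambda>e. e * g) ` E. c e = 0" by blast
  qed
qed

subsection \<open>The Hilbert function\<close>

definition monomials_of_degree :: "('r \<Rightarrow> int ^ 'n) \<Rightarrow> 'r divisor set \<Rightarrow> ('r \<Rightarrow>\<^sub>0 nat) set" where
  "monomials_of_degree v \<alpha> = {u. monomial_degree v u = \<alpha>}"

lemma subspace_graded_piece: "vs.subspace (graded_piece v \<alpha>)"
  by (auto simp: vs.subspace_def graded_piece_add graded_piece_scale)

lemma graded_piece_span:
  "graded_piece v \<alpha> \<subseteq> vs.span ((\<lambda>u. monom_of u :: ('r, 'k::field) cox_ring) ` monomials_of_degree v \<alpha>)"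
proof
  fix f :: "('r, 'k) cox_ring" assume f: "f \<in> graded_piece v \<alpha>"
  have "(\<Sum>u\<in>Poly_Mapping.keys f. scale_poly (Poly_Mapping.lookup f u) (monom_of u))
      \<in> vs.span ((\<lambda>u. monom_of u) ` monomials_of_degree v \<alpha>)"
    using f by (intro vs.span_sum vs.span_scale vs.span_base)
      (auto simp: graded_piece_def monomials_of_degree_def)
  moreover have "f = (\<Sum>u\<in>Poly_Mapping.keys f. scale_poly (Poly_Mapping.lookup f u) (monom_of u))"
    by (subst poly_mapping_sum_single) (simp add: mult_single)
  ultimately show "f \<in> vs.span ((\<lambda>u. monom_of u) ` monomials_of_degree v \<alpha>)" by simp
qed

context
  fixes v :: "'r \<Rightarrow> int ^ 'n" and I :: "('r, 'k::field) cox_ring set" and \<alpha> :: "'r divisor set"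
  assumes fin: "finite (monomials_of_degree v \<alpha>)" and I: "is_ideal I"
begin

text \<open>All bases modulo \<open>I\<close> have the same size, so the description in
  \<open>hilbert_function\<close> has exactly one candidate.\<close>

lemma hilbert_function_basis:
  assumes "basis_modulo (graded_piece v \<alpha>) I E"
  shows "hilbert_function v I \<alpha> = card E"
  unfolding hilbert_function_def
proof (rule the_equality)
  show "\<exists>E'. basis_modulo (graded_piece v \<alpha>) I E' \<and> card E' = card E"
    using assms by blast
  note le = independent_modulo_card_le[OF subspace_graded_piece I finite_imageI[OF fin] graded_piece_span]
  fix d assume "\<exists>E. basis_modulo (graded_piece v \<alpha>) I E \<and> card E = d"
  then obtain E' where E': "basis_modulo (graded_piece v \<alpha>) I E'" "card E' = d" by blast
  show "d = card E"
    using le[OF assms, of E'] le[OF E'(1), of E] E' assms by (auto simp: basis_modulo_iff)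
qed

lemma hilbert_function_basis_exists:
  obtains E where "basis_modulo (graded_piece v \<alpha>) I E" "hilbert_function v I \<alpha> = card E"
  using basis_modulo_exists[OF subspace_graded_piece I finite_imageI[OF fin] graded_piece_span]
    hilbert_function_basis by blast

lemma hilbert_function_ge:
  assumes "independent_modulo I L" "L \<subseteq> graded_piece v \<alpha>"
  shows "card L \<le> hilbert_function v I \<alpha>"
proof -
  obtain E where E: "basis_modulo (graded_piece v \<alpha>) I E" "hilbert_function v I \<alpha> = card E"
    by (rule hilbert_function_basis_exists)
  show ?thesis unfolding E(2)
    by (rule independent_modulo_card_le[OF subspace_graded_piece I finite_imageI[OF fin] graded_piece_span E(1) assms])
qed

text \<open>If \<open>I\<close> contains no nonzero form of this degree, the monomials remain
  independent modulo \<open>I\<close>. This covers the zero ideal, where the regular sequence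
  starts, and the degrees in (i).\<close>

lemma hilbert_function_trivial:
  assumes "graded_piece v \<alpha> \<inter> I \<subseteq> {0}"
  shows "hilbert_function v I \<alpha> = card (monomials_of_degree v \<alpha>)"
proof -
  let ?m = "\<lambda>u. monom_of u :: ('r, 'k) cox_ring"
  have inj: "inj_on ?m (monomials_of_degree v \<alpha>)"
    by (rule inj_onI) (metis keys_single one_neq_zero singleton_inject)
  have "basis_modulo (graded_piece v \<alpha>) I (?m ` monomials_of_degree v \<alpha>)"
    unfolding basis_modulo_iff independent_modulo_def
  proof (intro conjI allI impI ballI subsetI)
    show "finite (?m ` monomials_of_degree v \<alpha>)" using fin by simp
    show sub: "e \<in> graded_piece v \<alpha>" if "e \<in> ?m ` monomials_of_degree v \<alpha>" for e
      using that graded_piece_monom by (auto simp: monomials_of_degree_def)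
    have sum: "(\<Sum>e\<in>?m ` monomials_of_degree v \<alpha>. scale_poly (c e) e)
        = (\<Sum>u\<in>monomials_of_degree v \<alpha>. Poly_Mapping.single u (c (?m u)))" for c
      using inj by (simp add: sum.reindex mult_single)
    show "c e = 0" if c: "(\<Sum>e\<in>?m ` monomials_of_degree v \<alpha>. scale_poly (c e) e) \<in> I"
      and e: "e \<in> ?m ` monomials_of_degree v \<alpha>" for c e
    proof -
      have "(\<Sum>e\<in>?m ` monomials_of_degree v \<alpha>. scale_poly (c e) e) \<in> graded_piece v \<alpha>"
        by (intro graded_piece_sum graded_piece_scale sub)
      with c assms have "(\<Sum>e\<in>?m ` monomials_of_degree v \<alpha>. scale_poly (c e) e) = 0" by blast
      hence z: "(\<Sum>u\<in>monomials_of_degree v \<alpha>. Poly_Mapping.single u (c (?m u))) = 0" by (simp only: sum)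
      from e obtain w where w: "w \<in> monomials_of_degree v \<alpha>" "e = ?m w" by blast
      have "Poly_Mapping.lookup (\<Sum>u\<in>monomials_of_degree v \<alpha>. Poly_Mapping.single u (c (?m u))) w = c (?m w)"
        using w fin by (simp add: lookup_sum lookup_single when_def sum.delta)
      thus ?thesis using z w by simp
    qed
    show "\<exists>c. f - (\<Sum>e\<in>?m ` monomials_of_degree v \<alpha>. scale_poly (c e) e) \<in> I"
      if "f \<in> graded_piece v \<alpha>" for f
    proof -
      have "f \<in> vs.span (?m ` monomials_of_degree v \<alpha>)" using that graded_piece_span by blast
      then obtain c where "f = (\<Sum>e\<in>?m ` monomials_of_degree v \<alpha>. scale_poly (c e) e)"
        using vs.span_finite[of "?m ` monomials_of_degree v \<alpha>"] fin by auto
      thus ?thesis using ideal.subspace_0[OF I] by (intro exI[of _ c]) simp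
    qed
  qed
  from hilbert_function_basis[OF this] show ?thesis using inj by (simp add: card_image)
qed

end


subsection \<open>Hilbert's Nullstellensatz\<close>

lemma poly_eq_sum_lessThan:
  fixes p :: "'a::comm_ring_1 poly"
  assumes "\<And>j. j \<ge> N \<Longrightarrow> coeff p j = 0"
  shows "poly p x = (\<Sum>j<N. coeff p j * x ^ j)"
proof -
  have "poly p x = (\<Sum>j\<le>degree p. coeff p j * x ^ j)" by (rule poly_altdef)
  also have "\<dots> = (\<Sum>j\<in>{..degree p} \<union> {..<N}. coeff p j * x ^ j)"
    by (rule sum.mono_neutral_left) (auto simp: coeff_eq_0)
  also have "\<dots> = (\<Sum>j<N. coeff p j * x ^ j)"
    by (rule sum.mono_neutral_right) (use assms in auto)
  finally show ?thesis .
qed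

text \<open>Working in a fixed ring relative to an ideal \<open>J\<close> takes the place of
  quotient rings. That \<open>J\<close> is proper appears separately, as
  \<open>1 \<notin> J\<close>.\<close>

locale algebra_ideal = algebra_map h for h :: "'k::alg_closed_field \<Rightarrow> 'a::comm_ring_1" +
  fixes J :: "'a set"
  assumes J: "is_ideal J"
begin

section \<open>Characters of subalgebras modulo an ideal\<close>

definition subalgebra :: "'a set \<Rightarrow> bool" where
  "subalgebra A \<longleftrightarrow> range h \<subseteq> A \<and> (\<forall>a\<in>A. \<forall>b\<in>A. a + b \<in> A \<and> a * b \<in> A)"

text \<open>An algebra homomorphism to the field from the image of \<open>A\<close> modulo
  \<open>J\<close>. The function is total, with arbitrary values outside \<open>A\<close>.\<close>

definition character :: "'a set \<Rightarrow> ('a \<Rightarrow> 'k) \<Rightarrow> bool" where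
  "character A \<phi> \<longleftrightarrow> (\<forall>a\<in>A. \<forall>b\<in>A. \<phi> (a + b) = \<phi> a + \<phi> b \<and> \<phi> (a * b) = \<phi> a * \<phi> b) \<and>
     (\<forall>c. \<phi> (h c) = c) \<and> (\<forall>a\<in>A \<inter> J. \<phi> a = 0)"

lemma h_uminus: "h (- a) = - h a"
  using h_add[of a "- a"] h_zero by (simp add: eq_neg_iff_add_eq_0 add.commute)

lemma subalgebraD:
  assumes "subalgebra A"
  shows "h c \<in> A" "0 \<in> A" "1 \<in> A" "a \<in> A \<Longrightarrow> b \<in> A \<Longrightarrow> a + b \<in> A" "a \<in> A \<Longrightarrow> b \<in> A \<Longrightarrow> a * b \<in> A"
    "a \<in> A \<Longrightarrow> - a \<in> A" "a \<in> A \<Longrightarrow> b \<in> A \<Longrightarrow> a - b \<in> A"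
proof -
  show hc: "h c \<in> A" for c using assms by (auto simp: subalgebra_def)
  show "0 \<in> A" "1 \<in> A" using hc[of 0] hc[of 1] by (simp_all add: h_zero h_one)
  show add: "a \<in> A \<Longrightarrow> b \<in> A \<Longrightarrow> a + b \<in> A" and mult: "a \<in> A \<Longrightarrow> b \<in> A \<Longrightarrow> a * b \<in> A" for a b
    using assms by (auto simp: subalgebra_def)
  show neg: "a \<in> A \<Longrightarrow> - a \<in> A" for a
    using mult[OF hc[of "- 1"], of a] by (simp add: h_uminus h_one)
  show "a \<in> A \<Longrightarrow> b \<in> A \<Longrightarrow> a - b \<in> A" using add[of a "- b"] neg[of b] by simp
qed

lemma subalgebra_sum: "subalgebra A \<Longrightarrow> (\<And>i. i \<in> B \<Longrightarrow> f i \<in> A) \<Longrightarrow> sum f B \<in> A"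
  by (induction B rule: infinite_finite_induct) (auto intro: subalgebraD)

lemma subalgebra_prod: "subalgebra A \<Longrightarrow> (\<And>i. i \<in> B \<Longrightarrow> f i \<in> A) \<Longrightarrow> prod f B \<in> A"
  by (induction B rule: infinite_finite_induct) (auto intro: subalgebraD)

lemma subalgebra_power: "subalgebra A \<Longrightarrow> a \<in> A \<Longrightarrow> a ^ n \<in> A"
  by (induction n) (auto intro: subalgebraD)

lemma characterD:
  assumes "subalgebra A" "character A \<phi>"
  shows "\<phi> (h c) = c" "\<phi> 0 = 0" "\<phi> 1 = 1"
    "a \<in> A \<Longrightarrow> b \<in> A \<Longrightarrow> \<phi> (a + b) = \<phi> a + \<phi> b" "a \<in> A \<Longrightarrow> b \<in> A \<Longrightarrow> \<phi> (a * b) = \<phi> a * \<phi> b"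
    "a \<in> A \<Longrightarrow> a \<in> J \<Longrightarrow> \<phi> a = 0" "a \<in> A \<Longrightarrow> b \<in> A \<Longrightarrow> \<phi> (a - b) = \<phi> a - \<phi> b"
proof -
  note A = subalgebraD[OF assms(1)]
  show hc: "\<phi> (h c) = c" for c using assms(2) by (auto simp: character_def)
  show "\<phi> 0 = 0" "\<phi> 1 = 1" using hc[of 0] hc[of 1] by (simp_all add: h_zero h_one)
  show add: "a \<in> A \<Longrightarrow> b \<in> A \<Longrightarrow> \<phi> (a + b) = \<phi> a + \<phi> b"
    and "a \<in> A \<Longrightarrow> b \<in> A \<Longrightarrow> \<phi> (a * b) = \<phi> a * \<phi> b" for a b
    using assms(2) by (auto simp: character_def)
  show "a \<in> A \<Longrightarrow> a \<in> J \<Longrightarrow> \<phi> a = 0" using assms(2) by (auto simp: character_def)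
  show "a \<in> A \<Longrightarrow> b \<in> A \<Longrightarrow> \<phi> (a - b) = \<phi> a - \<phi> b"
    using add[of "a - b" b] A(7)[of a b] by simp
qed

lemma character_sum:
  assumes "subalgebra A" "character A \<phi>" "\<And>i. i \<in> B \<Longrightarrow> f i \<in> A"
  shows "\<phi> (sum f B) = (\<Sum>i\<in>B. \<phi> (f i))"
  using assms(3)
proof (induction B rule: infinite_finite_induct)
  case (insert x F)
  have "sum f F \<in> A" by (rule subalgebra_sum[OF assms(1)]) (use insert in auto)
  thus ?case using insert by (simp add: characterD(4)[OF assms(1,2)])
qed (simp_all add: characterD(2)[OF assms(1,2)])

text \<open>A division-free form of Gaussian elimination. Under \<phi> the matrix becomes lower
  unitriangular, so the last diagonal entry \<open>p\<close> has character 1. Cross-multiplying to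
  clear the last column alters the other entries only by products with \<open>M i e\<close>, whose
  character is 0, so the shape is preserved. The factor \<open>a\<close> is the product of the
  successive pivots.\<close>

lemma triangular_elimination:
  fixes e :: nat
  assumes A: "subalgebra A" and \<phi>: "character A \<phi>"
    and "\<And>i j. i < e \<Longrightarrow> j < e \<Longrightarrow> M i j \<in> A"
    and "\<And>i. i < e \<Longrightarrow> (\<Sum>j<e. M i j * m j) \<in> J"
    and "\<And>i. i < e \<Longrightarrow> \<phi> (M i i) = 1"
    and "\<And>i j. i < j \<Longrightarrow> j < e \<Longrightarrow> \<phi> (M i j) = 0"
  shows "\<exists>a\<in>A. \<phi> a = 1 \<and> (\<forall>j<e. a * m j \<in> J)"
  using assms(3-)
proof (induction e arbitrary: M)
  case 0
  show ?case using subalgebraD(3)[OF A] characterD(3)[OF A \<phi>] by auto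
next
  case (Suc e)
  define p where "p = M e e"
  define M' where "M' = (\<lambda>i j. p * M i j - M i e * M e j)"
  have p: "p \<in> A" "\<phi> p = 1" using Suc.prems by (auto simp: p_def)
  have \<phi>M': "\<phi> (M' i j) = \<phi> (M i j)" if "i < e" "j < e" for i j
  proof -
    have in_A: "M i j \<in> A" "M i e \<in> A" "M e j \<in> A" using that Suc.prems(1) by auto
    have "\<phi> (M' i j) = \<phi> p * \<phi> (M i j) - \<phi> (M i e) * \<phi> (M e j)"
      unfolding M'_def using in_A p(1)
      by (simp add: characterD(5,7)[OF A \<phi>] subalgebraD(5)[OF A])
    thus ?thesis using p(2) Suc.prems(4)[of i e] that by simp
  qed
  have "\<exists>a\<in>A. \<phi> a = 1 \<and> (\<forall>j<e. a * m j \<in> J)"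
  proof (rule Suc.IH[of M'])
    show "M' i j \<in> A" if "i < e" "j < e" for i j
      unfolding M'_def using that p(1) Suc.prems(1) by (intro subalgebraD(5,7)[OF A]) auto
    show "\<phi> (M' i i) = 1" if "i < e" for i using \<phi>M' Suc.prems(3) that by simp
    show "\<phi> (M' i j) = 0" if "i < j" "j < e" for i j using \<phi>M' Suc.prems(4)[of i j] that by simp
    show "(\<Sum>j<e. M' i j * m j) \<in> J" if "i < e" for i
    proof -
      have "(\<Sum>j<e. M' i j * m j) = p * (\<Sum>j<e. M i j * m j) - M i e * (\<Sum>j<e. M e j * m j)"
        by (simp add: M'_def sum_distrib_left sum_subtractf left_diff_distrib mult.assoc)
      also have "\<dots> = p * (\<Sum>j<Suc e. M i j * m j) - M i e * (\<Sum>j<Suc e. M e j * m j)"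
        by (simp add: p_def algebra_simps)
      also have "\<dots> \<in> J"
        using that by (intro ideal.subspace_diff[OF J] ideal.subspace_scale[OF J] Suc.prems(2)) auto
      finally show ?thesis .
    qed
  qed
  then obtain a where a: "a \<in> A" "\<phi> a = 1" "\<And>j. j < e \<Longrightarrow> a * m j \<in> J" by blast
  have "a * p * m j \<in> J" if "j < Suc e" for j
  proof (cases "j = e")
    case True
    have "a * p * m j = a * (\<Sum>j<Suc e. M e j * m j) - (\<Sum>j<e. M e j * (a * m j))"
      by (simp add: True p_def sum_distrib_left algebra_simps)
    also have "\<dots> \<in> J"
      by (intro ideal.subspace_diff[OF J] ideal.subspace_scale[OF J] ideal.subspace_sum[OF J] Suc.prems(2) a(3)) auto
    finally show ?thesis .
  next
    case False
    hence "p * (a * m j) \<in> J" using that by (intro ideal.subspace_scale[OF J] a(3)) simp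
    thus ?thesis by (simp add: mult_ac)
  qed
  moreover have "a * p \<in> A" "\<phi> (a * p) = 1"
    using a p by (auto simp: characterD(5)[OF A \<phi>] intro: subalgebraD[OF A])
  ultimately show ?case by blast
qed

section \<open>Extending a character to an element that is integral modulo the ideal\<close>

definition polys_over :: "'a set \<Rightarrow> 'a poly set" where
  "polys_over A = {f. \<forall>i. coeff f i \<in> A}"

definition adjoin :: "'a set \<Rightarrow> 'a \<Rightarrow> 'a set" where
  "adjoin A z = (\<lambda>f. poly f z) ` polys_over A"

lemma polys_over_add: "subalgebra A \<Longrightarrow> f \<in> polys_over A \<Longrightarrow> g \<in> polys_over A \<Longrightarrow> f + g \<in> polys_over A"
  and polys_over_diff: "subalgebra A \<Longrightarrow> f \<in> polys_over A \<Longrightarrow> g \<in> polys_over A \<Longrightarrow> f - g \<in> polys_over A"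
  and polys_over_mult: "subalgebra A \<Longrightarrow> f \<in> polys_over A \<Longrightarrow> g \<in> polys_over A \<Longrightarrow> f * g \<in> polys_over A"
  by (auto simp: polys_over_def coeff_mult intro!: subalgebraD subalgebra_sum)

lemma polys_over_monom: "subalgebra A \<Longrightarrow> a \<in> A \<Longrightarrow> monom a n \<in> polys_over A"
  by (auto simp: polys_over_def intro: subalgebraD)

lemma polys_over_smult: "subalgebra A \<Longrightarrow> a \<in> A \<Longrightarrow> f \<in> polys_over A \<Longrightarrow> smult a f \<in> polys_over A"
  by (auto simp: polys_over_def intro: subalgebraD)

lemma polys_over_const: "subalgebra A \<Longrightarrow> a \<in> A \<Longrightarrow> [:a:] \<in> polys_over A"
  using polys_over_monom[of A a 0] by (simp add: monom_0)

lemma polys_over_sum: "subalgebra A \<Longrightarrow> (\<And>i. i \<in> B \<Longrightarrow> f i \<in> polys_over A) \<Longrightarrow> sum f B \<in> polys_over A"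
  using polys_over_const[of A 0] subalgebraD(2)[of A]
  by (induction B rule: infinite_finite_induct) (auto intro: polys_over_add)

lemma polys_over_power: "subalgebra A \<Longrightarrow> f \<in> polys_over A \<Longrightarrow> f ^ n \<in> polys_over A"
  using polys_over_const[of A 1] subalgebraD(3)[of A]
  by (induction n) (auto intro: polys_over_mult simp: one_pCons)

lemma polys_over_prod: "subalgebra A \<Longrightarrow> (\<And>i. i \<in> B \<Longrightarrow> f i \<in> polys_over A) \<Longrightarrow> prod f B \<in> polys_over A"
  using polys_over_const[of A 1] subalgebraD(3)[of A]
  by (induction B rule: infinite_finite_induct) (auto intro: polys_over_mult simp: one_pCons)

lemma subalgebra_adjoin:
  assumes "subalgebra A"
  shows "subalgebra (adjoin A z)" "A \<subseteq> adjoin A z" "z \<in> adjoin A z"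
proof -
  show A: "A \<subseteq> adjoin A z"
  proof
    fix a assume "a \<in> A"
    have "a = poly [:a:] z" by simp
    thus "a \<in> adjoin A z" unfolding adjoin_def using polys_over_const[OF assms \<open>a \<in> A\<close>] by blast
  qed
  have "z = poly (monom 1 1) z" by (simp add: poly_monom)
  thus "z \<in> adjoin A z" unfolding adjoin_def using polys_over_monom[OF assms subalgebraD(3)[OF assms]] by blast
  show "subalgebra (adjoin A z)" unfolding subalgebra_def
  proof (intro conjI ballI)
    show "range h \<subseteq> adjoin A z" using A subalgebraD(1)[OF assms] by blast
    fix a b assume "a \<in> adjoin A z" "b \<in> adjoin A z"
    then obtain f g where "f \<in> polys_over A" "g \<in> polys_over A" "a = poly f z" "b = poly g z"
      unfolding adjoin_def by blast
    moreover from this have "a + b = poly (f + g) z" "a * b = poly (f * g) z" by simp_all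
    ultimately show "a + b \<in> adjoin A z" "a * b \<in> adjoin A z"
      unfolding adjoin_def using assms by (blast intro: polys_over_add polys_over_mult)+
  qed
qed

text \<open>The rows of the matrix are the products of \<open>f\<close> and \<open>g\<close> with powers of the variable, as in
  the Sylvester matrix; modulo the kernel of \<open>\<phi>\<close> it is unitriangular.\<close>

lemma no_unit_relation:
  assumes A: "subalgebra A" and \<phi>: "character A \<phi>"
    and g: "g \<in> polys_over A" "poly g z \<in> J" "coeff g e = 1" "\<And>j. j > e \<Longrightarrow> coeff g j = 0"
    and f: "f \<in> polys_over A" "poly f z \<in> J" "\<phi> (coeff f 0) = 1" "\<And>j. j > 0 \<Longrightarrow> \<phi> (coeff f j) = 0"
  shows False
proof -
  \<comment> \<open>The successor keeps \<open>d + e\<close> positive, so that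
    \<open>z ^ 0 = 1\<close> is among the powers even if \<open>f\<close> is constant and
    \<open>e = 0\<close>. This power gives the contradiction: \<open>a\<close> itself lies in
    \<open>J\<close> but has character 1.\<close>
  define d where "d = Suc (degree f)"
  define M where "M = (\<lambda>i j. if i < e then coeff (monom 1 i * f) j else coeff (monom 1 (i - e) * g) j)"
  have "\<exists>a\<in>A. \<phi> a = 1 \<and> (\<forall>j<d + e. a * z ^ j \<in> J)"
  proof (rule triangular_elimination[OF A \<phi>, where M = M])
    show "M i j \<in> A" for i j
      using f(1) g(1) subalgebraD(2)[OF A] by (auto simp: M_def coeff_monom_mult polys_over_def)
    show "\<phi> (M i i) = 1" for i
      using f(3) g(3) characterD(3)[OF A \<phi>] by (auto simp: M_def coeff_monom_mult)
    show "\<phi> (M i j) = 0" if "i < j" for i j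
      using f(4)[of "j - i"] g(4)[of "j - (i - e)"] that characterD(2)[OF A \<phi>]
      by (auto simp: M_def coeff_monom_mult)
    show "(\<Sum>j<d + e. M i j * z ^ j) \<in> J" if "i < d + e" for i
    proof (cases "i < e")
      case True
      have "poly (monom 1 i * f) z = (\<Sum>j<d + e. coeff (monom 1 i * f) j * z ^ j)"
        by (rule poly_eq_sum_lessThan) (use True in \<open>auto simp: coeff_monom_mult d_def coeff_eq_0\<close>)
      hence "(\<Sum>j<d + e. M i j * z ^ j) = z ^ i * poly f z" using True by (simp add: M_def poly_monom)
      thus ?thesis using ideal.subspace_scale[OF J f(2)] by simp
    next
      case False
      have "poly (monom 1 (i - e) * g) z = (\<Sum>j<d + e. coeff (monom 1 (i - e) * g) j * z ^ j)"
        by (rule poly_eq_sum_lessThan)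
           (use False that g(4) in \<open>auto simp: coeff_monom_mult d_def\<close>)
      hence "(\<Sum>j<d + e. M i j * z ^ j) = z ^ (i - e) * poly g z" using False by (simp add: M_def poly_monom)
      thus ?thesis using ideal.subspace_scale[OF J g(2)] by simp
    qed
  qed
  then obtain a where "a \<in> A" "\<phi> a = 1" "a * z ^ 0 \<in> J" unfolding d_def by blast
  thus False using characterD(6)[OF A \<phi>, of a] by simp
qed

context
  fixes A \<phi> assumes A: "subalgebra A" and \<phi>: "character A \<phi>"
begin

lemma coeff_map_character: "coeff (map_poly \<phi> f) i = \<phi> (coeff f i)"
  by (rule coeff_map_poly) (rule characterD(2)[OF A \<phi>])

lemma map_character_add:
  "f \<in> polys_over A \<Longrightarrow> g \<in> polys_over A \<Longrightarrow> map_poly \<phi> (f + g) = map_poly \<phi> f + map_poly \<phi> g"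
  and map_character_diff:
  "f \<in> polys_over A \<Longrightarrow> g \<in> polys_over A \<Longrightarrow> map_poly \<phi> (f - g) = map_poly \<phi> f - map_poly \<phi> g"
  by (rule poly_eqI, simp add: coeff_map_character polys_over_def characterD(4,7)[OF A \<phi>])+

lemma map_character_mult:
  assumes "f \<in> polys_over A" "g \<in> polys_over A"
  shows "map_poly \<phi> (f * g) = map_poly \<phi> f * map_poly \<phi> g"
proof (rule poly_eqI)
  fix n
  have "\<phi> (\<Sum>i\<le>n. coeff f i * coeff g (n - i)) = (\<Sum>i\<le>n. \<phi> (coeff f i * coeff g (n - i)))"
    by (rule character_sum[OF A \<phi>]) (use assms in \<open>auto simp: polys_over_def intro: subalgebraD[OF A]\<close>)
  also have "\<dots> = (\<Sum>i\<le>n. \<phi> (coeff f i) * \<phi> (coeff g (n - i)))"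
    using assms by (simp add: polys_over_def characterD(5)[OF A \<phi>])
  finally show "coeff (map_poly \<phi> (f * g)) n = coeff (map_poly \<phi> f * map_poly \<phi> g) n"
    by (simp add: coeff_map_character coeff_mult)
qed

lemma map_poly_h: "map_poly h q \<in> polys_over A" "map_poly \<phi> (map_poly h q) = q"
proof -
  have c: "coeff (map_poly h q) i = h (coeff q i)" for i by (rule coeff_map_poly) (rule h_zero)
  show "map_poly h q \<in> polys_over A" by (simp add: polys_over_def c subalgebraD(1)[OF A])
  show "map_poly \<phi> (map_poly h q) = q"
    by (rule poly_eqI) (simp add: coeff_map_character c characterD(1)[OF A \<phi>])
qed

text \<open>The images under \<phi> of the polynomials over \<open>A\<close> that vanish at
  \<open>z\<close> modulo \<open>J\<close> form an ideal of the polynomial ring over the field. The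
  monic relation \<open>g\<close> makes it nonzero and, by \<open>no_unit_relation\<close>, proper.
  Its member of least degree generates it and has a root because the field is algebraically
  closed.\<close>

lemma common_root_of_relations:
  assumes g: "g \<in> polys_over A" "poly g z \<in> J" "coeff g e = 1" "\<And>j. j > e \<Longrightarrow> coeff g j = 0"
  obtains t where "\<And>f. f \<in> polys_over A \<Longrightarrow> poly f z \<in> J \<Longrightarrow> poly (map_poly \<phi> f) t = 0"
proof -
  define R where "R = {f \<in> polys_over A. poly f z \<in> J}"
  have gR: "g \<in> R" "map_poly \<phi> g \<noteq> 0"
    using g coeff_map_character[of g e] characterD(3)[OF A \<phi>] by (auto simp: R_def)
  define n where "n = (LEAST n. \<exists>f\<in>R. map_poly \<phi> f \<noteq> 0 \<and> degree (map_poly \<phi> f) = n)"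
  have "\<exists>f\<in>R. map_poly \<phi> f \<noteq> 0 \<and> degree (map_poly \<phi> f) = n"
    unfolding n_def by (rule LeastI_ex) (use gR in blast)
  then obtain f where f: "f \<in> R" "map_poly \<phi> f \<noteq> 0" "degree (map_poly \<phi> f) = n" by blast
  have min: "degree (map_poly \<phi> f) \<le> degree (map_poly \<phi> f')" if "f' \<in> R" "map_poly \<phi> f' \<noteq> 0" for f'
    unfolding f(3) unfolding n_def by (rule Least_le) (use that in blast)
  have dvd: "map_poly \<phi> f dvd map_poly \<phi> f'" if f': "f' \<in> R" for f'
  proof -
    define q where "q = map_poly \<phi> f' div map_poly \<phi> f"
    \<comment> \<open>The quotient \<open>q\<close> has coefficients in the field;
      \<open>map_poly h\<close> lifts it to \<open>A\<close>, so that the remainder is again the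
      image of a relation.\<close>
    define r where "r = f' - map_poly h q * f"
    have "f \<in> polys_over A" "f' \<in> polys_over A" using f f' by (auto simp: R_def)
    moreover from this have m: "map_poly h q * f \<in> polys_over A"
      by (intro polys_over_mult[OF A] map_poly_h)
    ultimately have r: "r \<in> polys_over A" "map_poly \<phi> r = map_poly \<phi> f' - q * map_poly \<phi> f"
      unfolding r_def using polys_over_diff[OF A] map_character_diff map_character_mult[OF map_poly_h(1)] map_poly_h(2)
      by simp_all
    have "poly r z = poly f' z - poly (map_poly h q) z * poly f z" by (simp add: r_def)
    also have "\<dots> \<in> J"
      using f(1) f' by (intro ideal.subspace_diff[OF J] ideal.subspace_scale[OF J]) (auto simp: R_def)
    finally have "r \<in> R" using r by (simp add: R_def)
    moreover have eq: "map_poly \<phi> r = map_poly \<phi> f' mod map_poly \<phi> f"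
      unfolding r(2) q_def by (simp add: minus_div_mult_eq_mod)
    ultimately have "map_poly \<phi> f' mod map_poly \<phi> f = 0"
      using min[of r] degree_mod_less[OF f(2), of "map_poly \<phi> f'"] by (metis not_less)
    thus ?thesis by (simp add: mod_eq_0_iff_dvd)
  qed
  have "degree (map_poly \<phi> f) \<noteq> 0"
  proof
    assume deg: "degree (map_poly \<phi> f) = 0"
    then obtain c where c: "map_poly \<phi> f = [:c:]" by (rule degree_eq_zeroE)
    hence c0: "c \<noteq> 0" using f(2) by auto
    \<comment> \<open>A constant image is scaled to 1, the shape that
      \<open>no_unit_relation\<close> excludes.\<close>
    define f1 where "f1 = smult (h (inverse c)) f"
    have fA: "f \<in> polys_over A" using f by (simp add: R_def)
    have cf1: "\<phi> (coeff f1 i) = inverse c * coeff [:c:] i" for i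
      using fA unfolding c[symmetric] by (simp add: f1_def characterD(1,5)[OF A \<phi>] subalgebraD(1)[OF A] polys_over_def coeff_map_character)
    show False
    proof (rule no_unit_relation[OF A \<phi> g])
      show "f1 \<in> polys_over A" unfolding f1_def by (rule polys_over_smult[OF A subalgebraD(1)[OF A] fA])
      show "poly f1 z \<in> J" using f(1) ideal.subspace_scale[OF J] by (simp add: f1_def R_def)
      show "\<phi> (coeff f1 0) = 1" using cf1[of 0] c0 by simp
      show "\<phi> (coeff f1 j) = 0" if "j > 0" for j using cf1[of j] that by (simp add: coeff_pCons split: nat.splits)
    qed
  qed
  then obtain t where "poly (map_poly \<phi> f) t = 0" using alg_closed_imp_poly_has_root by blast
  hence "poly (map_poly \<phi> f') t = 0" if "f' \<in> R" for f'
    using dvd[OF that] by (auto elim!: dvdE)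
  thus ?thesis by (intro that[of t]) (auto simp: R_def)
qed

text \<open>The extension sends \<open>z\<close> to the common root \<open>t\<close>. Two
  polynomials with the same value at \<open>z\<close> differ by a relation, whose image vanishes at
  \<open>t\<close>, so the choice of \<open>lift\<close> does not matter.\<close>

lemma character_extend:
  assumes g: "g \<in> polys_over A" "poly g z \<in> J" "coeff g e = 1" "\<And>j. j > e \<Longrightarrow> coeff g j = 0"
  shows "\<exists>\<psi>. character (adjoin A z) \<psi>"
proof -
  obtain t where t: "\<And>f. f \<in> polys_over A \<Longrightarrow> poly f z \<in> J \<Longrightarrow> poly (map_poly \<phi> f) t = 0"
    using common_root_of_relations[OF g] by blast
  define lift where "lift = (\<lambda>b. SOME f. f \<in> polys_over A \<and> poly f z = b)"
  define \<psi> where "\<psi> = (\<lambda>b. poly (map_poly \<phi> (lift b)) t)"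
  have lift: "lift b \<in> polys_over A \<and> poly (lift b) z = b" if "b \<in> adjoin A z" for b
    unfolding lift_def by (rule someI_ex) (use that in \<open>auto simp: adjoin_def\<close>)
  have \<psi>: "\<psi> (poly f z) = poly (map_poly \<phi> f) t" if f: "f \<in> polys_over A" for f
  proof -
    have l: "lift (poly f z) \<in> polys_over A" "poly (lift (poly f z)) z = poly f z"
      using lift[of "poly f z"] f by (auto simp: adjoin_def)
    have "poly (map_poly \<phi> (lift (poly f z) - f)) t = 0"
      by (rule t) (use l f ideal.subspace_0[OF J] in \<open>auto intro: polys_over_diff[OF A]\<close>)
    thus ?thesis using l f by (simp add: \<psi>_def map_character_diff)
  qed
  have "character (adjoin A z) \<psi>" unfolding character_def
  proof (intro conjI ballI allI)
    show "\<psi> (h c) = c" for c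
    proof -
      have "\<psi> (h c) = \<psi> (poly [:h c:] z)" by simp
      also have "\<dots> = poly (map_poly \<phi> [:h c:]) t"
        by (rule \<psi>) (rule polys_over_const[OF A subalgebraD(1)[OF A]])
      also have "\<dots> = c" using characterD(1)[OF A \<phi>, of c] characterD(2)[OF A \<phi>] by (simp add: map_poly_pCons)
      finally show ?thesis .
    qed
    show "\<psi> a = 0" if "a \<in> adjoin A z \<inter> J" for a
      unfolding \<psi>_def by (rule t) (use that lift[of a] in auto)
    fix a b assume "a \<in> adjoin A z" "b \<in> adjoin A z"
    then obtain f f' where f: "f \<in> polys_over A" "f' \<in> polys_over A" and ab: "a = poly f z" "b = poly f' z"
      by (auto simp: adjoin_def)
    show "\<psi> (a + b) = \<psi> a + \<psi> b"
      using \<psi>[OF polys_over_add[OF A f]] f by (simp add: ab \<psi> map_character_add)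
    show "\<psi> (a * b) = \<psi> a * \<psi> b"
      using \<psi>[OF polys_over_mult[OF A f]] f by (simp add: ab \<psi> map_character_mult)
  qed
  thus ?thesis by blast
qed

end

end


text \<open>Two different exponent vectors give the polynomial
  \<open>\<Sum>i. (u i - w i) X ^ e i\<close>, which is nonzero because \<open>e\<close> does not
  merge variables. \<open>N\<close> avoids the finitely many roots of all these polynomials.\<close>

lemma weights_separating_exponents:
  fixes S :: "('i \<Rightarrow>\<^sub>0 nat) set" and e :: "'i \<Rightarrow> nat"
  assumes "finite S" "finite V" "inj_on e V"
    and supp: "\<And>u i. u \<in> S \<Longrightarrow> i \<notin> V \<Longrightarrow> Poly_Mapping.lookup u i = 0"
  obtains N where "N > 0" "inj_on (\<lambda>u. \<Sum>i\<in>V. Poly_Mapping.lookup u i * N ^ e i) S"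
proof -
  define D where "D = (\<lambda>(u, w). \<Sum>i\<in>V. monom (int (Poly_Mapping.lookup u i) - int (Poly_Mapping.lookup w i)) (e i))"
  let ?S2 = "{p \<in> S \<times> S. fst p \<noteq> snd p}"
  have nz: "D (u, w) \<noteq> 0" if "u \<in> S" "w \<in> S" "u \<noteq> w" for u w
  proof -
    from \<open>u \<noteq> w\<close> obtain k where k: "Poly_Mapping.lookup u k \<noteq> Poly_Mapping.lookup w k"
      by (meson poly_mapping_eqI)
    hence kV: "k \<in> V" using supp[OF that(1)] supp[OF that(2)] by metis
    have "coeff (D (u, w)) (e k) = (\<Sum>i\<in>V. if i = k then int (Poly_Mapping.lookup u i) - int (Poly_Mapping.lookup w i) else 0)"
      unfolding D_def prod.case coeff_sum
      by (rule sum.cong) (use assms(3) kV in \<open>auto simp: inj_on_def\<close>)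
    also have "\<dots> = int (Poly_Mapping.lookup u k) - int (Poly_Mapping.lookup w k)"
      using assms(2) kV by simp
    finally show ?thesis using k by auto
  qed
  have "finite (\<Union>p\<in>?S2. {x. poly (D p) x = 0})"
    by (rule finite_UN_I) (use assms(1) nz in \<open>auto intro!: poly_roots_finite\<close>)
  \<comment> \<open>Inserting 0 forces \<open>N > 0\<close>. Negative roots are sent to 0 by
    \<open>nat\<close> and do no harm.\<close>
  hence fin: "finite (insert 0 (nat ` (\<Union>p\<in>?S2. {x. poly (D p) x = 0})))" by simp
  obtain N where N: "N \<notin> insert 0 (nat ` (\<Union>p\<in>?S2. {x. poly (D p) x = 0}))"
    using ex_new_if_finite[OF _ fin] infinite_UNIV_nat by blast
  have "inj_on (\<lambda>u. \<Sum>i\<in>V. Poly_Mapping.lookup u i * N ^ e i) S"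
  proof (rule inj_onI, rule ccontr)
    fix u w assume uw: "u \<in> S" "w \<in> S" "u \<noteq> w"
      and eq: "(\<Sum>i\<in>V. Poly_Mapping.lookup u i * N ^ e i) = (\<Sum>i\<in>V. Poly_Mapping.lookup w i * N ^ e i)"
    have "poly (D (u, w)) (int N) = (\<Sum>i\<in>V. (int (Poly_Mapping.lookup u i) - int (Poly_Mapping.lookup w i)) * int N ^ e i)"
      by (simp add: D_def poly_sum poly_monom)
    also have "\<dots> = int (\<Sum>i\<in>V. Poly_Mapping.lookup u i * N ^ e i) - int (\<Sum>i\<in>V. Poly_Mapping.lookup w i * N ^ e i)"
      by (simp add: left_diff_distrib sum_subtractf)
    also have "\<dots> = 0" using eq by simp
    finally have "int N \<in> (\<Union>p\<in>?S2. {x. poly (D p) x = 0})" using uw by force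
    hence "nat (int N) \<in> nat ` (\<Union>p\<in>?S2. {x. poly (D p) x = 0})" by (rule imageI)
    thus False using N by simp
  qed
  thus ?thesis using N by (intro that[of N]) auto
qed

definition monic_of_degree :: "nat \<Rightarrow> 'a::comm_ring_1 poly \<Rightarrow> bool" where
  "monic_of_degree n p \<longleftrightarrow> coeff p n = 1 \<and> (\<forall>j>n. coeff p j = 0)"

lemma monic_of_degree_mult:
  assumes "monic_of_degree m p" "monic_of_degree n q"
  shows "monic_of_degree (m + n) (p * q)"
proof -
  have "coeff (p * q) k = (if k = m + n then 1 else 0)" if "k \<ge> m + n" for k
  proof -
    have "coeff p i * coeff q (k - i) = (if i = m then (if k = m + n then 1 else 0) else 0)" for i
    proof (cases "i > m \<or> k - i > n")
      case True
      hence "coeff p i * coeff q (k - i) = 0"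
        using assms by (auto simp: monic_of_degree_def)
      thus ?thesis using True that by auto
    next
      case False
      hence "i = m" "k - i = n" "k = m + n" using that by auto
      thus ?thesis using assms by (simp add: monic_of_degree_def)
    qed
    thus ?thesis using that by (simp add: coeff_mult)
  qed
  thus ?thesis by (simp add: monic_of_degree_def)
qed

lemma monic_of_degree_power: "monic_of_degree m p \<Longrightarrow> monic_of_degree (k * m) (p ^ k)"
  by (induction k) (auto intro: monic_of_degree_mult simp: monic_of_degree_def[of 0])

lemma monic_of_degree_prod:
  "finite A \<Longrightarrow> (\<And>i. i \<in> A \<Longrightarrow> monic_of_degree (d i) (p i)) \<Longrightarrow> monic_of_degree (\<Sum>i\<in>A. d i) (\<Prod>i\<in>A. p i)"
  by (induction A rule: finite_induct) (auto intro: monic_of_degree_mult simp: monic_of_degree_def[of 0])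

context algebra_ideal
begin

definition generated :: "'i::finite set \<Rightarrow> ('i \<Rightarrow> 'a) \<Rightarrow> 'a set" where
  "generated V x = ev x ` {P. \<forall>u\<in>Poly_Mapping.keys P. \<forall>i. i \<notin> V \<longrightarrow> Poly_Mapping.lookup u i = 0}"

lemma generated_subset:
  assumes "subalgebra A" "\<And>i. i \<in> V \<Longrightarrow> x i \<in> A"
  shows "generated V x \<subseteq> A"
proof -
  have "ev x P \<in> A" if P: "\<forall>u\<in>Poly_Mapping.keys P. \<forall>i. i \<notin> V \<longrightarrow> Poly_Mapping.lookup u i = 0" for P
    unfolding ev_def
  proof (intro subalgebra_sum[OF assms(1)] subalgebraD(5)[OF assms(1)] subalgebra_prod[OF assms(1)])
    fix u i assume u: "u \<in> Poly_Mapping.keys P"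
    show "x i ^ Poly_Mapping.lookup u i \<in> A"
      using P u assms(2)[of i] subalgebra_power[OF assms(1), of "x i"] subalgebraD(3)[OF assms(1)]
      by (cases "i \<in> V") auto
  qed (rule subalgebraD(1)[OF assms(1)])
  thus ?thesis by (auto simp: generated_def)
qed

lemma subalgebra_generated: "subalgebra (generated V x)"
  and generated_var: "i \<in> V \<Longrightarrow> x i \<in> generated V x"
proof -
  show "i \<in> V \<Longrightarrow> x i \<in> generated V x"
    unfolding generated_def
    by (rule image_eqI[where x = "Poly_Mapping.single (Poly_Mapping.single i 1) 1"])
       (auto simp: ev_var[simplified] lookup_single when_def)
  show "subalgebra (generated V x)" unfolding subalgebra_def
  proof (intro conjI ballI subsetI)
    fix a assume "a \<in> range h"
    then obtain c where "a = h c" by blast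
    thus "a \<in> generated V x" unfolding generated_def
      by (intro image_eqI[where x = "Poly_Mapping.single 0 c"]) (auto simp: ev_const)
  next
    fix a b assume "a \<in> generated V x" "b \<in> generated V x"
    then obtain P Q where P: "\<forall>u\<in>Poly_Mapping.keys P. \<forall>i. i \<notin> V \<longrightarrow> Poly_Mapping.lookup u i = 0" "a = ev x P"
      and Q: "\<forall>u\<in>Poly_Mapping.keys Q. \<forall>i. i \<notin> V \<longrightarrow> Poly_Mapping.lookup u i = 0" "b = ev x Q"
      unfolding generated_def by blast
    have "a + b = ev x (P + Q)" by (simp add: P Q ev_add)
    moreover have "\<forall>u\<in>Poly_Mapping.keys (P + Q). \<forall>i. i \<notin> V \<longrightarrow> Poly_Mapping.lookup u i = 0"
      using P(1) Q(1) keys_add[of P Q] by blast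
    ultimately show "a + b \<in> generated V x" unfolding generated_def by blast
    have "a * b = ev x (P * Q)" by (simp add: P Q ev_mult)
    moreover have "\<forall>u\<in>Poly_Mapping.keys (P * Q). \<forall>i. i \<notin> V \<longrightarrow> Poly_Mapping.lookup u i = 0"
    proof (intro ballI allI impI)
      fix u i assume "u \<in> Poly_Mapping.keys (P * Q)" "i \<notin> V"
      from subsetD[OF keys_mult this(1)] obtain a b
        where "u = a + b" "a \<in> Poly_Mapping.keys P" "b \<in> Poly_Mapping.keys Q"
        by (elim CollectE exE conjE)
      thus "Poly_Mapping.lookup u i = 0" using P(1) Q(1) \<open>i \<notin> V\<close> by (simp add: lookup_add)
    qed
    ultimately show "a * b \<in> generated V x" unfolding generated_def by blast
  qed
qed

lemma character_subset: "character A \<phi> \<Longrightarrow> B \<subseteq> A \<Longrightarrow> character B \<phi>"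
  unfolding character_def by (intro conjI) blast+

text \<open>Without relations modulo \<open>J\<close> the generators behave like independent
  variables, so evaluation at the origin is well defined on their polynomial expressions.\<close>

lemma character_if_no_relation:
  fixes V :: "'i::finite set" and x :: "'i \<Rightarrow> 'a"
  assumes "1 \<notin> J"
    and no_rel: "\<And>P. \<forall>u\<in>Poly_Mapping.keys P. \<forall>i. i \<notin> V \<longrightarrow> Poly_Mapping.lookup u i = 0 \<Longrightarrow> ev x P \<in> J \<Longrightarrow> P = 0"
  shows "\<exists>\<phi>. character (generated V x) \<phi>"
proof -
  define T where "T = {P :: ('i \<Rightarrow>\<^sub>0 nat) \<Rightarrow>\<^sub>0 'k. \<forall>u\<in>Poly_Mapping.keys P. \<forall>i. i \<notin> V \<longrightarrow> Poly_Mapping.lookup u i = 0}"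
  have G: "generated V x = ev x ` T" by (simp add: generated_def T_def)
  define \<phi> where "\<phi> = (\<lambda>b. poly_eval (\<lambda>_. 0) (SOME P. P \<in> T \<and> ev x P = b))"
  have \<phi>: "\<phi> (ev x P) = poly_eval (\<lambda>_. 0) P" if P: "P \<in> T" for P
  proof -
    define Q where "Q = (SOME Q. Q \<in> T \<and> ev x Q = ev x P)"
    have Q: "Q \<in> T \<and> ev x Q = ev x P" unfolding Q_def by (rule someI_ex) (use P in blast)
    have "Q - P = 0"
    proof (rule no_rel)
      show "\<forall>u\<in>Poly_Mapping.keys (Q - P). \<forall>i. i \<notin> V \<longrightarrow> Poly_Mapping.lookup u i = 0"
        using P Q keys_diff[of Q P] by (auto simp: T_def)
      show "ev x (Q - P) \<in> J" using Q ideal.subspace_0[OF J] by (simp add: ev_diff)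
    qed
    thus ?thesis by (simp add: \<phi>_def Q_def[symmetric])
  qed
  have sub: "P + Q \<in> T" if "P \<in> T" "Q \<in> T" for P Q using that keys_add[of P Q] by (auto simp: T_def)
  have mul: "P * Q \<in> T" if "P \<in> T" "Q \<in> T" for P Q
    unfolding T_def
  proof (intro CollectI ballI allI impI)
    fix u i assume "u \<in> Poly_Mapping.keys (P * Q)" "i \<notin> V"
    from subsetD[OF keys_mult this(1)] obtain a b
      where "u = a + b" "a \<in> Poly_Mapping.keys P" "b \<in> Poly_Mapping.keys Q"
      by (elim CollectE exE conjE)
    thus "Poly_Mapping.lookup u i = 0" using that \<open>i \<notin> V\<close> by (simp add: lookup_add T_def)
  qed
  have "character (generated V x) \<phi>" unfolding character_def G
  proof (intro conjI ballI allI)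
    show "\<phi> (h c) = c" for c
    proof -
      have "Poly_Mapping.single 0 c \<in> T" by (auto simp: T_def)
      from \<phi>[OF this] show ?thesis by (simp add: ev_const poly_eval_single)
    qed
    show "\<phi> a = 0" if "a \<in> ev x ` T \<inter> J" for a
    proof -
      from that obtain P where P: "P \<in> T" "a = ev x P" "ev x P \<in> J" by auto
      hence "P = 0" using no_rel[of P] by (simp add: T_def)
      thus ?thesis using \<phi>[OF P(1)] by (simp add: P(2) poly_eval_zero)
    qed
    fix a b assume "a \<in> ev x ` T" "b \<in> ev x ` T"
    then obtain P Q where P: "P \<in> T" "Q \<in> T" "a = ev x P" "b = ev x Q" by blast
    show "\<phi> (a + b) = \<phi> a + \<phi> b"
      using \<phi>[OF sub[OF P(1,2)]] by (simp add: P \<phi> ev_add poly_eval_add)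
    show "\<phi> (a * b) = \<phi> a * \<phi> b"
      using \<phi>[OF mul[OF P(1,2)]] by (simp add: P \<phi> ev_mult poly_eval_mult)
  qed
  thus ?thesis by blast
qed

text \<open>Nagata's substitution \<open>x\<^sub>i = y\<^sub>i + z\<^bsup>N ^ e i\<^esup>\<close> makes the last variable \<open>z\<close> integral.\<close>

lemma character_generated:
  fixes V :: "'i::finite set" and x :: "'i \<Rightarrow> 'a"
  assumes "1 \<notin> J"
  shows "\<exists>\<phi>. character (generated V x) \<phi>"
  using finite[of V]
proof (induction V arbitrary: x rule: finite_induct)
  case empty
  show ?case
  proof (rule character_if_no_relation[OF assms])
    fix P :: "('i \<Rightarrow>\<^sub>0 nat) \<Rightarrow>\<^sub>0 'k"
    assume P: "\<forall>u\<in>Poly_Mapping.keys P. \<forall>i. i \<notin> {} \<longrightarrow> Poly_Mapping.lookup u i = 0" "ev x P \<in> J"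
    have keys: "Poly_Mapping.keys P \<subseteq> {0}"
    proof
      fix u assume "u \<in> Poly_Mapping.keys P"
      hence "u = 0" using P(1) by (intro poly_mapping_eqI) simp
      thus "u \<in> {0}" by simp
    qed
    define c where "c = Poly_Mapping.lookup P 0"
    have Pc: "P = Poly_Mapping.single 0 c"
    proof (rule poly_mapping_eqI)
      fix u show "Poly_Mapping.lookup P u = Poly_Mapping.lookup (Poly_Mapping.single 0 c) u"
        using keys by (cases "u = 0") (auto simp: c_def lookup_single when_def in_keys_iff)
    qed
    hence "h c \<in> J" using P(2) by (simp add: ev_const)
    hence "h (inverse c) * h c \<in> J" by (rule ideal.subspace_scale[OF J])
    hence "h (inverse c * c) \<in> J" by (simp add: h_mult)
    hence "c = 0" using assms h_one by (cases "c = 0") auto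
    thus "P = 0" using Pc by simp
  qed
next
  case (insert i0 V0)
  let ?V = "insert i0 V0"
  show ?case
  proof (cases "\<forall>P. (\<forall>u\<in>Poly_Mapping.keys P. \<forall>i. i \<notin> ?V \<longrightarrow> Poly_Mapping.lookup u i = 0) \<longrightarrow> ev x P \<in> J \<longrightarrow> P = 0")
    case True
    show ?thesis by (rule character_if_no_relation[OF assms]) (use True in blast)
  next
    case False
    then obtain P where P: "\<And>u i. u \<in> Poly_Mapping.keys P \<Longrightarrow> i \<notin> ?V \<Longrightarrow> Poly_Mapping.lookup u i = 0"
      "ev x P \<in> J" "P \<noteq> 0" by blast
    obtain e1 :: "'i \<Rightarrow> nat" where e1: "inj_on e1 V0"
      using finite_imp_inj_to_nat_seg[OF insert.hyps(1)] by blast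
    \<comment> \<open>The value \<open>e i0 = 0\<close> gives \<open>y i0 = x i0 - z = 0\<close>:
      the distinguished variable is \<open>z\<close> itself and adds nothing to \<open>A\<close>.
      The successor keeps the other exponents apart from it.\<close>
    define e where "e = (\<lambda>i. if i = i0 then 0 else Suc (e1 i))"
    have e: "inj_on e ?V" using e1 insert.hyps(2) by (auto simp: e_def inj_on_def)
    obtain N where N: "N > 0" "inj_on (\<lambda>u. \<Sum>i\<in>?V. Poly_Mapping.lookup u i * N ^ e i) (Poly_Mapping.keys P)"
      by (rule weights_separating_exponents[OF finite_keys[of P] finite[of ?V] e P(1)])
    define w where "w = (\<lambda>u. \<Sum>i\<in>?V. Poly_Mapping.lookup u i * N ^ e i)"
    define z where "z = x i0"
    define y where "y = (\<lambda>i. x i - z ^ (N ^ e i))"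
    obtain \<phi> where \<phi>: "character (generated V0 y) \<phi>" using insert.IH by blast
    define A where "A = generated V0 y"
    have A: "subalgebra A" unfolding A_def by (rule subalgebra_generated)
    have yA: "y i \<in> A" if "i \<in> ?V" for i
    proof (cases "i = i0")
      case True
      hence "y i = 0" by (simp add: y_def z_def e_def)
      thus ?thesis using subalgebraD(2)[OF A] by simp
    next
      case False
      thus ?thesis using that generated_var[of i V0 y] by (simp add: A_def)
    qed
    define q where "q = (\<lambda>i. monom 1 (N ^ e i) + [:y i:])"
    have q: "poly (q i) z = x i" for i by (simp add: q_def poly_monom y_def)
    have qA: "q i \<in> polys_over A" if "i \<in> ?V" for i
      unfolding q_def using yA[OF that]
      by (intro polys_over_add[OF A] polys_over_monom[OF A] polys_over_const[OF A] subalgebraD(3)[OF A])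
    have qm: "monic_of_degree (N ^ e i) (q i)" for i
      using N(1) by (auto simp: monic_of_degree_def q_def coeff_pCons split: nat.splits)
    \<comment> \<open>\<open>Q u\<close> is the monomial \<open>u\<close> after the substitution, as
      a polynomial in the new variable. It is monic, and its degree is the weight of
      \<open>u\<close>.\<close>
    define Q where "Q = (\<lambda>u. \<Prod>i\<in>?V. q i ^ Poly_Mapping.lookup u i)"
    have Qm: "monic_of_degree (w u) (Q u)" for u
      unfolding w_def Q_def
      by (rule monic_of_degree_prod[OF finite]) (rule monic_of_degree_power[OF qm])
    have QA: "Q u \<in> polys_over A" for u
      unfolding Q_def by (intro polys_over_prod[OF A] polys_over_power[OF A] qA)
    have Qz: "poly (Q u) z = (\<Prod>i\<in>UNIV. x i ^ Poly_Mapping.lookup u i)" if "u \<in> Poly_Mapping.keys P" for u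
    proof -
      have "poly (Q u) z = (\<Prod>i\<in>?V. x i ^ Poly_Mapping.lookup u i)"
        by (simp only: Q_def poly_prod poly_power q)
      also have "\<dots> = (\<Prod>i\<in>UNIV. x i ^ Poly_Mapping.lookup u i)"
        by (rule prod.mono_neutral_left) (use P(1)[OF that] in auto)
      finally show ?thesis .
    qed
    have "Poly_Mapping.keys P \<noteq> {}" using P(3) by (metis keys_eq_empty)
    then obtain u0 where u0: "u0 \<in> Poly_Mapping.keys P" "\<And>u. u \<in> Poly_Mapping.keys P \<Longrightarrow> w u \<le> w u0"
      using Max_in[of "w ` Poly_Mapping.keys P"] Max_ge[of "w ` Poly_Mapping.keys P"]
      by (metis (no_types, lifting) finite_imageI finite_keys image_iff image_is_empty)
    \<comment> \<open>The weights are distinct, so a single monomial reaches the top degree. The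
      leading coefficient is therefore a nonzero scalar, which \<open>g\<close> below divides
      out.\<close>
    have lt: "w u < w u0" if "u \<in> Poly_Mapping.keys P" "u \<noteq> u0" for u
      using u0(2)[OF that(1)] N(2) that u0(1) unfolding inj_on_def w_def by (metis le_neq_implies_less)
    define c where "c = Poly_Mapping.lookup P u0"
    have c: "c \<noteq> 0" using u0(1) by (simp add: c_def in_keys_iff)
    define g where "g = smult (h (inverse c)) (\<Sum>u\<in>Poly_Mapping.keys P. smult (h (Poly_Mapping.lookup P u)) (Q u))"
    have coeff_g: "coeff g j = h (inverse c) * (\<Sum>u\<in>Poly_Mapping.keys P. h (Poly_Mapping.lookup P u) * coeff (Q u) j)" for j
      by (simp add: g_def coeff_sum)
    have "\<exists>\<psi>. character (adjoin A z) \<psi>"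
    proof (rule character_extend[OF A \<phi>[folded A_def]])
      show "g \<in> polys_over A" unfolding g_def
        by (intro polys_over_smult[OF A] polys_over_sum[OF A] subalgebraD(1)[OF A] QA)
      have "poly g z = h (inverse c) * ev x P" by (simp add: g_def poly_sum ev_def Qz)
      thus "poly g z \<in> J" using ideal.subspace_scale[OF J P(2)] by simp
      have "(\<Sum>u\<in>Poly_Mapping.keys P. h (Poly_Mapping.lookup P u) * coeff (Q u) (w u0))
          = (\<Sum>u\<in>Poly_Mapping.keys P. if u = u0 then h c else 0)"
        using lt Qm by (intro sum.cong) (auto simp: monic_of_degree_def c_def)
      also have "\<dots> = h c" using u0(1) by simp
      finally show "coeff g (w u0) = 1" using c by (simp add: coeff_g h_mult[symmetric] h_one)
      show "coeff g j = 0" if "j > w u0" for j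
      proof -
        have "coeff (Q u) j = 0" if "u \<in> Poly_Mapping.keys P" for u
          using u0(2)[OF that] Qm[of u] \<open>j > w u0\<close> by (simp add: monic_of_degree_def)
        thus ?thesis by (simp add: coeff_g)
      qed
    qed
    then obtain \<psi> where \<psi>: "character (adjoin A z) \<psi>" by blast
    have "generated ?V x \<subseteq> adjoin A z"
    proof (rule generated_subset[OF subalgebra_adjoin(1)[OF A]])
      fix i assume "i \<in> ?V"
      from qA[OF this] q[of i] show "x i \<in> adjoin A z" unfolding adjoin_def by force
    qed
    from character_subset[OF \<psi> this] show ?thesis by blast
  qed
qed

end

subsubsection \<open>The trick of Rabinowitsch\<close>

lemma monom_prod: "(\<Prod>i\<in>A. monom_of (a i)) = monom_of (\<Sum>i\<in>A. a i)"
  by (induction A rule: infinite_finite_induct) (auto simp: mult_single)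

lemma monom_power: "monom_of (Poly_Mapping.single j 1) ^ n = monom_of (Poly_Mapping.single j n)"
  by (induction n) (auto simp: mult_single single_add[symmetric])

lemma single_eq_prod_vars:
  fixes u :: "'r::finite \<Rightarrow>\<^sub>0 nat"
  shows "Poly_Mapping.single u c
    = Poly_Mapping.single 0 c * (\<Prod>j\<in>UNIV. monom_of (Poly_Mapping.single j 1) ^ Poly_Mapping.lookup u j)"
proof -
  have "u = (\<Sum>j\<in>UNIV. Poly_Mapping.single j (Poly_Mapping.lookup u j))"
    by (rule poly_mapping_eqI) (simp add: lookup_sum lookup_single when_def)
  hence u: "(\<Sum>j\<in>UNIV. Poly_Mapping.single j (Poly_Mapping.lookup u j)) = u" by (rule sym)
  show ?thesis by (simp only: monom_power monom_prod u mult_single) simp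
qed

text \<open>The kernel of \<open>S[T] \<rightarrow> (S/I)\<^sub>f\<close>, \<open>T \<mapsto> 1/f\<close>.\<close>

definition localization_kernel :: "'a::comm_ring_1 set \<Rightarrow> 'a \<Rightarrow> 'a poly set" where
  "localization_kernel I f = {p. \<exists>k. (\<forall>i>k. coeff p i = 0) \<and> (\<Sum>i\<le>k. coeff p i * f ^ (k - i)) \<in> I}"

text \<open>Multiplication by \<open>f ^ l\<close> raises the exponent of the denominator; adding
  two members of the kernel requires a common one.\<close>

lemma localization_kernel_raise:
  assumes "\<forall>i>k. coeff p i = 0" "(\<Sum>i\<le>k. coeff p i * f ^ (k - i)) \<in> I" "is_ideal I"
  shows "(\<Sum>i\<le>k + l. coeff p i * f ^ (k + l - i)) \<in> I"
proof -
  have "(\<Sum>i\<le>k + l. coeff p i * f ^ (k + l - i)) = (\<Sum>i\<le>k. coeff p i * f ^ (k + l - i))"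
    by (rule sum.mono_neutral_right) (use assms(1) in auto)
  also have "\<dots> = f ^ l * (\<Sum>i\<le>k. coeff p i * f ^ (k - i))"
    unfolding sum_distrib_left by (rule sum.cong) (auto simp: power_add[symmetric] algebra_simps)
  also have "\<dots> \<in> I" by (rule ideal.subspace_scale[OF assms(3,2)])
  finally show ?thesis .
qed

lemma is_ideal_localization_kernel:
  assumes I: "is_ideal I"
  shows "is_ideal (localization_kernel I f)"
proof -
  let ?J = "localization_kernel I f"
  have zero: "0 \<in> ?J" using ideal.subspace_0[OF I] by (auto simp: localization_kernel_def)
  have add: "p + q \<in> ?J" if pq: "p \<in> ?J" "q \<in> ?J" for p q
  proof -
    from pq obtain k l where k: "\<forall>i>k. coeff p i = 0" "(\<Sum>i\<le>k. coeff p i * f ^ (k - i)) \<in> I"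
      and l: "\<forall>i>l. coeff q i = 0" "(\<Sum>i\<le>l. coeff q i * f ^ (l - i)) \<in> I"
      by (auto simp: localization_kernel_def)
    have "(\<Sum>i\<le>k + l. coeff p i * f ^ (k + l - i)) + (\<Sum>i\<le>k + l. coeff q i * f ^ (k + l - i)) \<in> I"
      using localization_kernel_raise[OF k I, of l] localization_kernel_raise[OF l I, of k]
      by (intro ideal.subspace_add[OF I]) (simp_all add: add.commute)
    hence "(\<Sum>i\<le>k + l. coeff (p + q) i * f ^ (k + l - i)) \<in> I" by (simp add: distrib_right sum.distrib)
    moreover have "\<forall>i>k + l. coeff (p + q) i = 0" using k l by simp
    ultimately show ?thesis unfolding localization_kernel_def by blast
  qed
  have smult: "smult a p \<in> ?J" if p: "p \<in> ?J" for a p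
  proof -
    from p obtain k where k: "\<forall>i>k. coeff p i = 0" "(\<Sum>i\<le>k. coeff p i * f ^ (k - i)) \<in> I"
      by (auto simp: localization_kernel_def)
    have "(\<Sum>i\<le>k. coeff (smult a p) i * f ^ (k - i)) = a * (\<Sum>i\<le>k. coeff p i * f ^ (k - i))"
      by (simp add: sum_distrib_left mult.assoc)
    hence "(\<Sum>i\<le>k. coeff (smult a p) i * f ^ (k - i)) \<in> I" using ideal.subspace_scale[OF I k(2)] by simp
    moreover have "\<forall>i>k. coeff (smult a p) i = 0" using k by simp
    ultimately show ?thesis unfolding localization_kernel_def by blast
  qed
  have shift: "pCons 0 p \<in> ?J" if p: "p \<in> ?J" for p
  proof -
    from p obtain k where k: "\<forall>i>k. coeff p i = 0" "(\<Sum>i\<le>k. coeff p i * f ^ (k - i)) \<in> I"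
      by (auto simp: localization_kernel_def)
    have "(\<Sum>i\<le>Suc k. coeff (pCons 0 p) i * f ^ (Suc k - i)) = (\<Sum>i\<le>k. coeff p i * f ^ (k - i))"
      by (subst sum.atMost_Suc_shift) simp
    moreover have "\<forall>i>Suc k. coeff (pCons 0 p) i = 0" using k(1) by (auto simp: coeff_pCons split: nat.splits)
    ultimately show ?thesis using k(2) unfolding localization_kernel_def
      by (intro CollectI exI[of _ "Suc k"]) simp
  qed
  have "r * p \<in> ?J" if "p \<in> ?J" for r p
    using that zero by (induction r) (auto simp: mult_pCons_left intro: add smult shift)
  thus ?thesis using zero add by (intro ideal.subspaceI) auto
qed

text \<open>If no power of \<open>f\<close> lies in \<open>I\<close>, then 1 is not in the
  localization kernel, and the algebra generated by the variables and \<open>T\<close> has a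
  character modulo it. The values on the variables form a zero of \<open>I\<close>, where
  \<open>f\<close> vanishes by assumption; but \<open>f T - 1\<close> is in the kernel, so
  \<open>f\<close> would have to take a nonzero value.\<close>

theorem nullstellensatz:
  fixes I :: "('r::finite, 'k::alg_closed_field) cox_ring set"
  assumes I: "is_ideal I" and f: "\<And>x. x \<in> zero_set I \<Longrightarrow> poly_eval x f = 0"
  shows "\<exists>k. f ^ k \<in> I"
proof (rule ccontr)
  assume no: "\<not> (\<exists>k. f ^ k \<in> I)"
  define J where "J = localization_kernel I f"
  define h where "h = (\<lambda>c::'k. [:Poly_Mapping.single (0 :: 'r \<Rightarrow>\<^sub>0 nat) c:])"
  interpret algebra_ideal h J
  proof unfold_locales
    show "is_ideal J" unfolding J_def by (rule is_ideal_localization_kernel[OF I])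
  qed (simp_all add: h_def single_add mult_single one_pCons mult.commute)
  have "1 \<notin> J"
  proof
    assume "1 \<in> J"
    then obtain k where k: "(\<Sum>i\<le>k. coeff (1 :: ('r, 'k) cox_ring poly) i * f ^ (k - i)) \<in> I"
      unfolding J_def localization_kernel_def by blast
    have "(\<Sum>i\<le>k. coeff (1 :: ('r, 'k) cox_ring poly) i * f ^ (k - i)) = (\<Sum>i\<le>k. if i = 0 then f ^ k else 0)"
      by (rule sum.cong) auto
    thus False using k no by simp
  qed
  \<comment> \<open>\<open>None\<close> indexes the variable \<open>T\<close>, the inverse of
    \<open>f\<close> modulo the kernel.\<close>
  define x :: "'r option \<Rightarrow> ('r, 'k) cox_ring poly" where
    "x = (\<lambda>i. case i of None \<Rightarrow> [:0, 1:] | Some j \<Rightarrow> [:monom_of (Poly_Mapping.single j 1):])"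
  obtain \<phi> where \<phi>: "character (generated UNIV x) \<phi>" using character_generated[OF \<open>1 \<notin> J\<close>] by blast
  define A where "A = generated UNIV x"
  have A: "subalgebra A" unfolding A_def by (rule subalgebra_generated)
  note A_ops = subalgebraD[OF A] and \<phi>_ops = characterD[OF A \<phi>[folded A_def]]
  have xA: "x i \<in> A" for i unfolding A_def by (rule generated_var) simp
  define t where "t = (\<lambda>j. \<phi> (x (Some j)))"
  have mA: "(\<Prod>j\<in>B. x (Some j) ^ Poly_Mapping.lookup u j) \<in> A" for B u
    by (intro subalgebra_prod[OF A] subalgebra_power[OF A] xA)
  have \<phi>_pow: "\<phi> (a ^ n) = \<phi> a ^ n" if "a \<in> A" for a n
    by (induction n) (simp_all add: \<phi>_ops(3,5) that subalgebra_power[OF A])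
  have \<phi>_m: "\<phi> (\<Prod>j\<in>B. x (Some j) ^ Poly_Mapping.lookup u j) = (\<Prod>j\<in>B. t j ^ Poly_Mapping.lookup u j)"
    if "finite B" for B u
    using that
    by (induction B rule: finite_induct)
       (simp_all add: \<phi>_ops(3,5) mA subalgebra_power[OF A] xA \<phi>_pow t_def)
  have const_mult: "[:a * b:] = [:a:] * [:b:]" for a b :: "('r, 'k) cox_ring" by simp
  have const_prod: "[:prod F B:] = (\<Prod>j\<in>B. [:F j:])" for F :: "'r \<Rightarrow> ('r, 'k) cox_ring" and B
    by (induction B rule: infinite_finite_induct)
       (simp_all add: one_pCons const_mult del: mult_pCons_left mult_pCons_right)
  have const_pow: "[:a ^ n:] = [:a:] ^ n" for a :: "('r, 'k) cox_ring" and n :: nat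
    by (induction n) (simp_all add: one_pCons const_mult del: mult_pCons_left mult_pCons_right)
  have const_single: "[:Poly_Mapping.single u c:] = h c * (\<Prod>j\<in>UNIV. x (Some j) ^ Poly_Mapping.lookup u j)" for u c
    by (subst single_eq_prod_vars) (simp add: h_def x_def const_prod[symmetric] const_pow[symmetric])
  have const: "[:g:] \<in> A \<and> \<phi> [:g:] = poly_eval t g" for g
  proof (induction g rule: poly_mapping_additive_induct)
    case (single u c)
    show ?case unfolding const_single
      by (simp add: A_ops(1,5) mA \<phi>_ops(1,5) \<phi>_m poly_eval_single)
  next
    case (add g g')
    have "[:g + g':] = [:g:] + [:g':]" by simp
    thus ?case using add A_ops(4)[of "[:g:]" "[:g':]"] \<phi>_ops(4)[of "[:g:]" "[:g':]"] by (simp only: poly_eval_add)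
  qed
  have "t \<in> zero_set I" unfolding zero_set_def
  proof (intro CollectI ballI)
    fix g assume "g \<in> I"
    hence "[:g:] \<in> J" unfolding J_def localization_kernel_def
      by (intro CollectI exI[of _ 0]) (auto simp: coeff_pCons split: nat.splits)
    thus "poly_eval t g = 0" using const[of g] \<phi>_ops(6)[of "[:g:]"] by simp
  qed
  hence "poly_eval t f = 0" by (rule f)
  hence f0: "\<phi> [:f:] = 0" using const[of f] by simp
  \<comment> \<open>For \<open>k = 1\<close> the defining sum is \<open>- f + f = 0\<close>.\<close>
  have "[:- 1, f:] \<in> J" unfolding J_def localization_kernel_def
    using ideal.subspace_0[OF I]
    by (intro CollectI exI[of _ 1]) (auto simp: coeff_pCons split: nat.splits)
  moreover have "[:- 1, f:] = [:f:] * x None - 1" by (simp add: x_def one_pCons)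
  ultimately have "[:f:] * x None - 1 \<in> J" by (simp only:)
  moreover have fx: "[:f:] * x None \<in> A" using const xA by (intro A_ops(5)) auto
  moreover have "\<phi> ([:f:] * x None - 1) = \<phi> [:f:] * \<phi> (x None) - 1"
    using \<phi>_ops(7)[OF fx A_ops(3)] \<phi>_ops(5)[of "[:f:]" "x None"] const[of f] xA[of None]
    by (simp only: \<phi>_ops(3))
  ultimately have "\<phi> [:f:] * \<phi> (x None) - 1 = 0"
    using \<phi>_ops(6)[OF A_ops(7)[OF fx A_ops(3)]] by (simp only:)
  thus False using f0 by simp
qed


subsection \<open>Counting flipped cones of a complete simplicial fan\<close>

text \<open>A complete simplicial fan is encoded by its ray generators \<open>w\<close> and the set \<open>S\<close> of the index
  sets of its full-dimensional cones.\<close>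

locale complete_simplicial =
  fixes w :: "'r::finite \<Rightarrow> real ^ 'n" and S :: "'r set set"
  assumes spanning: "s \<in> S \<Longrightarrow> \<exists>a. (\<forall>j. j \<notin> s \<longrightarrow> a j = 0) \<and> (\<Sum>j\<in>UNIV. a j *\<^sub>R w j) = x"
    and indep: "s \<in> S \<Longrightarrow> (\<And>j. j \<notin> s \<Longrightarrow> a j = 0) \<Longrightarrow> (\<Sum>j\<in>UNIV. a j *\<^sub>R w j) = 0 \<Longrightarrow> a i = 0"
    and cover: "\<exists>s\<in>S. \<exists>a. (\<forall>j. a j \<ge> 0) \<and> (\<forall>j. j \<notin> s \<longrightarrow> a j = 0) \<and> (\<Sum>j\<in>UNIV. a j *\<^sub>R w j) = x"
    and consistent: "s \<in> S \<Longrightarrow> s' \<in> S \<Longrightarrow> (\<And>j. a j \<ge> 0) \<Longrightarrow> (\<And>j. b j \<ge> 0) \<Longrightarrow>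
      (\<And>j. j \<notin> s \<Longrightarrow> a j = 0) \<Longrightarrow> (\<And>j. j \<notin> s' \<Longrightarrow> b j = 0) \<Longrightarrow>
      (\<Sum>j\<in>UNIV. a j *\<^sub>R w j) = (\<Sum>j\<in>UNIV. b j *\<^sub>R w j) \<Longrightarrow> a i = b i"
begin

definition coord :: "'r set \<Rightarrow> real ^ 'n \<Rightarrow> 'r \<Rightarrow> real" where
  "coord s x = (SOME a. (\<forall>j. j \<notin> s \<longrightarrow> a j = 0) \<and> (\<Sum>j\<in>UNIV. a j *\<^sub>R w j) = x)"

lemma coord:
  assumes "s \<in> S"
  shows "j \<notin> s \<Longrightarrow> coord s x j = 0" "(\<Sum>j\<in>UNIV. coord s x j *\<^sub>R w j) = x"
  using someI_ex[OF spanning[OF assms, of x]] unfolding coord_def by auto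

lemma coord_eqI:
  assumes "s \<in> S" "\<And>j. j \<notin> s \<Longrightarrow> a j = 0" "(\<Sum>j\<in>UNIV. a j *\<^sub>R w j) = x"
  shows "coord s x i = a i"
proof -
  have "coord s x i - a i = 0"
    by (rule indep[OF assms(1), of "\<lambda>i. coord s x i - a i"])
       (simp_all add: coord[OF assms(1)] assms scaleR_left_diff_distrib sum_subtractf)
  thus ?thesis by simp
qed

lemma coord_add: "s \<in> S \<Longrightarrow> coord s (x + y) i = coord s x i + coord s y i"
  by (rule coord_eqI) (simp_all add: coord scaleR_left_distrib sum.distrib)

lemma coord_scale: "s \<in> S \<Longrightarrow> coord s (c *\<^sub>R x) i = c * coord s x i"
proof (rule coord_eqI)
  assume s: "s \<in> S"
  have "(\<Sum>j\<in>UNIV. (c * coord s x j) *\<^sub>R w j) = c *\<^sub>R (\<Sum>j\<in>UNIV. coord s x j *\<^sub>R w j)"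
    by (simp add: scaleR_sum_right)
  thus "(\<Sum>j\<in>UNIV. (c * coord s x j) *\<^sub>R w j) = c *\<^sub>R x" by (simp only: coord(2)[OF s])
qed (simp_all add: coord)

lemma coord_w:
  assumes "s \<in> S" "j \<in> s"
  shows "coord s (w j) i = (if i = j then 1 else 0)"
proof (rule coord_eqI[OF assms(1)])
  have "(\<Sum>i\<in>UNIV. (if i = j then 1 else 0) *\<^sub>R w i) = (\<Sum>i\<in>UNIV. if i = j then w i else 0)"
    by (rule sum.cong) auto
  thus "(\<Sum>i\<in>UNIV. (if i = j then 1 else 0) *\<^sub>R w i) = w j" by simp
qed (use assms(2) in auto)

lemma coord_support_sum:
  assumes "s \<in> S"
  shows "(\<Sum>j\<in>s. coord s x j *\<^sub>R w j) = x"
proof -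
  have "(\<Sum>j\<in>s. coord s x j *\<^sub>R w j) = (\<Sum>j\<in>UNIV. coord s x j *\<^sub>R w j)"
    by (rule sum.mono_neutral_left) (auto simp: coord[OF assms])
  thus ?thesis by (simp add: coord[OF assms])
qed

lemma finite_S [simp]: "finite S"
  by (rule finite_subset[of _ "Pow UNIV"]) auto

definition generic :: "real ^ 'n \<Rightarrow> bool" where
  "generic \<eta> \<longleftrightarrow> (\<forall>s\<in>S. \<forall>j\<in>s. coord s \<eta> j \<noteq> 0)"

text \<open>Each excluded set is a proper subspace, as it misses the vector \<open>w j\<close> with
  coordinate 1. Finitely many of them are negligible, while a nonempty open set is not.\<close>

lemma generic_dense:
  assumes "open U" "U \<noteq> {}"
  shows "\<exists>\<eta>\<in>U. generic \<eta>"
proof (rule ccontr)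
  assume no: "\<not> (\<exists>\<eta>\<in>U. generic \<eta>)"
  let ?H = "\<lambda>p. {x. coord (fst p) x (snd p) = 0}"
  have neg: "negligible (?H p)" if p: "p \<in> Sigma S (\<lambda>s. s)" for p
  proof -
    obtain s j where sj: "p = (s, j)" "s \<in> S" "j \<in> s" using p by auto
    have sub: "subspace (?H p)"
      using sj coord_add[OF sj(2), of 0 0 j] by (auto simp: subspace_def coord_add coord_scale)
    have "w j \<notin> span (?H p)" using coord_w[OF sj(2,3), of j] sub sj(1) by (simp add: span_eq_iff[THEN iffD2])
    hence "span (?H p) \<noteq> UNIV" by blast
    hence "dim (?H p) \<noteq> DIM(real ^ 'n)" using dim_eq_full[of "?H p"] by blast
    hence "dim (?H p) < DIM(real ^ 'n)" using dim_subset_UNIV[of "?H p"] by linarith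
    thus ?thesis by (rule negligible_lowdim)
  qed
  have "negligible (\<Union> (?H ` Sigma S (\<lambda>s. s)))"
    by (rule negligible_Union) (use neg in \<open>auto intro: finite_subset[OF subset_UNIV]\<close>)
  moreover have "U \<subseteq> \<Union> (?H ` Sigma S (\<lambda>s. s))" using no by (fastforce simp: generic_def)
  ultimately have "negligible U" by (rule negligible_subset)
  thus False using open_not_negligible[OF assms] by blast
qed

text \<open>\<open>b\<close> records whether the inequality of a ray holds at a point, and
  \<open>c\<close> is the coordinate of \<eta> at this ray. For \<open>c > 0\<close> the closed
  half-space counts with sign 1, for \<open>c < 0\<close> its open complement counts with sign
  -1.\<close>

definition face_sign :: "bool \<Rightarrow> real \<Rightarrow> int" where
  "face_sign b c = (if b then of_bool (c > 0) else - of_bool (c < 0))"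

text \<open>Omitting the factors in \<tau> gives the count for the star of the cone over \<tau>. The
  whole fan is the case of empty \<tau>; larger \<tau> enter when a sign is flipped.\<close>

definition flipped_count :: "'r set \<Rightarrow> ('r \<Rightarrow> bool) \<Rightarrow> real ^ 'n \<Rightarrow> int" where
  "flipped_count \<tau> \<epsilon> \<eta> = (\<Sum>s\<in>{s\<in>S. \<tau> \<subseteq> s}. \<Prod>j\<in>s - \<tau>. face_sign (\<epsilon> j) (coord s \<eta> j))"

text \<open>Since \<open>- [c < 0] = [c > 0] - 1\<close> for \<open>c \<noteq> 0\<close>, flipping one sign subtracts the same count in the
  star of the corresponding ray.\<close>

lemma flipped_count_flip:
  assumes "generic \<eta>" "i \<notin> \<tau>" "\<epsilon> i"
  shows "flipped_count \<tau> (\<epsilon>(i := False)) \<eta> = flipped_count \<tau> \<epsilon> \<eta> - flipped_count (insert i \<tau>) \<epsilon> \<eta>"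
proof -
  let ?t = "\<lambda>\<tau> \<epsilon> s. \<Prod>j\<in>s - \<tau>. face_sign (\<epsilon> j) (coord s \<eta> j)"
  have "?t \<tau> (\<epsilon>(i := False)) s = ?t \<tau> \<epsilon> s - (if i \<in> s then ?t (insert i \<tau>) \<epsilon> s else 0)"
    if s: "s \<in> S" "\<tau> \<subseteq> s" for s
  proof (cases "i \<in> s")
    case True
    have rem: "?t \<tau> \<epsilon>' s = face_sign (\<epsilon>' i) (coord s \<eta> i) * ?t (insert i \<tau>) \<epsilon>' s" for \<epsilon>'
    proof -
      have "s - \<tau> - {i} = s - insert i \<tau>" by blast
      thus ?thesis using prod.remove[of "s - \<tau>" i "\<lambda>j. face_sign (\<epsilon>' j) (coord s \<eta> j)"] True assms(2) by simp
    qed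
    have "coord s \<eta> i \<noteq> 0" using assms(1) s True by (auto simp: generic_def)
    hence "face_sign False (coord s \<eta> i) = face_sign True (coord s \<eta> i) - 1"
      by (auto simp: face_sign_def)
    moreover have "?t (insert i \<tau>) (\<epsilon>(i := False)) s = ?t (insert i \<tau>) \<epsilon> s"
      by (rule prod.cong) auto
    ultimately show ?thesis
      unfolding rem[of "\<epsilon>(i := False)"] rem[of \<epsilon>] using True assms(3)
      by (simp only: fun_upd_same if_True left_diff_distrib mult_1)
  next
    case False
    have "?t \<tau> (\<epsilon>(i := False)) s = ?t \<tau> \<epsilon> s"
      by (rule prod.cong) (use False in auto)
    thus ?thesis using False by simp
  qed
  hence "flipped_count \<tau> (\<epsilon>(i := False)) \<eta>
      = (\<Sum>s\<in>{s\<in>S. \<tau> \<subseteq> s}. ?t \<tau> \<epsilon> s - (if i \<in> s then ?t (insert i \<tau>) \<epsilon> s else 0))"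
    unfolding flipped_count_def by (intro sum.cong) auto
  also have "\<dots> = flipped_count \<tau> \<epsilon> \<eta> - (\<Sum>s\<in>{s\<in>S. \<tau> \<subseteq> s}. if i \<in> s then ?t (insert i \<tau>) \<epsilon> s else 0)"
    by (simp add: sum_subtractf flipped_count_def)
  also have "(\<Sum>s\<in>{s\<in>S. \<tau> \<subseteq> s}. if i \<in> s then ?t (insert i \<tau>) \<epsilon> s else 0) = flipped_count (insert i \<tau>) \<epsilon> \<eta>"
    unfolding flipped_count_def by (rule sum.mono_neutral_cong_right) auto
  finally show ?thesis .
qed

text \<open>Push \<open>\<eta>\<close> far into the direction of the cone over \<open>\<tau>\<close>: the result lies in the interior of exactly
  one full-dimensional cone, and this cone contains \<open>\<tau>\<close>.\<close>

lemma flipped_count_True: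
  assumes "generic \<eta>" "s0 \<in> S" "\<tau> \<subseteq> s0"
  shows "flipped_count \<tau> (\<lambda>_. True) \<eta> = 1"
proof -
  define p where "p = (\<Sum>j\<in>\<tau>. w j)"
  define one_\<tau> where "one_\<tau> = (\<lambda>j. if j \<in> \<tau> then 1 else (0::real))"
  have p: "(\<Sum>j\<in>UNIV. one_\<tau> j *\<^sub>R w j) = p"
    unfolding p_def one_\<tau>_def by (rule sum.mono_neutral_cong_right) auto
  have cp: "coord s p j = one_\<tau> j" if "s \<in> S" "\<tau> \<subseteq> s" for s j
    by (rule coord_eqI[OF that(1) _ p]) (use that in \<open>auto simp: one_\<tau>_def\<close>)
  define Q where "Q = {s\<in>S. \<tau> \<subseteq> s \<and> (\<forall>j\<in>s - \<tau>. coord s \<eta> j > 0)}"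
  have "flipped_count \<tau> (\<lambda>_. True) \<eta> = (\<Sum>s\<in>{s\<in>S. \<tau> \<subseteq> s}. if \<forall>j\<in>s - \<tau>. coord s \<eta> j > 0 then 1 else 0)"
    unfolding flipped_count_def
  proof (rule sum.cong, goal_cases)
    case (2 s)
    show ?case
    proof (cases "\<forall>j\<in>s - \<tau>. coord s \<eta> j > 0")
      case True
      thus ?thesis by (simp add: face_sign_def)
    next
      case False
      then obtain j where "j \<in> s - \<tau>" "\<not> coord s \<eta> j > 0" by blast
      hence "(\<Prod>j\<in>s - \<tau>. face_sign True (coord s \<eta> j)) = 0"
        by (intro prod_zero) (auto simp: face_sign_def)
      thus ?thesis by (simp only: if_not_P[OF False])
    qed
  qed auto
  also have "\<dots> = int (card Q)"
    unfolding Q_def by (simp add: sum.If_cases Int_def conj_ac)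
  also have "card Q = 1"
  proof -
    have unique: "s = s'" if "s \<in> Q" "s' \<in> Q" for s s'
    proof -
      have pos: "\<exists>T0. \<forall>T\<ge>T0. \<forall>j\<in>s. coord s (\<eta> + T *\<^sub>R p) j > 0" if "s \<in> Q" for s
      proof -
        \<comment> \<open>Larger than every absolute coordinate of \<eta>, so that \<open>T\<close>
          dominates on the rays of \<tau>. On the remaining rays of \<open>s\<close> the vector
          \<open>p\<close> has coordinate 0.\<close>
        define T0 where "T0 = (\<Sum>j\<in>UNIV. \<bar>coord s \<eta> j\<bar>) + 1"
        have "coord s (\<eta> + T *\<^sub>R p) j > 0" if "T \<ge> T0" "j \<in> s" for T j
        proof (cases "j \<in> \<tau>")
          case True
          have "\<bar>coord s \<eta> j\<bar> \<le> (\<Sum>j\<in>UNIV. \<bar>coord s \<eta> j\<bar>)" by (rule member_le_sum) auto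
          thus ?thesis using True \<open>s \<in> Q\<close> that
            by (auto simp: Q_def coord_add coord_scale cp one_\<tau>_def T0_def)
        next
          case False
          thus ?thesis using \<open>s \<in> Q\<close> that by (auto simp: Q_def coord_add coord_scale cp one_\<tau>_def)
        qed
        thus ?thesis by blast
      qed
      obtain T1 T2 where T1: "\<forall>T\<ge>T1. \<forall>j\<in>s. coord s (\<eta> + T *\<^sub>R p) j > 0"
        and T2: "\<forall>T\<ge>T2. \<forall>j\<in>s'. coord s' (\<eta> + T *\<^sub>R p) j > 0"
        using pos[OF \<open>s \<in> Q\<close>] pos[OF \<open>s' \<in> Q\<close>] by blast
      define x where "x = \<eta> + max T1 T2 *\<^sub>R p"
      have x1: "coord s x j > 0" if "j \<in> s" for j using T1 that by (simp add: x_def)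
      have x2: "coord s' x j > 0" if "j \<in> s'" for j using T2 that by (simp add: x_def)
      have sS: "s \<in> S" "s' \<in> S" using that by (auto simp: Q_def)
      have eq: "coord s x j = coord s' x j" for j
      proof (rule consistent[OF sS])
        show "coord s x j \<ge> 0" for j using x1[of j] coord(1)[OF sS(1), of j x] by (cases "j \<in> s") auto
        show "coord s' x j \<ge> 0" for j using x2[of j] coord(1)[OF sS(2), of j x] by (cases "j \<in> s'") auto
      qed (simp_all add: coord sS)
      have "j \<in> s \<longleftrightarrow> j \<in> s'" for j
        using eq[of j] x1[of j] x2[of j] coord(1)[OF sS(1), of j x] coord(1)[OF sS(2), of j x] by fastforce
      thus ?thesis by blast
    qed
    \<comment> \<open>Pigeonhole: each point \<open>\<eta> + k p\<close> lies in one of finitely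
      many cones, so one cone serves infinitely many \<open>k\<close>.\<close>
    have "\<exists>s\<in>S. infinite {k::nat. \<exists>a. (\<forall>j. a j \<ge> 0) \<and> (\<forall>j. j \<notin> s \<longrightarrow> a j = 0) \<and> (\<Sum>j\<in>UNIV. a j *\<^sub>R w j) = \<eta> + real k *\<^sub>R p}"
      (is "\<exists>s\<in>S. infinite (?K s)")
    proof (rule ccontr)
      assume "\<not> ?thesis"
      hence "finite (\<Union>s\<in>S. ?K s)" by auto
      moreover have "(\<Union>s\<in>S. ?K s) = UNIV" using cover by blast
      ultimately show False using infinite_UNIV_nat by simp
    qed
    then obtain s where s: "s \<in> S" "infinite (?K s)" by blast
    have coord_pos: "coord s \<eta> j + real k * coord s p j \<ge> 0" if "k \<in> ?K s" for k j
    proof -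
      from that obtain a where a: "\<forall>j. a j \<ge> 0" "\<forall>j. j \<notin> s \<longrightarrow> a j = 0" "(\<Sum>j\<in>UNIV. a j *\<^sub>R w j) = \<eta> + real k *\<^sub>R p"
        by blast
      have "coord s (\<eta> + real k *\<^sub>R p) j = a j" by (rule coord_eqI) (use s a in auto)
      thus ?thesis using a(1) s(1) by (simp add: coord_add coord_scale)
    qed
    \<comment> \<open>A negative coordinate of \<open>p\<close> would prevail for large
      \<open>k\<close>, and arbitrarily large \<open>k\<close> occur.\<close>
    have "coord s p j \<ge> 0" for j
    proof (rule ccontr)
      assume neg: "\<not> coord s p j \<ge> 0"
      obtain k where k: "k \<in> ?K s" "k > nat \<lceil>coord s \<eta> j / - coord s p j\<rceil>"
        using s(2) infinite_nat_iff_unbounded by blast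
      hence "real k > coord s \<eta> j / - coord s p j" by linarith
      hence "coord s \<eta> j + real k * coord s p j < 0" using neg by (simp add: field_simps)
      thus False using coord_pos[OF k(1), of j] by simp
    qed
    \<comment> \<open>\<open>p\<close> has nonnegative coordinates both in \<open>s\<close> and, by
      its definition, in \<open>s0\<close>. Consistency of the fan identifies them, which forces
      \<open>\<tau> \<subseteq> s\<close>.\<close>
    have cps: "coord s p j = one_\<tau> j" for j
    proof (rule consistent[OF s(1) assms(2)])
      show "(\<Sum>j\<in>UNIV. coord s p j *\<^sub>R w j) = (\<Sum>j\<in>UNIV. one_\<tau> j *\<^sub>R w j)"
        by (simp only: coord(2)[OF s(1)] p)
      show "one_\<tau> j = 0" if "j \<notin> s0" for j using that assms(3) by (auto simp: one_\<tau>_def)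
      show "one_\<tau> j \<ge> 0" for j by (simp add: one_\<tau>_def)
    qed (simp_all add: coord(1)[OF s(1)] \<open>\<And>j. coord s p j \<ge> 0\<close>)
    have "\<tau> \<subseteq> s"
    proof
      fix j assume "j \<in> \<tau>"
      thus "j \<in> s" using cps[of j] coord(1)[OF s(1), of j p] by (auto simp: one_\<tau>_def)
    qed
    moreover have "coord s \<eta> j > 0" if "j \<in> s - \<tau>" for j
    proof -
      obtain k where "k \<in> ?K s" using infinite_imp_nonempty[OF s(2)] by blast
      from coord_pos[OF this, of j] have "coord s \<eta> j \<ge> 0" using cps[of j] that by (simp add: one_\<tau>_def)
      moreover have "coord s \<eta> j \<noteq> 0" using assms(1) s(1) that by (auto simp: generic_def)
      ultimately show ?thesis by simp
    qed
    ultimately have "s \<in> Q" using s(1) by (simp add: Q_def)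
    hence "Q = {s}" using unique by blast
    thus ?thesis by simp
  qed
  finally show ?thesis by simp
qed

text \<open>Induction on the number of \<open>False\<close> signs. A flip reduces to counts with one
  such sign fewer, in the fan and in a star; without any, the count is 1 or 0 according to whether
  some cone contains \<tau>.\<close>

lemma flipped_count_generic:
  assumes "generic \<eta>" "generic \<eta>'"
  shows "flipped_count \<tau> \<epsilon> \<eta> = flipped_count \<tau> \<epsilon> \<eta>'"
proof (induction "card {j. \<not> \<epsilon> j}" arbitrary: \<tau> \<epsilon>)
  case 0
  hence "\<epsilon> = (\<lambda>_. True)" by auto
  thus ?case
  proof (cases "\<exists>s0\<in>S. \<tau> \<subseteq> s0")
    case True
    thus ?thesis using flipped_count_True assms \<open>\<epsilon> = (\<lambda>_. True)\<close> by metis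
  next
    case False
    hence "{s \<in> S. \<tau> \<subseteq> s} = {}" by blast
    thus ?thesis unfolding flipped_count_def by (simp only: sum.empty)
  qed
next
  case (Suc k)
  have "{j. \<not> \<epsilon> j} \<noteq> {}"
  proof
    assume "{j. \<not> \<epsilon> j} = {}"
    thus False using Suc.hyps(2) by (simp only: card.empty)
  qed
  then obtain i where i: "\<not> \<epsilon> i" by blast
  define \<epsilon>' where "\<epsilon>' = \<epsilon>(i := True)"
  have "{j. \<not> \<epsilon>' j} = {j. \<not> \<epsilon> j} - {i}" by (auto simp: \<epsilon>'_def)
  hence k: "k = card {j. \<not> \<epsilon>' j}" using Suc.hyps(2) i by (simp add: card_Diff_singleton)
  have eps: "\<epsilon> = \<epsilon>'(i := False)" using i by (auto simp: \<epsilon>'_def fun_eq_iff)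
  show ?case
  proof (cases "i \<in> \<tau>")
    case True
    have "flipped_count \<tau> \<epsilon> x = flipped_count \<tau> \<epsilon>' x" for x
      unfolding flipped_count_def by (intro sum.cong prod.cong) (use True in \<open>auto simp: \<epsilon>'_def\<close>)
    thus ?thesis using Suc.hyps(1)[OF k, of \<tau>] by simp
  next
    case False
    have "\<epsilon>' i" by (simp add: \<epsilon>'_def)
    have "flipped_count \<tau> \<epsilon> x = flipped_count \<tau> \<epsilon>' x - flipped_count (insert i \<tau>) \<epsilon>' x" if "generic x" for x
      unfolding eps by (rule flipped_count_flip[where \<epsilon> = \<epsilon>']) (fact that False \<open>\<epsilon>' i\<close>)+
    thus ?thesis using assms Suc.hyps(1)[OF k, of \<tau>] Suc.hyps(1)[OF k, of "insert i \<tau>"] by simp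
  qed
qed

text \<open>If the inequality of a ray is violated, then by convexity of the support function all terms
  vanish for \<open>\<eta>\<close> close to this ray; and the sum does not depend on \<open>\<eta>\<close>.\<close>

lemma polytope_indicator:
  assumes "generic \<eta>"
    and vertex: "\<And>s j. s \<in> S \<Longrightarrow> j \<in> s \<Longrightarrow> \<mu> s \<bullet> w j = - D j"
    and convex: "\<And>s j. s \<in> S \<Longrightarrow> \<mu> s \<bullet> w j \<ge> - D j"
  shows "(\<Sum>s\<in>S. \<Prod>j\<in>s. face_sign ((m - \<mu> s) \<bullet> w j \<ge> 0) (coord s \<eta> j)) = of_bool (\<forall>j. m \<bullet> w j \<ge> - D j)"
proof -
  define \<epsilon> where "\<epsilon> = (\<lambda>j. m \<bullet> w j + D j \<ge> 0)"
  have "(\<Sum>s\<in>S. \<Prod>j\<in>s. face_sign ((m - \<mu> s) \<bullet> w j \<ge> 0) (coord s \<eta> j)) = flipped_count {} \<epsilon> \<eta>"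
    unfolding flipped_count_def
    by (intro sum.cong prod.cong) (auto simp: \<epsilon>_def vertex inner_diff_left)
  also have "\<dots> = of_bool (\<forall>j. \<epsilon> j)"
  proof (cases "\<forall>j. \<epsilon> j")
    case True
    hence "\<epsilon> = (\<lambda>_. True)" by auto
    moreover obtain s0 where "s0 \<in> S" using cover by blast
    ultimately show ?thesis using flipped_count_True[OF assms(1), of s0 "{}"] by simp
  next
    case False
    then obtain i where i: "m \<bullet> w i + D i < 0" by (auto simp: \<epsilon>_def not_le)
    \<comment> \<open>A neighbourhood of the generator of the violated ray. At \<open>w i\<close>
      the value of \<open>m\<close> is below \<open>- D i\<close>, while every vertex has at least
      this value.\<close>
    define U where "U = (\<Inter>s\<in>S. {x. (m - \<mu> s) \<bullet> x < 0})"
    have "open U" unfolding U_def by (rule open_INT) (auto intro: open_halfspace_lt)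
    have "w i \<in> U"
    proof -
      have "m \<bullet> w i < \<mu> s \<bullet> w i" if "s \<in> S" for s using convex[OF that, of i] i by linarith
      thus ?thesis by (auto simp: U_def inner_diff_left)
    qed
    have "\<exists>\<eta>\<in>U. generic \<eta>"
      by (rule generic_dense[OF \<open>open U\<close>]) (use \<open>w i \<in> U\<close> in auto)
    then obtain \<eta>' where \<eta>': "\<eta>' \<in> U" "generic \<eta>'" by (elim bexE)
    have zero: "(\<Prod>j\<in>s. face_sign (\<epsilon> j) (coord s \<eta>' j)) = 0" if s: "s \<in> S" for s
    proof (rule ccontr)
      assume "(\<Prod>j\<in>s. face_sign (\<epsilon> j) (coord s \<eta>' j)) \<noteq> 0"
      hence nz: "\<forall>j\<in>s. face_sign (\<epsilon> j) (coord s \<eta>' j) \<noteq> 0"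
        by (simp add: prod_zero_iff)
      \<comment> \<open>A factor can be nonzero only if the coordinate of \<eta>' and
        \<open>m \<bullet> w j + D j\<close> do not have opposite signs. Summing over the cone would
        make \<open>m - \<mu> s\<close> nonnegative on \<eta>', against the choice of
        \<open>U\<close>.\<close>
      have "0 \<le> coord s \<eta>' j * (m \<bullet> w j + D j)" if "j \<in> s" for j
        using bspec[OF nz that] by (cases "\<epsilon> j") (auto simp: face_sign_def \<epsilon>_def intro!: mult_nonneg_nonneg mult_nonpos_nonpos)
      hence "0 \<le> (\<Sum>j\<in>s. coord s \<eta>' j * (m \<bullet> w j + D j))" by (rule sum_nonneg)
      also have "\<dots> = (\<Sum>j\<in>s. coord s \<eta>' j * ((m - \<mu> s) \<bullet> w j))"
        by (rule sum.cong) (auto simp: vertex[OF s] inner_diff_left)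
      also have "\<dots> = (m - \<mu> s) \<bullet> (\<Sum>j\<in>s. coord s \<eta>' j *\<^sub>R w j)" by (simp add: inner_sum_right)
      also have "\<dots> = (m - \<mu> s) \<bullet> \<eta>'" by (simp only: coord_support_sum[OF s])
      also have "\<dots> < 0" using \<eta>'(1) s by (auto simp: U_def)
      finally show False by simp
    qed
    have "flipped_count {} \<epsilon> \<eta>' = (\<Sum>s\<in>S. \<Prod>j\<in>s. face_sign (\<epsilon> j) (coord s \<eta>' j))"
      unfolding flipped_count_def by (rule sum.cong) auto
    also have "\<dots> = 0" using zero by (rule sum.neutral[OF ballI])
    finally have "flipped_count {} \<epsilon> \<eta> = 0"
      using flipped_count_generic[OF assms(1) \<eta>'(2), of "{}" \<epsilon>] by (simp only:)
    thus ?thesis using False by simp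
  qed
  also have "\<epsilon> = (\<lambda>j. m \<bullet> w j \<ge> - D j)" unfolding \<epsilon>_def by (rule ext) linarith
  finally show ?thesis .
qed

end


subsection \<open>The index sets of the full-dimensional cones\<close>

lemma convex_cone_sum:
  assumes "convex_cone C" "\<And>i. i \<in> A \<Longrightarrow> f i \<in> C"
  shows "sum f A \<in> C"
  using assms(2)
  by (induction A rule: infinite_finite_induct)
     (auto simp: convex_cone_contains_0[OF assms(1)] intro: convex_cone_add[OF assms(1)])

lemma convex_cone_hull_finite:
  fixes W :: "'a::real_vector set"
  assumes "finite W"
  shows "convex_cone hull W = {\<Sum>u\<in>W. b u *\<^sub>R u | b. \<forall>u\<in>W. b u \<ge> 0}" (is "_ = ?R")
proof
  show "convex_cone hull W \<subseteq> ?R"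
  proof (rule hull_minimal)
    show "W \<subseteq> ?R"
    proof
      fix x assume "x \<in> W"
      have "(\<Sum>u\<in>W. (if u = x then 1 else 0) *\<^sub>R u) = (\<Sum>u\<in>W. if u = x then u else 0)"
        by (rule sum.cong) auto
      also have "\<dots> = x" using assms \<open>x \<in> W\<close> by simp
      finally show "x \<in> ?R" by (intro CollectI exI[of _ "\<lambda>u. if u = x then 1 else 0"]) auto
    qed
    show "convex_cone ?R" unfolding convex_cone_iff
    proof (intro conjI ballI allI impI)
      show "0 \<in> ?R" by (intro CollectI exI[of _ "\<lambda>_. 0"]) simp
      fix x assume "x \<in> ?R"
      then obtain b where b: "\<forall>u\<in>W. b u \<ge> 0" "x = (\<Sum>u\<in>W. b u *\<^sub>R u)" by blast
      {
        fix y assume "y \<in> ?R"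
        then obtain d where d: "\<forall>u\<in>W. d u \<ge> 0" "y = (\<Sum>u\<in>W. d u *\<^sub>R u)" by blast
        have "x + y = (\<Sum>u\<in>W. (b u + d u) *\<^sub>R u)" by (simp add: b d scaleR_left_distrib sum.distrib)
        moreover have "\<forall>u\<in>W. b u + d u \<ge> 0" using b d by auto
        ultimately show "x + y \<in> ?R" by (intro CollectI exI[of _ "\<lambda>u. b u + d u"]) blast
      }
      fix c :: real assume "c \<ge> 0"
      have "c *\<^sub>R x = (\<Sum>u\<in>W. (c * b u) *\<^sub>R u)" by (simp add: b scaleR_sum_right)
      moreover have "\<forall>u\<in>W. c * b u \<ge> 0" using b \<open>c \<ge> 0\<close> by auto
      ultimately show "c *\<^sub>R x \<in> ?R" by (intro CollectI exI[of _ "\<lambda>u. c * b u"]) blast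
    qed
  qed
  show "?R \<subseteq> convex_cone hull W"
  proof clarify
    fix b :: "'a \<Rightarrow> real" assume "\<forall>u\<in>W. b u \<ge> 0"
    thus "(\<Sum>u\<in>W. b u *\<^sub>R u) \<in> convex_cone hull W"
      by (intro convex_cone_sum[OF convex_cone_convex_cone_hull]
          convex_cone_scaleR[OF convex_cone_convex_cone_hull] hull_inc) auto
  qed
qed

lemma convex_cone_hull_singleton: "x \<in> convex_cone hull {u} \<longleftrightarrow> (\<exists>c\<ge>0. x = c *\<^sub>R u)"
  by (auto simp: convex_cone_hull_finite)

text \<open>\<open>x + y\<close> is the midpoint of \<open>2 x\<close> and \<open>2 y\<close>. For
  \<open>x = y\<close> the open segment is empty, so this case is separate.\<close>

lemma face_of_cone_add:
  assumes "T face_of C" "convex_cone C" "convex_cone T" "x \<in> C" "y \<in> C" "x + y \<in> T"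
  shows "x \<in> T"
proof (cases "x = y")
  case True
  hence "x = (1/2) *\<^sub>R (x + y)" by (simp add: scaleR_2[symmetric])
  thus ?thesis using convex_cone_scaleR[OF assms(3) _ assms(6), of "1/2"] by simp
next
  case False
  have "x + y = (1 - 1/2) *\<^sub>R (2 *\<^sub>R x) + (1/2) *\<^sub>R (2 *\<^sub>R y)" by simp
  hence "x + y \<in> open_segment (2 *\<^sub>R x) (2 *\<^sub>R y)"
    using False unfolding in_segment by (intro conjI exI[of _ "1/2"]) auto
  moreover have "2 *\<^sub>R x \<in> C" "2 *\<^sub>R y \<in> C"
    using assms(4,5) by (auto intro!: convex_cone_scaleR[OF assms(2)])
  moreover have "\<forall>a\<in>C. \<forall>b\<in>C. \<forall>x\<in>T. x \<in> open_segment a b \<longrightarrow> a \<in> T \<and> b \<in> T"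
    using assms(1) by (simp add: face_of_def)
  ultimately have "2 *\<^sub>R x \<in> T" using assms(6) by blast
  thus ?thesis using convex_cone_scaleR[OF assms(3), of "1/2" "2 *\<^sub>R x"] by simp
qed

text \<open>Coefficients are unique by independence. If a point strictly between \<open>a\<close>
  and \<open>b\<close> lies on the ray, then at every other generator a positive combination of two
  nonnegative coefficients is zero, so both vanish.\<close>

lemma generator_ray_face_of:
  fixes W :: "'a::euclidean_space set"
  assumes "independent W" "u \<in> W"
  shows "convex_cone hull {u} face_of convex_cone hull W"
proof -
  have fin: "finite W" using independent_imp_finite[OF assms(1)] .
  show ?thesis unfolding face_of_def
  proof (intro conjI ballI impI)
    show "convex_cone hull {u} \<subseteq> convex_cone hull W" using assms(2) by (intro hull_mono) auto
    show "convex (convex_cone hull {u})" by (rule convex_convex_cone_hull)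
    fix a b x assume a: "a \<in> convex_cone hull W" and b: "b \<in> convex_cone hull W"
      and x: "x \<in> convex_cone hull {u}" "x \<in> open_segment a b"
    obtain A where A: "\<forall>u\<in>W. A u \<ge> 0" "a = (\<Sum>u\<in>W. A u *\<^sub>R u)"
      using a unfolding convex_cone_hull_finite[OF fin] by blast
    obtain B where B: "\<forall>u\<in>W. B u \<ge> 0" "b = (\<Sum>u\<in>W. B u *\<^sub>R u)"
      using b unfolding convex_cone_hull_finite[OF fin] by blast
    obtain c where c: "x = c *\<^sub>R u" using x(1) by (auto simp: convex_cone_hull_singleton)
    obtain t where t: "0 < t" "t < 1" "x = (1 - t) *\<^sub>R a + t *\<^sub>R b" using x(2) by (auto simp: in_segment)
    have cu: "c *\<^sub>R u = (\<Sum>w\<in>W. (if w = u then c else 0) *\<^sub>R w)"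
    proof -
      have "(\<Sum>w\<in>W. (if w = u then c else 0) *\<^sub>R w) = (\<Sum>w\<in>W. if w = u then c *\<^sub>R w else 0)"
        by (rule sum.cong) auto
      thus ?thesis using fin assms(2) by simp
    qed
    have comb: "(\<Sum>w\<in>W. ((1 - t) * A w + t * B w - (if w = u then c else 0)) *\<^sub>R w) = 0"
    proof -
      have "(\<Sum>w\<in>W. ((1 - t) * A w + t * B w - (if w = u then c else 0)) *\<^sub>R w)
          = (1 - t) *\<^sub>R a + t *\<^sub>R b - c *\<^sub>R u"
        unfolding A(2) B(2) cu
        by (simp add: scaleR_left_distrib scaleR_left_diff_distrib sum.distrib sum_subtractf scaleR_sum_right)
      thus ?thesis using t(3) c by simp
    qed
    have zero: "(1 - t) * A w + t * B w - (if w = u then c else 0) = 0" if "w \<in> W" for w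
      by (rule independentD[OF assms(1) fin subset_refl comb that])
    have AB: "A w = 0 \<and> B w = 0" if "w \<in> W" "w \<noteq> u" for w
    proof -
      have "(1 - t) * A w \<ge> 0" "t * B w \<ge> 0" using A B t that by auto
      moreover have "(1 - t) * A w + t * B w = 0" using zero[OF that(1)] that(2) by simp
      ultimately have "(1 - t) * A w = 0" "t * B w = 0" by linarith+
      thus ?thesis using t by auto
    qed
    have red: "(\<Sum>w\<in>W. D w *\<^sub>R w) = D u *\<^sub>R u" if "\<And>w. w \<in> W \<Longrightarrow> w \<noteq> u \<Longrightarrow> D w = 0" for D :: "'a \<Rightarrow> real"
      using sum.mono_neutral_right[of W "{u}" "\<lambda>w. D w *\<^sub>R w"] fin assms(2) that by auto
    show "a \<in> convex_cone hull {u}" "b \<in> convex_cone hull {u}"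
      using red[of A] red[of B] AB A B assms(2) by (auto simp: convex_cone_hull_singleton)
  qed
qed

section \<open>Ray generators of the cones of a simplicial fan\<close>

locale toric_fan =
  fixes \<Sigma> :: "(real ^ 'n) set set" and v :: "'r::finite \<Rightarrow> int ^ 'n"
  assumes complete: "complete_fan \<Sigma>" and simplicial: "simplicial_fan \<Sigma>"
    and generators: "primitive_ray_generators \<Sigma> v"
begin

abbreviation w :: "'r \<Rightarrow> real ^ 'n" where "w j \<equiv> real_vec (v j)"

definition rays_of :: "(real ^ 'n) set \<Rightarrow> 'r set" where
  "rays_of \<sigma> = {j. ray v j \<subseteq> \<sigma>}"

definition max_cones :: "'r set set" where
  "max_cones = rays_of ` {\<sigma>\<in>\<Sigma>. dim \<sigma> = CARD('n)}"

lemma fan_props: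
  shows "finite \<Sigma>" "\<And>\<sigma> \<tau>. \<sigma> \<in> \<Sigma> \<Longrightarrow> \<tau> face_of \<sigma> \<Longrightarrow> \<tau> \<noteq> {} \<Longrightarrow> \<tau> \<in> \<Sigma>"
    "\<And>\<sigma> \<tau>. \<sigma> \<in> \<Sigma> \<Longrightarrow> \<tau> \<in> \<Sigma> \<Longrightarrow> (\<sigma> \<inter> \<tau>) face_of \<sigma>" "\<Union>\<Sigma> = UNIV"
    "\<And>\<sigma>. \<sigma> \<in> \<Sigma> \<Longrightarrow> \<exists>W. independent W \<and> \<sigma> = convex_cone hull W"
proof -
  have fan: "fan \<Sigma>" using complete by (simp add: complete_fan_def)
  show "finite \<Sigma>" using fan by (simp add: fan_def)
  show "\<Union>\<Sigma> = UNIV" using complete by (simp add: complete_fan_def)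
  show "\<tau> \<in> \<Sigma>" if "\<sigma> \<in> \<Sigma>" "\<tau> face_of \<sigma>" "\<tau> \<noteq> {}" for \<sigma> \<tau> using fan that by (simp add: fan_def)
  show "(\<sigma> \<inter> \<tau>) face_of \<sigma>" if "\<sigma> \<in> \<Sigma>" "\<tau> \<in> \<Sigma>" for \<sigma> \<tau> using fan that by (simp add: fan_def)
  show "\<exists>W. independent W \<and> \<sigma> = convex_cone hull W" if "\<sigma> \<in> \<Sigma>" for \<sigma>
    using simplicial that by (simp add: simplicial_fan_def)
qed

lemma ray_in_fan: "ray v j \<in> \<Sigma>" and dim_ray: "dim (ray v j) = 1"
  and ray_inj: "ray v i = ray v j \<Longrightarrow> i = j"
  and ray_surj: "\<rho> \<in> \<Sigma> \<Longrightarrow> dim \<rho> = 1 \<Longrightarrow> \<exists>j. \<rho> = ray v j"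
proof -
  have b: "bij_betw (ray v) UNIV {\<rho>\<in>\<Sigma>. dim \<rho> = 1}"
    using generators by (simp add: primitive_ray_generators_def)
  show "ray v j \<in> \<Sigma>" "dim (ray v j) = 1" using bij_betwE[OF b] by auto
  show "ray v i = ray v j \<Longrightarrow> i = j" using bij_betw_imp_inj_on[OF b] by (simp add: inj_on_def)
  show "\<rho> \<in> \<Sigma> \<Longrightarrow> dim \<rho> = 1 \<Longrightarrow> \<exists>j. \<rho> = ray v j" using bij_betw_imp_surj_on[OF b] by blast
qed

lemma in_ray: "x \<in> ray v j \<longleftrightarrow> (\<exists>c\<ge>0. x = c *\<^sub>R w j)"
  by (simp add: ray_def convex_cone_hull_singleton)

lemma w_in_ray: "w j \<in> ray v j"
  unfolding in_ray by (intro exI[of _ 1]) simp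

lemma w_nonzero: "w j \<noteq> 0"
proof
  assume "w j = 0"
  hence "ray v j \<subseteq> {0}" by (auto simp: in_ray)
  hence "dim (ray v j) \<le> dim {0 :: real ^ 'n}" by (rule dim_subset)
  thus False by (simp add: dim_ray)
qed

lemma convex_cone_fan: "\<sigma> \<in> \<Sigma> \<Longrightarrow> convex_cone \<sigma>"
  using fan_props(5) convex_cone_convex_cone_hull by metis

lemma ray_subset_iff: "\<sigma> \<in> \<Sigma> \<Longrightarrow> j \<in> rays_of \<sigma> \<longleftrightarrow> w j \<in> \<sigma>"
  unfolding rays_of_def mem_Collect_eq
proof
  show "w j \<in> \<sigma>" if "ray v j \<subseteq> \<sigma>" using that w_in_ray[of j] by blast
  show "ray v j \<subseteq> \<sigma>" if "\<sigma> \<in> \<Sigma>" "w j \<in> \<sigma>"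
    using convex_cone_scaleR[OF convex_cone_fan[OF that(1)] _ that(2)] by (auto simp: in_ray)
qed

text \<open>A generator spans a one-dimensional face, which belongs to the fan and is thus one of
  the rays. Together with \<open>ray_is_generator\<close> this identifies the abstract generators of
  a simplicial cone with its vectors \<open>w j\<close> up to positive factors.\<close>

lemma generator_is_ray:
  assumes "\<sigma> \<in> \<Sigma>" "independent W" "\<sigma> = convex_cone hull W" "u \<in> W"
  obtains j c where "j \<in> rays_of \<sigma>" "c > 0" "w j = c *\<^sub>R u"
proof -
  have face: "convex_cone hull {u} face_of \<sigma>" using generator_ray_face_of[OF assms(2,4)] assms(3) by simp
  hence "convex_cone hull {u} \<in> \<Sigma>" by (rule fan_props(2)[OF assms(1) _ convex_cone_hull_nonempty])
  moreover have "dim (convex_cone hull {u}) = 1"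
  proof -
    have u0: "u \<noteq> 0" using assms(2,4) dependent_zero by blast
    have "span (convex_cone hull {u}) = span {u}"
    proof (rule span_eq[THEN iffD2], intro conjI)
      show "convex_cone hull {u} \<subseteq> span {u}"
        by (auto simp: convex_cone_hull_singleton span_base span_scale)
      show "{u} \<subseteq> span (convex_cone hull {u})" by (simp add: hull_inc span_base)
    qed
    hence "dim (convex_cone hull {u}) = dim {u}" by (metis dim_span)
    also have "independent {u}" using u0 by simp
    hence "dim {u} = 1" by (simp add: dim_eq_card_independent)
    finally show ?thesis .
  qed
  ultimately obtain j where j: "convex_cone hull {u} = ray v j" using ray_surj by blast
  have "w j \<in> convex_cone hull {u}" using w_in_ray j by simp
  then obtain c where c: "c \<ge> 0" "w j = c *\<^sub>R u" by (auto simp: convex_cone_hull_singleton)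
  have "c \<noteq> 0"
  proof
    assume "c = 0"
    thus False using c(2) w_nonzero[of j] by simp
  qed
  hence "c > 0" using c(1) by simp
  have "j \<in> rays_of \<sigma>" unfolding rays_of_def using face_of_imp_subset[OF face] j by simp
  thus ?thesis using \<open>c > 0\<close> c(2) by (rule that)
qed

text \<open>The ray is its own intersection with \<sigma>, hence a face of \<sigma>. A face contains
  the summands of its elements, so a generator that occurs in \<open>w j\<close> with positive
  coefficient lies on the ray.\<close>

lemma ray_is_generator:
  assumes "\<sigma> \<in> \<Sigma>" "independent W" "\<sigma> = convex_cone hull W" "j \<in> rays_of \<sigma>"
  shows "\<exists>u\<in>W. \<exists>c>0. w j = c *\<^sub>R u"
proof -
  have fin: "finite W" using independent_imp_finite[OF assms(2)] .
  have "w j \<in> convex_cone hull W" using assms ray_subset_iff by simp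
  then obtain b where b: "\<forall>u\<in>W. b u \<ge> 0" "w j = (\<Sum>u\<in>W. b u *\<^sub>R u)"
    unfolding convex_cone_hull_finite[OF fin] by blast
  have "\<exists>u\<in>W. b u \<noteq> 0"
  proof (rule ccontr)
    assume "\<not> ?thesis"
    hence "w j = 0" unfolding b(2) by (intro sum.neutral) auto
    thus False using w_nonzero by simp
  qed
  then obtain u where u: "u \<in> W" "b u > 0" using b(1) by force
  have cone: "convex_cone \<sigma>" by (rule convex_cone_fan[OF assms(1)])
  have W\<sigma>: "W \<subseteq> \<sigma>" unfolding assms(3) by (rule hull_subset)
  have "ray v j = \<sigma> \<inter> ray v j" using assms(4) by (auto simp: rays_of_def)
  hence face: "ray v j face_of \<sigma>" using fan_props(3)[OF assms(1) ray_in_fan[of j]] by simp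
  have "b u *\<^sub>R u \<in> ray v j"
  proof (rule face_of_cone_add[OF face cone convex_cone_fan[OF ray_in_fan]])
    show "b u *\<^sub>R u \<in> \<sigma>" using u W\<sigma> by (intro convex_cone_scaleR[OF cone]) auto
    show "(\<Sum>u'\<in>W - {u}. b u' *\<^sub>R u') \<in> \<sigma>"
      using b(1) W\<sigma> by (intro convex_cone_sum[OF cone] convex_cone_scaleR[OF cone]) auto
    have "b u *\<^sub>R u + (\<Sum>u'\<in>W - {u}. b u' *\<^sub>R u') = w j"
      unfolding b(2) using sum.remove[OF fin u(1), of "\<lambda>u. b u *\<^sub>R u"] by simp
    thus "b u *\<^sub>R u + (\<Sum>u'\<in>W - {u}. b u' *\<^sub>R u') \<in> ray v j" using w_in_ray by simp
  qed
  then obtain c where c: "c \<ge> 0" "b u *\<^sub>R u = c *\<^sub>R w j" by (auto simp: in_ray)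
  have "u \<noteq> 0" using u assms(2) dependent_zero by blast
  have "c \<noteq> 0"
  proof
    assume "c = 0"
    thus False using c(2) u(2) \<open>u \<noteq> 0\<close> by simp
  qed
  hence "c > 0" using c(1) by simp
  hence "w j = (b u / c) *\<^sub>R u" using arg_cong[OF c(2), of "\<lambda>x. (1 / c) *\<^sub>R x"] by simp
  thus ?thesis using u \<open>c > 0\<close> by (intro bexI[of _ u] exI[of _ "b u / c"]) auto
qed

lemma rays_independent:
  assumes "\<sigma> \<in> \<Sigma>" "\<And>j. j \<notin> rays_of \<sigma> \<Longrightarrow> a j = 0" "(\<Sum>j\<in>UNIV. a j *\<^sub>R w j) = 0"
  shows "a i = 0"
proof (cases "i \<in> rays_of \<sigma>")
  case True
  obtain W where W: "independent W" "\<sigma> = convex_cone hull W" using fan_props(5)[OF assms(1)] by blast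
  have "\<forall>j\<in>rays_of \<sigma>. \<exists>u. u \<in> W \<and> (\<exists>c>0. w j = c *\<^sub>R u)" using ray_is_generator[OF assms(1) W] by blast
  then obtain f where f: "\<And>j. j \<in> rays_of \<sigma> \<Longrightarrow> f j \<in> W \<and> (\<exists>c>0. w j = c *\<^sub>R f j)" by metis
  then obtain c where c: "\<And>j. j \<in> rays_of \<sigma> \<Longrightarrow> c j > 0 \<and> w j = c j *\<^sub>R f j" by metis
  have inj: "inj_on f (rays_of \<sigma>)"
  proof (rule inj_onI)
    fix j k assume jk: "j \<in> rays_of \<sigma>" "k \<in> rays_of \<sigma>" "f j = f k"
    have r: "ray v j = convex_cone hull {f j}" if "j \<in> rays_of \<sigma>" for j
    proof -
      have "w j = c j *\<^sub>R f j" "c j > 0" using c[OF that] by auto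
      have "x \<in> ray v j \<longleftrightarrow> x \<in> convex_cone hull {f j}" for x
      proof
        assume "x \<in> ray v j"
        then obtain d where "d \<ge> 0" "x = d *\<^sub>R w j" by (auto simp: in_ray)
        thus "x \<in> convex_cone hull {f j}" unfolding convex_cone_hull_singleton
          using \<open>w j = c j *\<^sub>R f j\<close> \<open>c j > 0\<close> by (intro exI[of _ "d * c j"]) auto
      next
        assume "x \<in> convex_cone hull {f j}"
        then obtain d where "d \<ge> 0" "x = d *\<^sub>R f j" by (auto simp: convex_cone_hull_singleton)
        thus "x \<in> ray v j" unfolding in_ray
          using \<open>w j = c j *\<^sub>R f j\<close> \<open>c j > 0\<close> by (intro exI[of _ "d / c j"]) auto
      qed
      thus ?thesis by blast
    qed
    show "j = k" by (rule ray_inj) (use r jk in simp)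
  qed
  have "(\<Sum>j\<in>UNIV. a j *\<^sub>R w j) = (\<Sum>j\<in>rays_of \<sigma>. a j *\<^sub>R w j)"
    by (rule sum.mono_neutral_right) (use assms(2) in auto)
  also have "\<dots> = (\<Sum>j\<in>rays_of \<sigma>. (a j * c j) *\<^sub>R f j)"
    by (rule sum.cong) (use c in \<open>metis scaleR_scaleR\<close>)+
  also have "\<dots> = (\<Sum>u\<in>f ` rays_of \<sigma>. (a (inv_into (rays_of \<sigma>) f u) * c (inv_into (rays_of \<sigma>) f u)) *\<^sub>R u)"
    by (subst sum.reindex[OF inj]) (auto intro!: sum.cong simp: inv_into_f_f[OF inj])
  finally have z: "(\<Sum>u\<in>f ` rays_of \<sigma>. (a (inv_into (rays_of \<sigma>) f u) * c (inv_into (rays_of \<sigma>) f u)) *\<^sub>R u) = 0"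
    using assms(3) by simp
  have "f ` rays_of \<sigma> \<subseteq> W" using f by blast
  from independentD[OF W(1) _ this z, of "f i"] True
  have "a i * c i = 0" by (simp add: inv_into_f_f[OF inj])
  thus ?thesis using c[OF True] by auto
qed (use assms(2) in auto)

lemma cone_nonneg_combination:
  assumes "\<sigma> \<in> \<Sigma>"
  shows "x \<in> \<sigma> \<longleftrightarrow> (\<exists>a. (\<forall>j. a j \<ge> 0) \<and> (\<forall>j. j \<notin> rays_of \<sigma> \<longrightarrow> a j = 0) \<and> (\<Sum>j\<in>UNIV. a j *\<^sub>R w j) = x)"
proof
  obtain W where W: "independent W" "\<sigma> = convex_cone hull W" using fan_props(5)[OF assms] by blast
  have fin: "finite W" using independent_imp_finite[OF W(1)] .
  assume "x \<in> \<sigma>"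
  then obtain b where b: "\<forall>u\<in>W. b u \<ge> 0" "x = (\<Sum>u\<in>W. b u *\<^sub>R u)"
    unfolding W(2) convex_cone_hull_finite[OF fin] by blast
  have "\<forall>u\<in>W. \<exists>j c. j \<in> rays_of \<sigma> \<and> c > 0 \<and> w j = c *\<^sub>R u"
    using generator_is_ray[OF assms W] by metis
  then obtain g c where g: "\<And>u. u \<in> W \<Longrightarrow> g u \<in> rays_of \<sigma> \<and> c u > 0 \<and> w (g u) = c u *\<^sub>R u"
    by metis
  \<comment> \<open>The choice of \<open>g\<close> might send several generators to one ray, so
    their coefficients are collected over its fibres.\<close>
  define a where "a = (\<lambda>j. \<Sum>u\<in>{u\<in>W. g u = j}. b u / c u)"
  have "(\<Sum>j\<in>UNIV. a j *\<^sub>R w j) = (\<Sum>j\<in>UNIV. \<Sum>u\<in>{u\<in>W. g u = j}. (b u / c u) *\<^sub>R w (g u))"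
    unfolding a_def scaleR_sum_left by (intro sum.cong) auto
  also have "\<dots> = (\<Sum>u\<in>W. (b u / c u) *\<^sub>R w (g u))"
    by (rule sum.group) (use fin in auto)
  also have "\<dots> = (\<Sum>u\<in>W. b u *\<^sub>R u)"
  proof (rule sum.cong)
    fix u assume u: "u \<in> W"
    hence "w (g u) = c u *\<^sub>R u" "c u > 0" using g by auto
    thus "(b u / c u) *\<^sub>R w (g u) = b u *\<^sub>R u" by simp
  qed simp
  finally have "(\<Sum>j\<in>UNIV. a j *\<^sub>R w j) = x" using b(2) by simp
  moreover have "a j \<ge> 0" for j
    unfolding a_def using b(1) g by (intro sum_nonneg divide_nonneg_nonneg) (auto intro: less_imp_le)
  moreover have "a j = 0" if "j \<notin> rays_of \<sigma>" for j
  proof -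
    have "{u \<in> W. g u = j} = {}" using g that by auto
    thus ?thesis unfolding a_def by (simp only: sum.empty)
  qed
  ultimately show "\<exists>a. (\<forall>j. a j \<ge> 0) \<and> (\<forall>j. j \<notin> rays_of \<sigma> \<longrightarrow> a j = 0) \<and> (\<Sum>j\<in>UNIV. a j *\<^sub>R w j) = x"
    by blast
next
  assume "\<exists>a. (\<forall>j. a j \<ge> 0) \<and> (\<forall>j. j \<notin> rays_of \<sigma> \<longrightarrow> a j = 0) \<and> (\<Sum>j\<in>UNIV. a j *\<^sub>R w j) = x"
  then obtain a where a: "\<forall>j. a j \<ge> 0" "\<forall>j. j \<notin> rays_of \<sigma> \<longrightarrow> a j = 0" "x = (\<Sum>j\<in>UNIV. a j *\<^sub>R w j)" by blast
  have cone: "convex_cone \<sigma>" by (rule convex_cone_fan[OF assms])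
  have "a j *\<^sub>R w j \<in> \<sigma>" for j
    using a ray_subset_iff[OF assms, of j] convex_cone_scaleR[OF cone] convex_cone_contains_0[OF cone]
    by (cases "j \<in> rays_of \<sigma>") auto
  thus "x \<in> \<sigma>" unfolding a(3) by (rule convex_cone_sum[OF cone])
qed

text \<open>The common vector lies in \<open>\<sigma> \<inter> \<sigma>'\<close>, a face of
  \<sigma>, which contains all summands of the first combination. Both combinations are therefore
  supported on the rays of \<sigma>', and these are independent.\<close>

lemma nonneg_combination_unique:
  assumes "\<sigma> \<in> \<Sigma>" "\<sigma>' \<in> \<Sigma>" "\<And>j. a j \<ge> 0" "\<And>j. b j \<ge> 0"
    "\<And>j. j \<notin> rays_of \<sigma> \<Longrightarrow> a j = 0" "\<And>j. j \<notin> rays_of \<sigma>' \<Longrightarrow> b j = 0"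
    "(\<Sum>j\<in>UNIV. a j *\<^sub>R w j) = (\<Sum>j\<in>UNIV. b j *\<^sub>R w j)"
  shows "a i = b i"
proof -
  define x where "x = (\<Sum>j\<in>UNIV. a j *\<^sub>R w j)"
  have "x \<in> \<sigma>" "x \<in> \<sigma>'"
    using cone_nonneg_combination[OF assms(1), of x] cone_nonneg_combination[OF assms(2), of x] assms
    by (auto simp: x_def)
  have cone: "convex_cone \<sigma>" "convex_cone (\<sigma> \<inter> \<sigma>')"
    using convex_cone_fan assms(1,2) convex_cone_Inter[of "{\<sigma>, \<sigma>'}"] by auto
  have a\<sigma>: "a j *\<^sub>R w j \<in> \<sigma>" for j
    using assms(3)[of j] assms(5)[of j] ray_subset_iff[OF assms(1), of j]
      convex_cone_scaleR[OF cone(1)] convex_cone_contains_0[OF cone(1)]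
    by (cases "j \<in> rays_of \<sigma>") auto
  have "a j = 0" if "j \<notin> rays_of \<sigma>'" for j
  proof (rule ccontr)
    assume "a j \<noteq> 0"
    have "a j *\<^sub>R w j \<in> \<sigma> \<inter> \<sigma>'"
    proof (rule face_of_cone_add[OF fan_props(3)[OF assms(1,2)] cone a\<sigma>])
      show "(\<Sum>k\<in>UNIV - {j}. a k *\<^sub>R w k) \<in> \<sigma>" by (rule convex_cone_sum[OF cone(1) a\<sigma>])
      have "a j *\<^sub>R w j + (\<Sum>k\<in>UNIV - {j}. a k *\<^sub>R w k) = x"
        unfolding x_def using sum.remove[of UNIV j "\<lambda>j. a j *\<^sub>R w j"] by simp
      thus "a j *\<^sub>R w j + (\<Sum>k\<in>UNIV - {j}. a k *\<^sub>R w k) \<in> \<sigma> \<inter> \<sigma>'"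
        using \<open>x \<in> \<sigma>\<close> \<open>x \<in> \<sigma>'\<close> by simp
    qed
    hence "a j *\<^sub>R w j \<in> \<sigma>'" by blast
    from convex_cone_scaleR[OF convex_cone_fan[OF assms(2)] _ this, of "1 / a j"]
    have "(1 / a j) *\<^sub>R (a j *\<^sub>R w j) \<in> \<sigma>'" using assms(3)[of j] by (simp only: zero_le_divide_1_iff)
    hence "w j \<in> \<sigma>'" using \<open>a j \<noteq> 0\<close> by simp
    thus False using ray_subset_iff[OF assms(2)] that by blast
  qed
  hence supp: "a j - b j = 0" if "j \<notin> rays_of \<sigma>'" for j using that assms(6) by simp
  have "(\<Sum>j\<in>UNIV. (a j - b j) *\<^sub>R w j) = (\<Sum>j\<in>UNIV. a j *\<^sub>R w j) - (\<Sum>j\<in>UNIV. b j *\<^sub>R w j)"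
    by (simp add: scaleR_left_diff_distrib sum_subtractf)
  also have "\<dots> = 0" using assms(7) by simp
  finally have sum0: "(\<Sum>j\<in>UNIV. (a j - b j) *\<^sub>R w j) = 0" .
  have "a i - b i = 0"
    by (rule rays_independent[of \<sigma>' "\<lambda>i. a i - b i" i]) (fact assms(2) supp sum0)+
  thus ?thesis by simp
qed

lemma closed_cone: "\<sigma> \<in> \<Sigma> \<Longrightarrow> closed \<sigma>"
  using fan_props(5) closed_convex_cone_hull independent_imp_finite by metis

end


section \<open>Full-dimensional cones of a complete fan\<close>

context toric_fan
begin

text \<open>The complement of the union of the full-dimensional cones is open, and by completeness
  it is covered by finitely many cones of smaller dimension. A negligible open set is empty.\<close>

lemma full_dimensional_cones_cover: "\<exists>\<sigma>\<in>\<Sigma>. dim \<sigma> = CARD('n) \<and> x \<in> \<sigma>"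
proof (rule ccontr)
  assume no: "\<not> ?thesis"
  define U where "U = \<Union>{\<sigma>\<in>\<Sigma>. dim \<sigma> = CARD('n)}"
  have "closed U" unfolding U_def by (rule closed_Union) (use fan_props(1) closed_cone in auto)
  hence "open (- U)" by (rule open_Compl)
  have "x \<in> - U" using no by (auto simp: U_def)
  have "negligible (\<Union>{\<sigma>\<in>\<Sigma>. dim \<sigma> \<noteq> CARD('n)})"
  proof (rule negligible_Union)
    fix \<sigma> assume "\<sigma> \<in> {\<sigma>\<in>\<Sigma>. dim \<sigma> \<noteq> CARD('n)}"
    hence "dim \<sigma> < DIM(real ^ 'n)" using dim_subset_UNIV[of \<sigma>] by simp
    thus "negligible \<sigma>" by (rule negligible_lowdim)
  qed (use fan_props(1) in auto)
  moreover have "- U \<subseteq> \<Union>{\<sigma>\<in>\<Sigma>. dim \<sigma> \<noteq> CARD('n)}" using fan_props(4) by (auto simp: U_def)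
  ultimately have "negligible (- U)" by (rule negligible_subset)
  thus False using open_not_negligible[OF \<open>open (- U)\<close>] \<open>x \<in> - U\<close> by auto
qed

lemma rays_spanning:
  assumes "\<sigma> \<in> \<Sigma>" "dim \<sigma> = CARD('n)"
  shows "\<exists>a. (\<forall>j. j \<notin> rays_of \<sigma> \<longrightarrow> a j = 0) \<and> (\<Sum>j\<in>UNIV. a j *\<^sub>R w j) = x"
proof -
  let ?V = "{\<Sum>j\<in>UNIV. a j *\<^sub>R w j | a. \<forall>j. j \<notin> rays_of \<sigma> \<longrightarrow> a j = 0}"
  have "subspace ?V" unfolding subspace_def
  proof (intro conjI ballI allI)
    show "0 \<in> ?V" by (intro CollectI exI[of _ "\<lambda>_. 0"]) simp
    fix x assume "x \<in> ?V"
    then obtain a where a: "x = (\<Sum>j\<in>UNIV. a j *\<^sub>R w j)" "\<forall>j. j \<notin> rays_of \<sigma> \<longrightarrow> a j = 0" by blast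
    show "c *\<^sub>R x \<in> ?V" for c
      using a by (intro CollectI exI[of _ "\<lambda>j. c * a j"]) (simp add: scaleR_sum_right)
    fix y assume "y \<in> ?V"
    then obtain b where b: "y = (\<Sum>j\<in>UNIV. b j *\<^sub>R w j)" "\<forall>j. j \<notin> rays_of \<sigma> \<longrightarrow> b j = 0" by blast
    show "x + y \<in> ?V"
      using a b by (intro CollectI exI[of _ "\<lambda>j. a j + b j"]) (simp add: scaleR_left_distrib sum.distrib)
  qed
  moreover have "\<sigma> \<subseteq> ?V"
  proof
    fix y assume "y \<in> \<sigma>"
    then obtain a where "\<forall>j. j \<notin> rays_of \<sigma> \<longrightarrow> a j = 0" "(\<Sum>j\<in>UNIV. a j *\<^sub>R w j) = y"
      unfolding cone_nonneg_combination[OF assms(1)] by (elim exE conjE)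
    thus "y \<in> ?V" by (intro CollectI exI[of _ a]) auto
  qed
  ultimately have "span \<sigma> \<subseteq> ?V" by (intro span_minimal)
  moreover have "span \<sigma> = UNIV" using assms(2) dim_eq_full[of \<sigma>] by simp
  ultimately have "x \<in> ?V" by auto
  then obtain a where "\<forall>j. j \<notin> rays_of \<sigma> \<longrightarrow> a j = 0" "x = (\<Sum>j\<in>UNIV. a j *\<^sub>R w j)"
    by (elim CollectE exE conjE)
  thus ?thesis by (intro exI[of _ a]) auto
qed

lemma max_conesE:
  assumes "s \<in> max_cones"
  obtains \<sigma> where "\<sigma> \<in> \<Sigma>" "dim \<sigma> = CARD('n)" "s = rays_of \<sigma>"
  using assms by (auto simp: max_cones_def)

sublocale complete_simplicial w max_cones
proof
  fix x
  obtain \<sigma> where \<sigma>: "\<sigma> \<in> \<Sigma>" "dim \<sigma> = CARD('n)" "x \<in> \<sigma>" using full_dimensional_cones_cover by blast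
  have "rays_of \<sigma> \<in> max_cones" unfolding max_cones_def using \<sigma> by (intro imageI) simp
  moreover have "\<exists>a. (\<forall>j. a j \<ge> 0) \<and> (\<forall>j. j \<notin> rays_of \<sigma> \<longrightarrow> a j = 0) \<and> (\<Sum>j\<in>UNIV. a j *\<^sub>R w j) = x"
    by (rule iffD1[OF cone_nonneg_combination[OF \<sigma>(1)] \<sigma>(3)])
  ultimately show "\<exists>s\<in>max_cones. \<exists>a. (\<forall>j. a j \<ge> 0) \<and> (\<forall>j. j \<notin> s \<longrightarrow> a j = 0) \<and> (\<Sum>j\<in>UNIV. a j *\<^sub>R w j) = x"
    by (intro bexI[of _ "rays_of \<sigma>"])
next
  fix s x assume "s \<in> max_cones"
  then obtain \<sigma> where \<sigma>: "\<sigma> \<in> \<Sigma>" "dim \<sigma> = CARD('n)" "s = rays_of \<sigma>" by (rule max_conesE)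
  show "\<exists>a. (\<forall>j. j \<notin> s \<longrightarrow> a j = 0) \<and> (\<Sum>j\<in>UNIV. a j *\<^sub>R w j) = x"
    unfolding \<sigma>(3) by (rule rays_spanning[OF \<sigma>(1,2)])
next
  fix s a i assume s: "s \<in> max_cones" and a: "\<And>j. j \<notin> s \<Longrightarrow> a j = 0" "(\<Sum>j\<in>UNIV. a j *\<^sub>R w j) = 0"
  obtain \<sigma> where \<sigma>: "\<sigma> \<in> \<Sigma>" "dim \<sigma> = CARD('n)" "s = rays_of \<sigma>" using s by (rule max_conesE)
  show "a i = 0" by (rule rays_independent[OF \<sigma>(1) a[unfolded \<sigma>(3)]])
next
  fix s s' a b i
  assume s: "s \<in> max_cones" "s' \<in> max_cones" and nn: "\<And>j. a j \<ge> 0" "\<And>j. b j \<ge> 0"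
    and supp: "\<And>j. j \<notin> s \<Longrightarrow> a j = 0" "\<And>j. j \<notin> s' \<Longrightarrow> b j = 0"
    and eq: "(\<Sum>j\<in>UNIV. a j *\<^sub>R w j) = (\<Sum>j\<in>UNIV. b j *\<^sub>R w j)"
  obtain \<sigma> where \<sigma>: "\<sigma> \<in> \<Sigma>" "dim \<sigma> = CARD('n)" "s = rays_of \<sigma>" using s(1) by (rule max_conesE)
  obtain \<sigma>' where \<sigma>': "\<sigma>' \<in> \<Sigma>" "dim \<sigma>' = CARD('n)" "s' = rays_of \<sigma>'" using s(2) by (rule max_conesE)
  show "a i = b i"
    by (rule nonneg_combination_unique[OF \<sigma>(1) \<sigma>'(1) nn supp[unfolded \<sigma>(3) \<sigma>'(3)] eq])
qed

end


subsection \<open>Lattice points of polytopes\<close>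

lemma inner_real_vec: "real_vec m \<bullet> real_vec u = of_int (pairing m u)"
  by (simp add: inner_vec_def real_vec_def pairing_def)

lemma real_vec_add: "real_vec (a + b) = real_vec a + real_vec b"
  and real_vec_diff: "real_vec (a - b) = real_vec a - real_vec b"
  and real_vec_zero [simp]: "real_vec 0 = 0"
  by (simp_all add: real_vec_def vec_eq_iff)

lemma real_vec_sum: "real_vec (sum f A) = (\<Sum>i\<in>A. real_vec (f i))"
  by (induction A rule: infinite_finite_induct) (simp_all add: real_vec_add)

lemma real_vec_eq_iff [simp]: "real_vec a = real_vec b \<longleftrightarrow> a = b"
  by (simp add: real_vec_def vec_eq_iff)

lemma pairing_sum_left: "pairing (sum f A) u = (\<Sum>i\<in>A. pairing (f i) u)"
  by (induction A rule: infinite_finite_induct) (simp_all add: pairing_add_left)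

definition lattice_box :: "nat \<Rightarrow> (int ^ 'n) set" where
  "lattice_box B = {m. \<forall>k. \<bar>m $ k\<bar> \<le> int B}"

lemma card_functions_box:
  "finite {f :: 'i::finite \<Rightarrow> int. \<forall>k. f k \<in> A k}" "card {f :: 'i \<Rightarrow> int. \<forall>k. f k \<in> A k} = (\<Prod>k\<in>UNIV. card (A k))"
  if "\<And>k. finite (A k)"
proof -
  have "{f :: 'i \<Rightarrow> int. \<forall>k. f k \<in> A k} = PiE UNIV A" by (auto simp: PiE_def)
  thus "finite {f :: 'i::finite \<Rightarrow> int. \<forall>k. f k \<in> A k}" "card {f :: 'i \<Rightarrow> int. \<forall>k. f k \<in> A k} = (\<Prod>k\<in>UNIV. card (A k))"
    using that by (simp_all add: card_PiE finite_PiE)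
qed

lemma inj_vec_nth: "inj_on vec_nth A"
  by (rule inj_onI) (simp add: vec_nth_inject)

lemma finite_lattice_box: "finite (lattice_box B :: (int ^ 'n) set)"
proof (rule finite_imageD[OF _ inj_vec_nth])
  show "finite (vec_nth ` (lattice_box B :: (int ^ 'n) set))"
    by (rule finite_subset[OF _ card_functions_box(1)[of "\<lambda>_. {- int B..int B}"]])
       (auto simp: lattice_box_def abs_le_iff minus_le_iff)
qed

text \<open>A coordinate \<open>i\<close> with \<open>u $ i \<noteq> 0\<close> is determined by the
  others, so overwriting it by 0 is injective on the hyperplane.\<close>

lemma card_lattice_box_hyperplane:
  fixes u :: "int ^ 'n"
  assumes "u \<noteq> 0"
  shows "card {m \<in> lattice_box B. pairing m u = c} \<le> (2 * B + 1) ^ (CARD('n) - 1)"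
proof -
  obtain i where i: "u $ i \<noteq> 0" using assms by (auto simp: vec_eq_iff)
  let ?H = "{m \<in> lattice_box B. pairing m u = c}"
  let ?A = "\<lambda>k. if k = i then {0} else {- int B..int B}"
  let ?f = "\<lambda>m k. if k = i then 0 else m $ k"
  have inj: "inj_on ?f ?H"
  proof (rule inj_onI)
    fix a b assume ab: "a \<in> ?H" "b \<in> ?H" "?f a = ?f b"
    have ne: "a $ k = b $ k" if "k \<noteq> i" for k using fun_cong[OF ab(3), of k] that by simp
    have "0 = pairing a u - pairing b u" using ab by simp
    also have "\<dots> = (\<Sum>k\<in>UNIV. (a $ k - b $ k) * u $ k)"
      by (simp add: pairing_def sum_subtractf left_diff_distrib)
    also have "\<dots> = (\<Sum>k\<in>UNIV. if k = i then (a $ i - b $ i) * u $ i else 0)"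
      by (rule sum.cong) (use ne in auto)
    finally have "(a $ i - b $ i) * u $ i = 0" by simp
    hence "a $ i = b $ i" using i by simp
    thus "a = b" using ne by (metis vec_eq_iff)
  qed
  have "?f ` ?H \<subseteq> {f. \<forall>k. f k \<in> ?A k}" by (auto simp: lattice_box_def abs_le_iff minus_le_iff)
  hence "card (?f ` ?H) \<le> card {f. \<forall>k. f k \<in> ?A k}" by (intro card_mono card_functions_box) auto
  also have "\<dots> = (\<Prod>k\<in>UNIV. card (?A k))" by (rule card_functions_box) auto
  also have "\<dots> = (\<Prod>k\<in>UNIV - {i}. card (?A k))" by (subst prod.remove[of UNIV i]) auto
  also have "\<dots> = (\<Prod>k\<in>UNIV - {i}. 2 * B + 1)" by (rule prod.cong) auto
  also have "\<dots> = (2 * B + 1) ^ (CARD('n) - 1)" by simp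
  finally show ?thesis using inj by (simp add: card_image)
qed

definition polytope_points :: "('r \<Rightarrow> int ^ 'n) \<Rightarrow> 'r divisor \<Rightarrow> (int ^ 'n) set" where
  "polytope_points v D = {m. \<forall>j. pairing m (v j) \<ge> - D j}"

context toric_fan
begin

text \<open>Every vector is a nonnegative combination of rays, so the inequalities of the polytope
  bound \<open>m\<close> from below in each direction, in particular along both signs of every axis.
  One \<open>R\<close> serves all \<open>K\<close>: the growth estimate needs a bound linear in
  \<open>K\<close>, and \<open>K = 0\<close> settles degree zero.\<close>

lemma polytope_points_bounded:
  "\<exists>R. \<forall>K. polytope_points v (\<lambda>j. int K * D j) \<subseteq> lattice_box (K * R)"
proof -
  have "\<exists>R::nat. \<forall>K m. m \<in> polytope_points v (\<lambda>j. int K * D j) \<longrightarrow> real_vec m \<bullet> x \<ge> - real (K * R)"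
    for x :: "real ^ 'n"
  proof -
    obtain s a where a: "\<forall>j. a j \<ge> 0" "(\<Sum>j\<in>UNIV. a j *\<^sub>R w j) = x" using cover[of x] by blast
    define R where "R = nat \<lceil>\<bar>\<Sum>j\<in>UNIV. a j * of_int (D j)\<bar>\<rceil>"
    have R: "(\<Sum>j\<in>UNIV. a j * of_int (D j)) \<le> real R" by (simp add: R_def) linarith
    have "real_vec m \<bullet> x \<ge> - real (K * R)" if m: "m \<in> polytope_points v (\<lambda>j. int K * D j)" for K m
    proof -
      have "real_vec m \<bullet> x = (\<Sum>j\<in>UNIV. a j * of_int (pairing m (v j)))"
        unfolding a(2)[symmetric] by (simp add: inner_sum_right inner_real_vec)
      also have "\<dots> \<ge> (\<Sum>j\<in>UNIV. a j * of_int (- (int K * D j)))"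
        using a(1) m by (intro sum_mono mult_left_mono) (auto simp: polytope_points_def simp del: of_int_minus of_int_mult)
      also have "(\<Sum>j\<in>UNIV. a j * of_int (- (int K * D j))) = - (real K * (\<Sum>j\<in>UNIV. a j * of_int (D j)))"
        by (simp add: sum_negf sum_distrib_left algebra_simps)
      finally show ?thesis using mult_left_mono[OF R, of "real K"] by simp
    qed
    thus ?thesis by blast
  qed
  then obtain R :: "real ^ 'n \<Rightarrow> nat" where R: "\<And>x K m. m \<in> polytope_points v (\<lambda>j. int K * D j) \<Longrightarrow> real_vec m \<bullet> x \<ge> - real (K * R x)"
    by metis
  define B where "B = (\<Sum>k\<in>UNIV. R (axis k 1) + R (- axis k 1))"
  have "m \<in> lattice_box (K * B)" if m: "m \<in> polytope_points v (\<lambda>j. int K * D j)" for K m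
    unfolding lattice_box_def
  proof (intro CollectI allI)
    fix k
    have "R (axis k 1) + R (- axis k 1) \<le> B" unfolding B_def by (rule member_le_sum) auto
    hence le: "K * R (axis k 1) \<le> K * B" "K * R (- axis k 1) \<le> K * B" by auto
    have "real_vec m \<bullet> axis k 1 = of_int (m $ k)" by (simp add: inner_axis real_vec_def)
    hence "of_int (m $ k) \<ge> - real (K * R (axis k 1))" "- of_int (m $ k) \<ge> - real (K * R (- axis k 1))"
      using R[OF m, of "axis k 1"] R[OF m, of "- axis k 1"] by auto
    hence "m $ k \<ge> - int (K * R (axis k 1))" "m $ k \<le> int (K * R (- axis k 1))" by linarith+
    thus "\<bar>m $ k\<bar> \<le> int (K * B)" using le by linarith
  qed
  thus ?thesis by blast
qed

lemma finite_polytope_points: "finite (polytope_points v D)"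
proof -
  obtain R where "polytope_points v (\<lambda>j. int 1 * D j) \<subseteq> lattice_box (1 * R)"
    using polytope_points_bounded[of D] by blast
  thus ?thesis using finite_subset[OF _ finite_lattice_box] by simp
qed

text \<open>Expanding \<open>m\<close> in the rays of a full-dimensional cone gives
  \<open>m \<bullet> m = 0\<close>.\<close>

lemma pairing_eq_0_imp:
  assumes "\<And>j. j \<in> s \<Longrightarrow> pairing m (v j) = 0" "s \<in> max_cones"
  shows "m = 0"
proof -
  have "real_vec m \<bullet> real_vec m = (\<Sum>j\<in>s. coord s (real_vec m) j * (real_vec m \<bullet> w j))"
    by (subst (2) coord_support_sum[OF assms(2), of "real_vec m", symmetric]) (simp add: inner_sum_right)
  also have "\<dots> = 0" by (rule sum.neutral) (use assms(1) in \<open>auto simp: inner_real_vec\<close>)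
  finally have "real_vec m = 0" by simp
  thus ?thesis by (metis real_vec_eq_iff real_vec_zero)
qed

lemma max_cones_nonempty: "\<exists>s. s \<in> max_cones"
  using cover[of 0] by blast

lemma card_max_cone:
  assumes "s \<in> max_cones"
  shows "card s = CARD('n)"
proof -
  have inj: "inj_on w s"
  proof (rule inj_onI)
    fix i j assume ij: "i \<in> s" "j \<in> s" "w i = w j"
    from coord_w[OF assms ij(1), of i] coord_w[OF assms ij(2), of i] ij(3) show "i = j"
      by (simp split: if_splits)
  qed
  have "independent (w ` s)"
  proof (rule independent_if_scalars_zero)
    fix f x assume z: "(\<Sum>x\<in>w ` s. f x *\<^sub>R x) = 0" and "x \<in> w ` s"
    then obtain i where i: "i \<in> s" "x = w i" by blast
    define a where "a = (\<lambda>j. if j \<in> s then f (w j) else 0)"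
    have "(\<Sum>j\<in>UNIV. a j *\<^sub>R w j) = (\<Sum>j\<in>s. f (w j) *\<^sub>R w j)"
      unfolding a_def by (rule sum.mono_neutral_cong_right) auto
    also have "\<dots> = 0" using z by (simp add: sum.reindex[OF inj])
    finally have z0: "(\<Sum>j\<in>UNIV. a j *\<^sub>R w j) = 0" .
    have supp: "\<And>j. j \<notin> s \<Longrightarrow> a j = 0" by (simp add: a_def)
    have "a i = 0" by (rule indep[OF assms supp z0])
    thus "f x = 0" using i by (simp add: a_def)
  qed simp
  moreover have "span (w ` s) = UNIV"
  proof -
    have "x \<in> span (w ` s)" for x :: "real ^ 'n"
    proof -
      have "(\<Sum>j\<in>s. coord s x j *\<^sub>R w j) \<in> span (w ` s)"
        by (intro span_sum span_scale span_base imageI)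
      thus ?thesis by (simp only: coord_support_sum[OF assms])
    qed
    thus ?thesis by blast
  qed
  ultimately have "card (w ` s) = DIM(real ^ 'n)"
    using dim_eq_card_independent[of "w ` s"] dim_eq_full[of "w ` s"] by simp
  thus ?thesis using inj by (simp add: card_image)
qed

end


subsection \<open>Exponential sums over polytopes\<close>

lemma has_sum_finite_sum:
  fixes f :: "'a \<Rightarrow> 'b \<Rightarrow> 'c::topological_comm_monoid_add"
  assumes "finite S" "\<And>s. s \<in> S \<Longrightarrow> (f s has_sum a s) A"
  shows "((\<lambda>x. \<Sum>s\<in>S. f s x) has_sum (\<Sum>s\<in>S. a s)) A"
  using assms by (induction S rule: finite_induct) (auto intro: has_sum_add)

lemma prod_of_bool: "finite A \<Longrightarrow> (\<Prod>j\<in>A. of_bool (P j)) = (of_bool (\<forall>j\<in>A. P j) :: int)"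
  by (induction A rule: finite_induct) auto

lemma abs_exp_minus_one_le: "\<bar>exp t - 1\<bar> \<le> \<bar>t\<bar> * exp \<bar>t\<bar>" for t :: real
proof (cases "t \<ge> 0")
  case True
  have "1 - exp (- t) \<le> t" using exp_ge_add_one_self[of "- t"] by simp
  hence "exp t * (1 - exp (- t)) \<le> exp t * t" by (rule mult_left_mono) simp
  moreover have "exp t * (1 - exp (- t)) = exp t - 1" by (simp add: right_diff_distrib exp_minus_inverse)
  moreover have "exp t \<ge> 1" using True by simp
  ultimately show ?thesis using True by (simp add: mult.commute)
next
  case False
  have "1 - exp t \<le> - t" using exp_ge_add_one_self[of t] by linarith
  moreover have "- t * 1 \<le> - t * exp (- t)" using False by (intro mult_left_mono) auto
  moreover have "\<bar>exp t - 1\<bar> = 1 - exp t" "\<bar>t\<bar> = - t" using False by simp_all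
  ultimately show ?thesis by simp
qed

text \<open>The simple pole of one geometric series at \<open>x = 0\<close>. The constant
  \<open>1 / c + 1\<close> comes from \<open>exp y \<ge> 1 + y\<close> and
  \<open>1 \<le> 1 / x\<close>.\<close>

lemma inverse_one_minus_exp_le:
  assumes "0 < x" "x \<le> 1" "0 < (c::real)"
  shows "1 / (1 - exp (- (x * c))) \<le> (1 / c + 1) / x"
proof -
  define y where "y = x * c"
  have y: "y > 0" using assms by (simp add: y_def)
  have "exp y \<ge> 1 + y" by (rule exp_ge_add_one_self)
  hence "exp (- y) \<le> 1 / (1 + y)" using y by (simp add: exp_minus divide_simps)
  hence "1 - exp (- y) \<ge> 1 - 1 / (1 + y)" by simp
  also have "1 - 1 / (1 + y) = y / (1 + y)" using y by (simp add: divide_simps)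
  finally have "1 / (1 - exp (- y)) \<le> 1 / (y / (1 + y))" using y by (intro divide_left_mono) auto
  also have "\<dots> = 1 / y + 1" using y by (simp add: field_simps)
  also have "1 \<le> 1 / x" using assms by simp
  hence "1 / y + 1 \<le> (1 / c + 1) / x" by (simp add: y_def add_divide_distrib mult.commute)
  finally show ?thesis by (simp add: y_def)
qed

lemma alternating_sum_prod:
  assumes "finite A"
  shows "(\<Sum>J\<in>Pow A. (- 1) ^ card J * (\<Prod>i\<in>J. y i)) = (\<Prod>i\<in>A. 1 - y i :: real)"
proof -
  have "(\<Prod>i\<in>A. - y i + 1) = (\<Sum>J\<in>Pow A. (\<Prod>i\<in>J. - y i) * (\<Prod>i\<in>A - J. 1))"
    by (rule prod_add[OF assms])
  thus ?thesis by (simp add: prod_uminus)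
qed

context toric_fan
begin

text \<open>For a nef Cartier divisor \<open>D\<close>, \<open>\<mu> s\<close> is the vertex of the polytope of \<open>D\<close> belonging to the cone \<open>s\<close>.\<close>

definition vertex_data :: "'r divisor \<Rightarrow> ('r set \<Rightarrow> int ^ 'n) \<Rightarrow> bool" where
  "vertex_data D \<mu> \<longleftrightarrow> (\<forall>s\<in>max_cones. (\<forall>j\<in>s. pairing (\<mu> s) (v j) = - D j) \<and> (\<forall>j. pairing (\<mu> s) (v j) \<ge> - D j))"

lemma vertex_data_add:
  "vertex_data D \<mu> \<Longrightarrow> vertex_data E \<nu> \<Longrightarrow> vertex_data (\<lambda>j. D j + E j) (\<lambda>s. \<mu> s + \<nu> s)"
  unfolding vertex_data_def
proof (intro ballI conjI allI)
  fix s j assume D: "\<forall>s\<in>max_cones. (\<forall>j\<in>s. pairing (\<mu> s) (v j) = - D j) \<and> (\<forall>j. pairing (\<mu> s) (v j) \<ge> - D j)"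
    and E: "\<forall>s\<in>max_cones. (\<forall>j\<in>s. pairing (\<nu> s) (v j) = - E j) \<and> (\<forall>j. pairing (\<nu> s) (v j) \<ge> - E j)"
    and s: "s \<in> max_cones"
  show "pairing (\<mu> s + \<nu> s) (v j) = - (D j + E j)" if "j \<in> s"
    using bspec[OF D s] bspec[OF E s] that by (simp add: pairing_add_left)
  have "- D j \<le> pairing (\<mu> s) (v j)" "- E j \<le> pairing (\<nu> s) (v j)"
    using bspec[OF D s] bspec[OF E s] by blast+
  thus "- (D j + E j) \<le> pairing (\<mu> s + \<nu> s) (v j)" by (simp add: pairing_add_left)
qed

lemma vertex_data_zero: "vertex_data (\<lambda>j. 0) (\<lambda>s. 0)"
  by (simp add: vertex_data_def)

lemma vertex_data_sum:
  "(\<And>i. i \<in> A \<Longrightarrow> vertex_data (D i) (\<mu> i)) \<Longrightarrow> vertex_data (\<lambda>j. \<Sum>i\<in>A. D i j) (\<lambda>s. \<Sum>i\<in>A. \<mu> i s)"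
  by (induction A rule: infinite_finite_induct) (simp_all add: vertex_data_zero vertex_data_add)

text \<open>The support of the product of face signs. On it each coordinate of \<eta> times the
  matching pairing is nonnegative, so \<open>m \<bullet> \<eta> \<ge> 0\<close> on all cones at
  once; the exponential sums of all cones converge at the same positive \<open>x\<close>.\<close>

definition half_open_cone :: "'r set \<Rightarrow> real ^ 'n \<Rightarrow> (int ^ 'n) set" where
  "half_open_cone s \<eta> = {m. \<forall>j\<in>s. if coord s \<eta> j > 0 then pairing m (v j) \<ge> 0 else pairing m (v j) < 0}"

definition cone_sign :: "'r set \<Rightarrow> real ^ 'n \<Rightarrow> int" where
  "cone_sign s \<eta> = (\<Prod>j\<in>s. if coord s \<eta> j > 0 then 1 else - 1)"

lemma prod_face_sign:
  assumes "generic \<eta>" "s \<in> max_cones"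
  shows "(\<Prod>j\<in>s. face_sign (real_vec m \<bullet> w j \<ge> 0) (coord s \<eta> j)) = cone_sign s \<eta> * of_bool (m \<in> half_open_cone s \<eta>)"
proof -
  have "face_sign (real_vec m \<bullet> w j \<ge> 0) (coord s \<eta> j)
      = (if coord s \<eta> j > 0 then 1 else - 1) * of_bool (if coord s \<eta> j > 0 then pairing m (v j) \<ge> 0 else pairing m (v j) < 0)"
    if "j \<in> s" for j
  proof -
    have "coord s \<eta> j \<noteq> 0" using assms that by (auto simp: generic_def)
    thus ?thesis by (auto simp: face_sign_def inner_real_vec)
  qed
  hence "(\<Prod>j\<in>s. face_sign (real_vec m \<bullet> w j \<ge> 0) (coord s \<eta> j))
      = (\<Prod>j\<in>s. (if coord s \<eta> j > 0 then 1 else - 1) * of_bool (if coord s \<eta> j > 0 then pairing m (v j) \<ge> 0 else pairing m (v j) < 0))"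
    by (rule prod.cong[OF refl])
  also have "\<dots> = cone_sign s \<eta> * of_bool (m \<in> half_open_cone s \<eta>)"
    unfolding prod.distrib cone_sign_def by (subst prod_of_bool) (auto simp: half_open_cone_def)
  finally show ?thesis .
qed

abbreviation char_exp :: "real ^ 'n \<Rightarrow> real \<Rightarrow> int ^ 'n \<Rightarrow> real" where
  "char_exp \<eta> x m \<equiv> exp (- x * (real_vec m \<bullet> \<eta>))"

text \<open>The absolute pairings with the rays embed the lattice points of the cone into tuples of
  natural numbers, so the sum is at most a product of geometric series. An inequality is enough for
  the order of the pole, and it also covers cones whose generators are not a lattice basis.\<close>

lemma half_open_cone_finite_sum_le:
  assumes "generic \<eta>" "s \<in> max_cones" "x > 0" "finite F" "F \<subseteq> half_open_cone s \<eta>"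
  shows "(\<Sum>m\<in>F. char_exp \<eta> x m) \<le> (\<Prod>j\<in>s. 1 / (1 - exp (- (x * \<bar>coord s \<eta> j\<bar>))))"
proof -
  define c where "c = (\<lambda>j. coord s \<eta> j)"
  define q where "q = (\<lambda>j. exp (- (x * \<bar>c j\<bar>)))"
  define \<phi> where "\<phi> = (\<lambda>m. restrict (\<lambda>j. nat \<bar>pairing m (v j)\<bar>) s)"
  have c0: "c j \<noteq> 0" if "j \<in> s" for j using assms(1,2) that by (auto simp: generic_def c_def)
  have q: "0 < q j" "q j < 1" if "j \<in> s" for j using c0[OF that] assms(3) by (auto simp: q_def)
  have exp_eq: "char_exp \<eta> x m = (\<Prod>j\<in>s. q j ^ \<phi> m j)" if m: "m \<in> F" for m
  proof -
    have "real_vec m \<bullet> \<eta> = real_vec m \<bullet> (\<Sum>j\<in>s. c j *\<^sub>R w j)"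
      by (simp only: c_def coord_support_sum[OF assms(2)])
    also have "\<dots> = (\<Sum>j\<in>s. c j * of_int (pairing m (v j)))"
      by (simp add: inner_sum_right inner_real_vec)
    also have "\<dots> = (\<Sum>j\<in>s. \<bar>c j\<bar> * real (\<phi> m j))"
    proof (rule sum.cong)
      fix j assume j: "j \<in> s"
      have "if c j > 0 then pairing m (v j) \<ge> 0 else pairing m (v j) < 0"
        using m assms(5) j by (auto simp: half_open_cone_def c_def)
      thus "c j * of_int (pairing m (v j)) = \<bar>c j\<bar> * real (\<phi> m j)"
        using c0[OF j] j by (auto simp: \<phi>_def split: if_splits)
    qed simp
    finally have "- x * (real_vec m \<bullet> \<eta>) = (\<Sum>j\<in>s. real (\<phi> m j) * (- (x * \<bar>c j\<bar>)))"
      by (simp add: sum_distrib_left sum_negf algebra_simps)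
    thus ?thesis by (simp only: exp_sum[OF finite] exp_of_nat_mult q_def)
  qed
  have inj: "inj_on \<phi> F"
  proof (rule inj_onI)
    fix a b assume ab: "a \<in> F" "b \<in> F" "\<phi> a = \<phi> b"
    have "pairing (a - b) (v j) = 0" if j: "j \<in> s" for j
    proof -
      have "if c j > 0 then pairing a (v j) \<ge> 0 else pairing a (v j) < 0"
        "if c j > 0 then pairing b (v j) \<ge> 0 else pairing b (v j) < 0"
        using ab assms(5) j by (auto simp: half_open_cone_def c_def)
      moreover have "nat \<bar>pairing a (v j)\<bar> = nat \<bar>pairing b (v j)\<bar>"
        using fun_cong[OF ab(3), of j] j by (simp add: \<phi>_def)
      ultimately have "pairing a (v j) = pairing b (v j)" by (auto split: if_splits)
      thus ?thesis by (simp add: pairing_diff_left)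
    qed
    hence "a - b = 0" by (rule pairing_eq_0_imp[OF _ assms(2)])
    thus "a = b" by simp
  qed
  define K where "K = Suc (\<Sum>m\<in>F. \<Sum>j\<in>s. \<phi> m j)"
  have sub: "\<phi> ` F \<subseteq> PiE s (\<lambda>_. {..<K})"
  proof
    fix p assume "p \<in> \<phi> ` F"
    then obtain m where m: "m \<in> F" "p = \<phi> m" by blast
    have "\<phi> m j < K" if "j \<in> s" for j
    proof -
      have "\<phi> m j \<le> (\<Sum>j\<in>s. \<phi> m j)" using that by (intro member_le_sum) auto
      also have "\<dots> \<le> (\<Sum>m\<in>F. \<Sum>j\<in>s. \<phi> m j)" using m(1) assms(4) by (intro member_le_sum) auto
      finally show ?thesis by (simp add: K_def)
    qed
    thus "p \<in> PiE s (\<lambda>_. {..<K})" using m(2) by (auto simp: \<phi>_def)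
  qed
  have "(\<Sum>m\<in>F. char_exp \<eta> x m) = (\<Sum>m\<in>F. \<Prod>j\<in>s. q j ^ \<phi> m j)" by (rule sum.cong) (simp_all only: exp_eq)
  also have "\<dots> = (\<Sum>p\<in>\<phi> ` F. \<Prod>j\<in>s. q j ^ p j)" by (simp add: sum.reindex[OF inj])
  also have "\<dots> \<le> (\<Sum>p\<in>PiE s (\<lambda>_. {..<K}). \<Prod>j\<in>s. q j ^ p j)"
    by (rule sum_mono2[OF _ sub]) (auto intro!: finite_PiE prod_nonneg simp: q_def)
  also have "\<dots> = (\<Prod>j\<in>s. \<Sum>k<K. q j ^ k)" by (rule prod_sum_PiE[symmetric]) auto
  also have "\<dots> \<le> (\<Prod>j\<in>s. 1 / (1 - q j))"
  proof (rule prod_mono, intro conjI)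
    fix j assume j: "j \<in> s"
    show "0 \<le> (\<Sum>k<K. q j ^ k)" by (intro sum_nonneg) (simp add: q_def)
    have "(\<Sum>k<K. q j ^ k) = (1 - q j ^ K) / (1 - q j)" using q[OF j] by (simp add: sum_gp_strict)
    also have "\<dots> \<le> 1 / (1 - q j)" using q[OF j] by (intro divide_right_mono) auto
    finally show "(\<Sum>k<K. q j ^ k) \<le> 1 / (1 - q j)" .
  qed
  finally show ?thesis by (simp add: q_def c_def)
qed

definition cone_sum :: "'r set \<Rightarrow> real ^ 'n \<Rightarrow> real \<Rightarrow> real" where
  "cone_sum s \<eta> x = infsum (char_exp \<eta> x) (half_open_cone s \<eta>)"

text \<open>Bounded partial sums of positive terms give summability, and the bound passes to the
  limit. A full-dimensional cone has n rays, each of which contributes one factor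
  \<open>1 / x\<close>.\<close>

lemma cone_sum:
  assumes "generic \<eta>" "s \<in> max_cones" "x > 0"
  shows "(char_exp \<eta> x has_sum cone_sum s \<eta> x) (half_open_cone s \<eta>)"
    and "cone_sum s \<eta> x \<ge> 0"
    and "x \<le> 1 \<Longrightarrow> cone_sum s \<eta> x \<le> (\<Prod>j\<in>s. 1 / \<bar>coord s \<eta> j\<bar> + 1) / x ^ CARD('n)"
proof -
  have summable: "char_exp \<eta> x summable_on half_open_cone s \<eta>"
    by (rule nonneg_bdd_above_summable_on)
       (use half_open_cone_finite_sum_le[OF assms] in \<open>auto intro!: bdd_aboveI2\<close>)
  thus "(char_exp \<eta> x has_sum cone_sum s \<eta> x) (half_open_cone s \<eta>)"
    unfolding cone_sum_def by (rule has_sum_infsum)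
  show "cone_sum s \<eta> x \<ge> 0" unfolding cone_sum_def by (rule infsum_nonneg) simp
  assume "x \<le> 1"
  have "cone_sum s \<eta> x \<le> (\<Prod>j\<in>s. 1 / (1 - exp (- (x * \<bar>coord s \<eta> j\<bar>))))"
    unfolding cone_sum_def
    by (rule infsum_le_finite_sums[OF summable]) (rule half_open_cone_finite_sum_le[OF assms])
  also have "\<dots> \<le> (\<Prod>j\<in>s. (1 / \<bar>coord s \<eta> j\<bar> + 1) / x)"
  proof (rule prod_mono, intro conjI)
    fix j assume "j \<in> s"
    hence c: "\<bar>coord s \<eta> j\<bar> > 0" using assms by (auto simp: generic_def)
    show "1 / (1 - exp (- (x * \<bar>coord s \<eta> j\<bar>))) \<le> (1 / \<bar>coord s \<eta> j\<bar> + 1) / x"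
      by (rule inverse_one_minus_exp_le[OF assms(3) \<open>x \<le> 1\<close> c])
    show "0 \<le> 1 / (1 - exp (- (x * \<bar>coord s \<eta> j\<bar>)))" using assms(3) c by simp
  qed
  also have "\<dots> = (\<Prod>j\<in>s. 1 / \<bar>coord s \<eta> j\<bar> + 1) / x ^ CARD('n)"
    by (simp add: prod_dividef card_max_cone[OF assms(2)])
  finally show "cone_sum s \<eta> x \<le> (\<Prod>j\<in>s. 1 / \<bar>coord s \<eta> j\<bar> + 1) / x ^ CARD('n)" .
qed

text \<open>The indicator identity is multiplied by \<open>char_exp\<close> and summed over the
  lattice. The cone of \<open>s\<close> is translated to the vertex \<open>\<mu> s\<close>, which
  comes out as a factor. Simultaneous convergence takes the place of rational functions in Brion's
  formula.\<close>

lemma polytope_exp_sum: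
  assumes "generic \<eta>" "vertex_data D \<mu>" "x > 0"
  shows "(\<Sum>m\<in>polytope_points v D. char_exp \<eta> x m)
    = (\<Sum>s\<in>max_cones. of_int (cone_sign s \<eta>) * cone_sum s \<eta> x * char_exp \<eta> x (\<mu> s))"
proof -
  let ?f = "\<lambda>s m. of_int (cone_sign s \<eta>) * (of_bool (m - \<mu> s \<in> half_open_cone s \<eta>) * char_exp \<eta> x m)"
  have "(?f s has_sum of_int (cone_sign s \<eta>) * (char_exp \<eta> x (\<mu> s) * cone_sum s \<eta> x)) UNIV" if s: "s \<in> max_cones" for s
  proof (rule has_sum_cmult_right)
    let ?h = "\<lambda>m. m + \<mu> s"
    have inj_h: "inj_on ?h (half_open_cone s \<eta>)" by (simp add: inj_on_def)
    have "((\<lambda>m. char_exp \<eta> x (\<mu> s) * char_exp \<eta> x m) has_sum char_exp \<eta> x (\<mu> s) * cone_sum s \<eta> x) (half_open_cone s \<eta>)"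
      by (rule has_sum_cmult_right) (rule cone_sum(1)[OF assms(1) s assms(3)])
    moreover have "(\<lambda>m. char_exp \<eta> x (\<mu> s) * char_exp \<eta> x m) = char_exp \<eta> x \<circ> ?h"
      by (simp add: fun_eq_iff real_vec_add inner_add_left exp_add[symmetric] algebra_simps)
    ultimately have "(char_exp \<eta> x has_sum char_exp \<eta> x (\<mu> s) * cone_sum s \<eta> x) (?h ` half_open_cone s \<eta>)"
      by (simp only: has_sum_reindex[OF inj_h])
    moreover have "?h ` half_open_cone s \<eta> = {m. m - \<mu> s \<in> half_open_cone s \<eta>}"
    proof (intro equalityI subsetI)
      fix m assume "m \<in> {m. m - \<mu> s \<in> half_open_cone s \<eta>}"
      thus "m \<in> ?h ` half_open_cone s \<eta>" by (intro image_eqI[of _ _ "m - \<mu> s"]) auto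
    qed auto
    ultimately have "(char_exp \<eta> x has_sum char_exp \<eta> x (\<mu> s) * cone_sum s \<eta> x) {m. m - \<mu> s \<in> half_open_cone s \<eta>}"
      by simp
    thus "((\<lambda>m. of_bool (m - \<mu> s \<in> half_open_cone s \<eta>) * char_exp \<eta> x m) has_sum char_exp \<eta> x (\<mu> s) * cone_sum s \<eta> x) UNIV"
      by (rule has_sum_cong_neutral[THEN iffD1, rotated -1]) auto
  qed
  hence 1: "((\<lambda>m. \<Sum>s\<in>max_cones. ?f s m) has_sum (\<Sum>s\<in>max_cones. of_int (cone_sign s \<eta>) * (char_exp \<eta> x (\<mu> s) * cone_sum s \<eta> x))) UNIV"
    by (intro has_sum_finite_sum finite_S)
  have "(\<Sum>s\<in>max_cones. ?f s m) = of_bool (m \<in> polytope_points v D) * char_exp \<eta> x m" for m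
  proof -
    have vd: "real_vec (\<mu> s) \<bullet> w j = - of_int (D j)" if "s \<in> max_cones" "j \<in> s" for s j
      using assms(2) that by (simp add: vertex_data_def inner_real_vec)
    have vd': "real_vec (\<mu> s) \<bullet> w j \<ge> - of_int (D j)" if "s \<in> max_cones" for s j
    proof -
      have "- D j \<le> pairing (\<mu> s) (v j)" using assms(2) that by (simp add: vertex_data_def)
      thus ?thesis by (simp only: inner_real_vec of_int_le_iff[symmetric, where ?'a = real] of_int_minus)
    qed
    have "(\<Sum>s\<in>max_cones. cone_sign s \<eta> * of_bool (m - \<mu> s \<in> half_open_cone s \<eta>))
        = (\<Sum>s\<in>max_cones. \<Prod>j\<in>s. face_sign ((real_vec m - real_vec (\<mu> s)) \<bullet> w j \<ge> 0) (coord s \<eta> j))"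
      by (rule sum.cong) (simp_all only: prod_face_sign[OF assms(1)] real_vec_diff[symmetric])
    also have "\<dots> = of_bool (\<forall>j. real_vec m \<bullet> w j \<ge> - real_of_int (D j))"
      by (rule polytope_indicator[OF assms(1), where \<mu> = "\<lambda>s. real_vec (\<mu> s)"]) (fact vd vd')+
    also have "(\<forall>j. real_vec m \<bullet> w j \<ge> - real_of_int (D j)) \<longleftrightarrow> m \<in> polytope_points v D"
      unfolding polytope_points_def inner_real_vec
      by (simp only: of_int_minus[symmetric] of_int_le_iff mem_Collect_eq)
    finally have eq: "(\<Sum>s\<in>max_cones. cone_sign s \<eta> * of_bool (m - \<mu> s \<in> half_open_cone s \<eta>)) = of_bool (m \<in> polytope_points v D)" .
    have "(\<Sum>s\<in>max_cones. ?f s m) = (\<Sum>s\<in>max_cones. of_int (cone_sign s \<eta> * of_bool (m - \<mu> s \<in> half_open_cone s \<eta>))) * char_exp \<eta> x m"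
      unfolding sum_distrib_right by (rule sum.cong) (simp_all only: of_int_mult of_int_of_bool mult.assoc)
    also have "\<dots> = of_int (\<Sum>s\<in>max_cones. cone_sign s \<eta> * of_bool (m - \<mu> s \<in> half_open_cone s \<eta>)) * char_exp \<eta> x m"
      by (simp only: of_int_sum)
    finally show ?thesis unfolding eq by simp
  qed
  hence "((\<lambda>m. of_bool (m \<in> polytope_points v D) * char_exp \<eta> x m) has_sum
      (\<Sum>s\<in>max_cones. of_int (cone_sign s \<eta>) * (char_exp \<eta> x (\<mu> s) * cone_sum s \<eta> x))) UNIV"
    using 1 by (simp only:)
  hence "(char_exp \<eta> x has_sum
      (\<Sum>s\<in>max_cones. of_int (cone_sign s \<eta>) * (char_exp \<eta> x (\<mu> s) * cone_sum s \<eta> x))) (polytope_points v D)"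
    by (rule has_sum_cong_neutral[THEN iffD1, rotated -1]) auto
  moreover have "(char_exp \<eta> x has_sum (\<Sum>m\<in>polytope_points v D. char_exp \<eta> x m)) (polytope_points v D)"
    by (rule has_sum_finite[OF finite_polytope_points])
  ultimately have "(\<Sum>m\<in>polytope_points v D. char_exp \<eta> x m)
      = (\<Sum>s\<in>max_cones. of_int (cone_sign s \<eta>) * (char_exp \<eta> x (\<mu> s) * cone_sum s \<eta> x))"
    by (rule has_sum_unique[rotated])
  thus ?thesis by (simp add: mult_ac)
qed

text \<open>The cone sums have a pole of order \<open>n\<close> at \<open>x = 0\<close>, and each of the \<open>n + 1\<close> differences of
  exponentials contributes a zero.\<close>

lemma alternating_count_constant:
  assumes A: "finite A" "card A = CARD('n)"
    and D: "\<And>i. i \<in> A \<Longrightarrow> vertex_data (D i) (\<mu> i)" and E: "vertex_data E \<nu>"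
  shows "(\<Sum>J\<in>Pow A. (- 1) ^ card J * int (card (polytope_points v (\<lambda>j. E j + (\<Sum>i\<in>J. D i j)))))
    = (\<Sum>J\<in>Pow A. (- 1) ^ card J * int (card (polytope_points v (\<lambda>j. \<Sum>i\<in>J. D i j))))"
proof -
  obtain \<eta> where \<eta>: "generic \<eta>" using generic_dense[of UNIV] by auto
  let ?P = "\<lambda>J. polytope_points v (\<lambda>j. E j + (\<Sum>i\<in>J. D i j))"
  let ?Q = "\<lambda>J. polytope_points v (\<lambda>j. \<Sum>i\<in>J. D i j)"
  \<comment> \<open>The difference of the two sides with exponential weights; at
    \<open>x = 0\<close> all weights are 1.\<close>
  define \<Phi> where "\<Phi> = (\<lambda>x. \<Sum>J\<in>Pow A. (- 1) ^ card J * ((\<Sum>m\<in>?P J. char_exp \<eta> x m) - (\<Sum>m\<in>?Q J. char_exp \<eta> x m)))"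
  define g where "g = (\<lambda>s x. of_int (cone_sign s \<eta>) * cone_sum s \<eta> x)"
  have expand: "\<Phi> x = (\<Sum>s\<in>max_cones. g s x * ((char_exp \<eta> x (\<nu> s) - 1) * (\<Prod>i\<in>A. 1 - char_exp \<eta> x (\<mu> i s))))"
    if x: "x > 0" for x
  proof -
    have J: "(\<Sum>m\<in>?P J. char_exp \<eta> x m) - (\<Sum>m\<in>?Q J. char_exp \<eta> x m)
        = (\<Sum>s\<in>max_cones. g s x * ((char_exp \<eta> x (\<nu> s) - 1) * (\<Prod>i\<in>J. char_exp \<eta> x (\<mu> i s))))"
      if "J \<in> Pow A" for J
    proof -
      have fin: "finite J" using that A(1) finite_subset by blast
      have VJ: "vertex_data (\<lambda>j. \<Sum>i\<in>J. D i j) (\<lambda>s. \<Sum>i\<in>J. \<mu> i s)"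
        using D that by (intro vertex_data_sum) auto
      have prod: "char_exp \<eta> x (\<Sum>i\<in>J. \<mu> i s) = (\<Prod>i\<in>J. char_exp \<eta> x (\<mu> i s))" for s
        by (simp only: exp_sum[OF fin, symmetric] real_vec_sum inner_sum_left sum_distrib_left)
      have plus: "char_exp \<eta> x (\<nu> s + (\<Sum>i\<in>J. \<mu> i s)) = char_exp \<eta> x (\<nu> s) * char_exp \<eta> x (\<Sum>i\<in>J. \<mu> i s)" for s
        by (simp only: exp_add[symmetric] real_vec_add inner_add_left distrib_left)
      show ?thesis
        unfolding polytope_exp_sum[OF \<eta> vertex_data_add[OF E VJ] x] polytope_exp_sum[OF \<eta> VJ x]
          plus prod g_def sum_subtractf[symmetric]
        by (rule sum.cong) (simp_all add: algebra_simps)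
    qed
    have "\<Phi> x = (\<Sum>J\<in>Pow A. \<Sum>s\<in>max_cones. (- 1) ^ card J * (g s x * ((char_exp \<eta> x (\<nu> s) - 1) * (\<Prod>i\<in>J. char_exp \<eta> x (\<mu> i s)))))"
      unfolding \<Phi>_def by (rule sum.cong) (simp_all only: J sum_distrib_left)
    also have "\<dots> = (\<Sum>s\<in>max_cones. \<Sum>J\<in>Pow A. (- 1) ^ card J * (g s x * ((char_exp \<eta> x (\<nu> s) - 1) * (\<Prod>i\<in>J. char_exp \<eta> x (\<mu> i s)))))"
      by (rule sum.swap)
    also have "\<dots> = (\<Sum>s\<in>max_cones. g s x * ((char_exp \<eta> x (\<nu> s) - 1) * (\<Sum>J\<in>Pow A. (- 1) ^ card J * (\<Prod>i\<in>J. char_exp \<eta> x (\<mu> i s)))))"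
      by (rule sum.cong) (simp_all add: sum_distrib_left mult_ac)
    finally show ?thesis by (simp only: alternating_sum_prod[OF A(1)])
  qed
  define b where "b = (\<lambda>m::int ^ 'n. \<bar>real_vec m \<bullet> \<eta>\<bar> * exp \<bar>real_vec m \<bullet> \<eta>\<bar>)"
  have b: "\<bar>char_exp \<eta> x m - 1\<bar> \<le> x * b m" if "0 < x" "x \<le> 1" for x m
  proof -
    have "\<bar>char_exp \<eta> x m - 1\<bar> \<le> \<bar>- x * (real_vec m \<bullet> \<eta>)\<bar> * exp \<bar>- x * (real_vec m \<bullet> \<eta>)\<bar>"
      by (rule abs_exp_minus_one_le)
    also have "\<dots> \<le> \<bar>- x * (real_vec m \<bullet> \<eta>)\<bar> * exp \<bar>real_vec m \<bullet> \<eta>\<bar>"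
      using that mult_right_mono[of x 1 "\<bar>real_vec m \<bullet> \<eta>\<bar>"] by (intro mult_left_mono) (auto simp: abs_mult)
    also have "\<dots> = x * b m" using that by (simp add: b_def abs_mult)
    finally show ?thesis .
  qed
  have b0: "b m \<ge> 0" for m by (simp add: b_def)
  define C where "C = (\<Sum>s\<in>max_cones. \<bar>of_int (cone_sign s \<eta>)\<bar> * (\<Prod>j\<in>s. 1 / \<bar>coord s \<eta> j\<bar> + 1) * (b (\<nu> s) * (\<Prod>i\<in>A. b (\<mu> i s))))"
  have bound: "\<bar>\<Phi> x\<bar> \<le> C * x" if x: "0 < x" "x \<le> 1" for x
  proof -
    have "\<bar>\<Phi> x\<bar> \<le> (\<Sum>s\<in>max_cones. \<bar>g s x * ((char_exp \<eta> x (\<nu> s) - 1) * (\<Prod>i\<in>A. 1 - char_exp \<eta> x (\<mu> i s)))\<bar>)"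
      unfolding expand[OF x(1)] by (rule sum_abs)
    also have "\<dots> \<le> (\<Sum>s\<in>max_cones. \<bar>of_int (cone_sign s \<eta>)\<bar> * (\<Prod>j\<in>s. 1 / \<bar>coord s \<eta> j\<bar> + 1) * (b (\<nu> s) * (\<Prod>i\<in>A. b (\<mu> i s))) * x)"
    proof (rule sum_mono)
      fix s assume s: "s \<in> max_cones"
      let ?K = "\<Prod>j\<in>s. 1 / \<bar>coord s \<eta> j\<bar> + 1"
      have K0: "?K \<ge> 0" by (intro prod_nonneg) auto
      have 1: "\<bar>g s x\<bar> \<le> \<bar>of_int (cone_sign s \<eta>)\<bar> * (?K / x ^ CARD('n))"
        unfolding g_def abs_mult using cone_sum(2,3)[OF \<eta> s x(1)] x(2) by (intro mult_left_mono) auto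
      have 2: "\<bar>\<Prod>i\<in>A. 1 - char_exp \<eta> x (\<mu> i s)\<bar> \<le> (\<Prod>i\<in>A. x * b (\<mu> i s))"
        unfolding abs_prod using b[OF x] by (intro prod_mono) (auto simp: abs_minus_commute)
      have "\<bar>g s x * ((char_exp \<eta> x (\<nu> s) - 1) * (\<Prod>i\<in>A. 1 - char_exp \<eta> x (\<mu> i s)))\<bar>
          \<le> (\<bar>of_int (cone_sign s \<eta>)\<bar> * (?K / x ^ CARD('n))) * ((x * b (\<nu> s)) * (\<Prod>i\<in>A. x * b (\<mu> i s)))"
        unfolding abs_mult[of "g s x"] abs_mult[of "char_exp \<eta> x (\<nu> s) - 1"]
        using 1 2 b[OF x, of "\<nu> s"] x K0 b0 by (intro mult_mono mult_nonneg_nonneg prod_nonneg divide_nonneg_nonneg) auto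
      also have "\<dots> = \<bar>of_int (cone_sign s \<eta>)\<bar> * ?K * (b (\<nu> s) * (\<Prod>i\<in>A. b (\<mu> i s))) * x"
        using x A(2) by (simp add: prod.distrib)
      finally show "\<bar>g s x * ((char_exp \<eta> x (\<nu> s) - 1) * (\<Prod>i\<in>A. 1 - char_exp \<eta> x (\<mu> i s)))\<bar>
          \<le> \<bar>of_int (cone_sign s \<eta>)\<bar> * ?K * (b (\<nu> s) * (\<Prod>i\<in>A. b (\<mu> i s))) * x" .
    qed
    also have "\<dots> = C * x" by (simp add: C_def sum_distrib_right)
    finally show ?thesis .
  qed
  \<comment> \<open>The expansion over cones holds only for \<open>x > 0\<close>, but \<Phi> itself
    is a finite sum of exponentials, so the limit from the right is its value at 0.\<close>
  have "isCont \<Phi> 0" unfolding \<Phi>_def by (intro continuous_intros)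
  hence "(\<Phi> \<longlongrightarrow> \<Phi> 0) (at_right 0)" unfolding isCont_def by (rule tendsto_mono[OF at_le[OF subset_UNIV]])
  moreover have "(\<Phi> \<longlongrightarrow> 0) (at_right 0)"
  proof (rule Lim_null_comparison)
    show "\<forall>\<^sub>F x in at_right 0. norm (\<Phi> x) \<le> C * x"
      unfolding eventually_at_right_field by (intro exI[of _ 1]) (use bound in auto)
    have "((\<lambda>x. C * x) \<longlongrightarrow> C * 0) (at_right 0)" by (intro tendsto_intros)
    thus "((\<lambda>x. C * x) \<longlongrightarrow> 0) (at_right 0)" by simp
  qed
  ultimately have "\<Phi> 0 = 0" using tendsto_unique[of "at_right (0::real)"] by (simp add: trivial_limit_at_right_real)
  hence "(\<Sum>J\<in>Pow A. (- 1) ^ card J * (real (card (?P J)) - real (card (?Q J)))) = 0"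
    by (simp add: \<Phi>_def)
  hence "real_of_int (\<Sum>J\<in>Pow A. (- 1) ^ card J * int (card (?P J))) = real_of_int (\<Sum>J\<in>Pow A. (- 1) ^ card J * int (card (?Q J)))"
    by (simp add: right_diff_distrib sum_subtractf)
  thus ?thesis by (simp only: of_int_eq_iff)
qed

end


subsection \<open>Graded complete intersections\<close>

context toric_fan
begin

text \<open>A lattice point \<open>m\<close> corresponds to the effective divisor
  \<open>D + div \<chi>^m\<close>, read as an exponent vector. It can be recovered because the rays
  of a maximal cone span.\<close>

lemma monomials_polytope_points:
  "bij_betw (\<lambda>m. Abs_poly_mapping (\<lambda>j. nat (pairing m (v j) + D j)))
    (polytope_points v D) (monomials_of_degree v (divisor_class v D))"
proof -
  let ?f = "\<lambda>m. Abs_poly_mapping (\<lambda>j. nat (pairing m (v j) + D j))"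
  have lookup: "Poly_Mapping.lookup (?f m) j = nat (pairing m (v j) + D j)" for m j
    by (simp add: lookup_Abs_poly_mapping)
  show ?thesis
  proof (rule bij_betwI')
    fix a b assume a: "a \<in> polytope_points v D" and b: "b \<in> polytope_points v D"
    show "?f a = ?f b \<longleftrightarrow> a = b"
    proof
      assume eq: "?f a = ?f b"
      obtain s where s: "s \<in> max_cones" using max_cones_nonempty by blast
      have "pairing (a - b) (v j) = 0" for j
      proof -
        have "nat (pairing a (v j) + D j) = nat (pairing b (v j) + D j)"
          using arg_cong[OF eq, of "\<lambda>u. Poly_Mapping.lookup u j"] by (simp only: lookup)
        moreover have "- D j \<le> pairing a (v j)" "- D j \<le> pairing b (v j)" using a b by (auto simp: polytope_points_def)
        ultimately show ?thesis by (simp add: pairing_diff_left)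
      qed
      hence "a - b = 0" by (rule pairing_eq_0_imp[OF _ s])
      thus "a = b" by simp
    qed simp
  next
    fix m assume m: "m \<in> polytope_points v D"
    have "int (Poly_Mapping.lookup (?f m) j) = D j + pairing m (v j)" for j
    proof -
      have "- D j \<le> pairing m (v j)" using m by (simp add: polytope_points_def)
      thus ?thesis unfolding lookup by simp
    qed
    thus "?f m \<in> monomials_of_degree v (divisor_class v D)"
      unfolding monomials_of_degree_def monomial_degree_def mem_Collect_eq divisor_class_eq_iff by blast
  next
    fix u assume "u \<in> monomials_of_degree v (divisor_class v D)"
    then obtain m where m: "\<And>j. int (Poly_Mapping.lookup u j) = D j + pairing m (v j)"
      unfolding monomials_of_degree_def monomial_degree_def mem_Collect_eq divisor_class_eq_iff by blast
    have "m \<in> polytope_points v D" unfolding polytope_points_def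
    proof (intro CollectI allI)
      fix j show "- D j \<le> pairing m (v j)" using m[of j] by linarith
    qed
    moreover have "u = ?f m"
    proof (rule poly_mapping_eqI)
      fix j show "Poly_Mapping.lookup u j = Poly_Mapping.lookup (?f m) j"
        unfolding lookup using m[of j] by linarith
    qed
    ultimately show "\<exists>m\<in>polytope_points v D. u = ?f m" by blast
  qed
qed

lemma finite_monomials: "finite (monomials_of_degree v (divisor_class v D))"
  and card_monomials: "card (monomials_of_degree v (divisor_class v D)) = card (polytope_points v D)"
  using bij_betw_finite[OF monomials_polytope_points] finite_polytope_points
    bij_betw_same_card[OF monomials_polytope_points] by auto

text \<open>The representative chosen in \<open>class_polytope\<close> is arbitrary; either polytope
  counts the monomials of the same class.\<close>

lemma card_lattice_points:
  "card (lattice_points (class_polytope v (divisor_class v D))) = card (polytope_points v D)"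
proof -
  define D' where "D' = (SOME D'. D' \<in> divisor_class v D)"
  have "D' \<in> divisor_class v D" unfolding D'_def by (rule someI[of _ D]) (rule self_mem_divisor_class)
  hence cl: "divisor_class v D' = divisor_class v D" by (simp add: mem_divisor_class_iff_eq)
  have "lattice_points (class_polytope v (divisor_class v D)) = real_vec ` polytope_points v D'"
  proof -
    have "real_vec m \<in> divisor_polytope v D' \<longleftrightarrow> m \<in> polytope_points v D'" for m
      unfolding divisor_polytope_def polytope_points_def mem_Collect_eq inner_real_vec
      by (simp only: of_int_minus[symmetric] of_int_le_iff)
    thus ?thesis unfolding lattice_points_def class_polytope_def D'_def[symmetric] by blast
  qed
  hence "card (lattice_points (class_polytope v (divisor_class v D))) = card (polytope_points v D')"
    by (simp add: card_image inj_on_def)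
  thus ?thesis using card_monomials[of D'] card_monomials[of D] cl by simp
qed

text \<open>The linear bound for the polytopes of \<open>K D\<close>, taken at \<open>K = 0\<close>,
  leaves only the origin.\<close>

lemma polytope_points_zero: "polytope_points v (\<lambda>j. 0) = {0}"
proof -
  obtain R where "polytope_points v (\<lambda>j. int 0 * (0::int)) \<subseteq> lattice_box (0 * R)"
    using polytope_points_bounded[of "\<lambda>j. 0"] by blast
  thus ?thesis by (auto simp: polytope_points_def lattice_box_def vec_eq_iff)
qed

lemma monomials_degree_zero: "monomials_of_degree v (divisor_class v (\<lambda>j. 0)) = {0}"
proof -
  have "card (monomials_of_degree v (divisor_class v (\<lambda>j. 0))) = 1"
    by (simp add: card_monomials polytope_points_zero)
  moreover have "0 \<in> monomials_of_degree v (divisor_class v (\<lambda>j. 0))"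
    by (simp add: monomials_of_degree_def monomial_degree_def)
  ultimately show ?thesis by (metis card_1_singletonE singletonD)
qed

end

section \<open>Constant terms and the degrees of generators\<close>

lemma poly_eval_origin:
  fixes f :: "('r::finite, 'k::field) cox_ring"
  shows "poly_eval (\<lambda>_. 0) f = Poly_Mapping.lookup f 0"
proof (induction f rule: poly_mapping_additive_induct)
  case (single u c)
  have "(\<Prod>j\<in>UNIV. 0 ^ Poly_Mapping.lookup u j) = (if u = 0 then 1 else (0::'k))"
  proof (cases "u = 0")
    case False
    then obtain j where "Poly_Mapping.lookup u j \<noteq> 0" by (metis poly_mapping_eqI lookup_zero)
    hence "(\<Prod>j\<in>UNIV. 0 ^ Poly_Mapping.lookup u j) = (0::'k)" by (intro prod_zero bexI[of _ j]) auto
    thus ?thesis using False by simp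
  qed simp
  thus ?case by (simp add: poly_eval_single lookup_single when_def)
qed (simp add: poly_eval_add lookup_add)

lemma degree_zero_if_constant_term:
  assumes "f \<in> graded_piece v \<alpha>" "poly_eval (\<lambda>_. 0) f \<noteq> 0"
  shows "\<alpha> = divisor_class v (\<lambda>j. 0)"
proof -
  have "0 \<in> Poly_Mapping.keys f" using assms(2) by (simp add: poly_eval_origin in_keys_iff)
  thus ?thesis using assms(1) by (auto simp: graded_piece_def monomial_degree_def)
qed

text \<open>By regularity the last coefficient is a combination of the earlier \<open>Gs\<close>,
  which have no constant terms. Substituting this combination shortens the relation and changes the
  other coefficients only by multiples of \<open>Gs ! k\<close>, so their constant terms are
  unaffected.\<close>

lemma regular_sequence_relation_constant_terms:
  fixes Gs :: "('r::finite, 'k::field) cox_ring list"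
  assumes reg: "regular_sequence Gs" and zero: "\<And>i. i < length Gs \<Longrightarrow> poly_eval (\<lambda>_. 0) (Gs ! i) = 0"
    and "k \<le> length Gs" "(\<Sum>i<k. b i * Gs ! i) = 0" "i < k"
  shows "poly_eval (\<lambda>_. 0) (b i) = 0"
  using assms(3-)
proof (induction k arbitrary: b i)
  case (Suc k)
  hence k: "k < length Gs" by simp
  have split: "b k * Gs ! k + (\<Sum>i<k. b i * Gs ! i) = 0" using Suc.prems(2) by (simp add: add.commute)
  have "b k * Gs ! k = (\<Sum>i<k. (- b i) * Gs ! i)"
    using split by (simp add: sum_negf eq_neg_iff_add_eq_0)
  hence "b k * Gs ! k \<in> ideal_gen (set (take k Gs))"
    unfolding ideal_gen_list using k by (intro exI[of _ "\<lambda>i. - b i"]) (auto intro!: sum.cong)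
  hence "b k \<in> ideal_gen (set (take k Gs))" using reg k by (auto simp: regular_sequence_def)
  then obtain c where c': "b k = (\<Sum>i<length (take k Gs). c i * take k Gs ! i)" unfolding ideal_gen_list by blast
  have c: "b k = (\<Sum>i<k. c i * Gs ! i)" unfolding c' using k by (intro sum.cong) auto
  have "(\<Sum>i<k. (b i + c i * Gs ! k) * Gs ! i) = (\<Sum>i<k. b i * Gs ! i) + (\<Sum>i<k. c i * Gs ! i) * Gs ! k"
    unfolding sum_distrib_right sum.distrib[symmetric] by (rule sum.cong) (simp_all add: algebra_simps)
  also have "\<dots> = 0" unfolding c[symmetric] using split by (simp add: add.commute)
  finally have "(\<Sum>i<k. (b i + c i * Gs ! k) * Gs ! i) = 0" .
  from Suc.IH[OF _ this] k
  have "poly_eval (\<lambda>_. 0) (b i + c i * Gs ! k) = 0" if "i < k" for i using that by simp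
  hence "poly_eval (\<lambda>_. 0) (b i) = 0" if "i < k" for i
    using that zero[OF k] by (simp add: poly_eval_add poly_eval_mult)
  moreover have "poly_eval (\<lambda>_. 0) (b k) = 0"
    unfolding c using zero k by (simp add: poly_eval_sum poly_eval_mult)
  ultimately show ?case using Suc.prems(3) by (cases "i = k") auto
qed simp

text \<open>The determinant is nonzero, so some term of its Leibniz expansion is nonzero.
  \<open>t\<close> renumbers the indices by the type \<open>'n\<close>, over which determinants are
  defined.\<close>

lemma transversal_of_left_invertible:
  fixes A B :: "nat \<Rightarrow> nat \<Rightarrow> 'k::field"
  assumes inv: "\<And>k j. k < CARD('n::finite) \<Longrightarrow> j < CARD('n) \<Longrightarrow>
      (\<Sum>i<CARD('n). B k i * A i j) = (if k = j then 1 else 0)"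
  obtains p where "p permutes {..<CARD('n)}" "\<And>i. i < CARD('n) \<Longrightarrow> A i (p i) \<noteq> 0"
proof -
  obtain t :: "'n \<Rightarrow> nat" where t: "bij_betw t UNIV {..<CARD('n)}"
    using ex_bij_betw_finite_nat[of "UNIV :: 'n set"] by (auto simp: atLeast0LessThan)
  have tlt: "t x < CARD('n)" for x using bij_betwE[OF t] by auto
  have tinj: "t x = t y \<longleftrightarrow> x = y" for x y using bij_betw_imp_inj_on[OF t] by (auto simp: inj_on_def)
  define MA where "MA = ((\<chi> x y. A (t x) (t y)) :: 'k ^ 'n ^ 'n)"
  define MB where "MB = ((\<chi> x y. B (t x) (t y)) :: 'k ^ 'n ^ 'n)"
  have "(MB ** MA) $ x $ y = mat 1 $ x $ y" for x y
  proof -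
    have "(MB ** MA) $ x $ y = (\<Sum>z\<in>UNIV. B (t x) (t z) * A (t z) (t y))"
      by (simp add: matrix_matrix_mult_def MA_def MB_def)
    also have "\<dots> = (\<Sum>i<CARD('n). B (t x) i * A i (t y))"
      by (rule sum.reindex_bij_betw[OF t])
    finally show ?thesis using inv[OF tlt tlt] by (simp add: mat_def tinj)
  qed
  hence "MB ** MA = mat 1" by (simp add: vec_eq_iff)
  hence "det MB * det MA = 1" by (metis det_mul det_I)
  hence "det MA \<noteq> 0" by auto
  have "\<exists>q\<in>{q. q permutes (UNIV :: 'n set)}. of_int (sign q) * (\<Prod>i\<in>UNIV. MA $ i $ q i) \<noteq> 0"
  proof (rule ccontr)
    assume "\<not> ?thesis"
    hence "det MA = 0" unfolding det_def by (intro sum.neutral) blast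
    thus False using \<open>det MA \<noteq> 0\<close> by simp
  qed
  then obtain q where q: "q permutes (UNIV :: 'n set)" "(\<Prod>i\<in>UNIV. MA $ i $ q i) \<noteq> 0" by auto
  have nz: "A (t x) (t (q x)) \<noteq> 0" for x
  proof
    assume "A (t x) (t (q x)) = 0"
    hence "(\<Prod>i\<in>UNIV. MA $ i $ q i) = 0" by (intro prod_zero bexI[of _ x]) (simp_all add: MA_def)
    thus False using q(2) by simp
  qed
  define p where "p = (\<lambda>i. if i < CARD('n) then t (q (inv_into UNIV t i)) else i)"
  have tinv: "t (inv_into UNIV t i) = i" if "i < CARD('n)" for i
    using bij_betw_inv_into_right[OF t] that by simp
  have "bij_betw (t \<circ> q \<circ> inv_into UNIV t) {..<CARD('n)} {..<CARD('n)}"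
    using bij_betw_trans[OF bij_betw_inv_into[OF t] bij_betw_trans[OF permutes_imp_bij[OF q(1)] t]]
    by (simp add: comp_assoc)
  hence "bij_betw p {..<CARD('n)} {..<CARD('n)}"
    by (rule bij_betw_cong[THEN iffD1, rotated]) (simp add: p_def)
  hence "p permutes {..<CARD('n)}" by (rule bij_imp_permutes) (simp add: p_def)
  moreover have "A i (p i) \<noteq> 0" if "i < CARD('n)" for i
    using nz[of "inv_into UNIV t i"] tinv[OF that] that by (simp add: p_def)
  ultimately show ?thesis by (rule that)
qed

lemma sum_Pow_lessThan_Suc:
  "(\<Sum>J\<in>Pow {..<Suc k}. f J) = (\<Sum>J\<in>Pow {..<k}. f J) + (\<Sum>J\<in>Pow {..<k}. f (insert k J))"
proof -
  have "inj_on (insert k) (Pow {..<k})" by (rule inj_onI) (auto dest: equalityD1 equalityD2)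
  moreover have "Pow {..<k} \<inter> insert k ` Pow {..<k} = {}" by auto
  ultimately show ?thesis
    by (simp add: lessThan_Suc Pow_insert sum.union_disjoint sum.reindex)
qed

context toric_fan
begin

text \<open>A form with a constant term has degree zero, where 1 is the only monomial. It would be a
  unit, but the ideal of a regular sequence is proper.\<close>

lemma regular_sequence_constant_terms:
  fixes Gs :: "('r, 'k::field) cox_ring list"
  assumes "regular_sequence Gs" "G \<in> set Gs" "G \<in> graded_piece v \<delta>"
  shows "poly_eval (\<lambda>_. 0) G = 0"
proof (rule ccontr)
  assume nz: "poly_eval (\<lambda>_. 0) G \<noteq> 0"
  define c where "c = Poly_Mapping.lookup G 0"
  have c: "c \<noteq> 0" using nz by (simp add: c_def poly_eval_origin)
  have "\<delta> = divisor_class v (\<lambda>j. 0)" by (rule degree_zero_if_constant_term[OF assms(3) nz])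
  hence "Poly_Mapping.keys G \<subseteq> {0}"
    using assms(3) monomials_degree_zero by (auto simp: graded_piece_def monomials_of_degree_def)
  hence "G = Poly_Mapping.single 0 c"
    by (intro poly_mapping_eqI) (auto simp: c_def lookup_single when_def in_keys_iff)
  hence "f = (f * Poly_Mapping.single 0 (inverse c)) * G" for f :: "('r, 'k) cox_ring"
    using c by (simp add: mult.assoc mult_single)
  hence "f \<in> ideal_gen (set Gs)" for f
    using ideal.span_scale[OF ideal.span_base[OF assms(2)]] by metis
  thus False using assms(1) by (auto simp: regular_sequence_def)
qed

text \<open>\<open>A\<close> writes \<open>Fs\<close> in terms of \<open>Gs\<close> and
  \<open>B\<close> goes back. A transversal of \<open>A\<close> with nonzero constant terms matches
  the two lists, since a homogeneous entry with a constant term has degree zero. Only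
  \<open>A\<close> is chosen with homogeneous entries.\<close>

lemma generators_same_degrees:
  fixes Fs Gs :: "('r, 'k::field) cox_ring list"
  assumes reg: "regular_sequence Gs" and len: "length Gs = CARD('n)" "length Fs = CARD('n)"
    and I: "ideal_gen (set Fs) = ideal_gen (set Gs)"
    and F: "\<And>i. i < CARD('n) \<Longrightarrow> Fs ! i \<in> graded_piece v (divisor_class v (D i))"
    and G: "\<And>i. i < CARD('n) \<Longrightarrow> Gs ! i \<in> graded_piece v (divisor_class v (E i))"
  obtains p where "p permutes {..<CARD('n)}"
    and "\<And>i. i < CARD('n) \<Longrightarrow> divisor_class v (D i) = divisor_class v (E (p i)) \<and> Fs ! i \<noteq> 0"
proof -
  let ?n = "CARD('n)"
  let ?c = "poly_eval (\<lambda>_. 0) :: ('r, 'k) cox_ring \<Rightarrow> 'k"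
  have Gc: "?c (Gs ! i) = 0" if "i < ?n" for i
    using regular_sequence_constant_terms[OF reg _ G[OF that]] len that by simp
  note rel = regular_sequence_relation_constant_terms[OF reg Gc, unfolded len, OF _ order_refl]
  have "\<exists>a. Fs ! i = (\<Sum>j<?n. a j * Gs ! j) \<and> (\<forall>j. a j \<in> graded_piece v (class_diff v (divisor_class v (D i)) (divisor_class v (E j))))"
    if i: "i < ?n" for i
  proof -
    have "Fs ! i \<in> ideal_gen (set Gs)" unfolding I[symmetric] using i len by (intro ideal.span_base) auto
    then obtain a where "Fs ! i = (\<Sum>j<length Gs. a j * Gs ! j)"
      and "\<And>j. a j \<in> graded_piece v (class_diff v (divisor_class v (D i)) (divisor_class v (E j)))"
      by (rule homogeneous_ideal_representation[OF F[OF i] divisor_class_in_Cl, where \<delta> = "\<lambda>j. divisor_class v (E j)"])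
         (use G len in auto)
    thus ?thesis unfolding len by (intro exI[of _ a] conjI allI)
  qed
  hence "\<forall>i. \<exists>a. i < ?n \<longrightarrow> Fs ! i = (\<Sum>j<?n. a j * Gs ! j) \<and>
      (\<forall>j. a j \<in> graded_piece v (class_diff v (divisor_class v (D i)) (divisor_class v (E j))))" by blast
  then obtain A where A: "\<And>i. i < ?n \<Longrightarrow> Fs ! i = (\<Sum>j<?n. A i j * Gs ! j)"
    and Adeg: "\<And>i j. i < ?n \<Longrightarrow> A i j \<in> graded_piece v (class_diff v (divisor_class v (D i)) (divisor_class v (E j)))"
    by (drule_tac choice) blast
  have "\<exists>b. Gs ! k = (\<Sum>i<?n. b i * Fs ! i)" if k: "k < ?n" for k
  proof -
    have "Gs ! k \<in> ideal_gen (set Fs)" unfolding I using k len by (intro ideal.span_base) auto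
    thus ?thesis unfolding ideal_gen_list len .
  qed
  hence "\<forall>k. \<exists>b. k < ?n \<longrightarrow> Gs ! k = (\<Sum>i<?n. b i * Fs ! i)" by blast
  then obtain B where B: "\<And>k. k < ?n \<Longrightarrow> Gs ! k = (\<Sum>i<?n. B k i * Fs ! i)"
    by (drule_tac choice) blast
  \<comment> \<open>The entries of \<open>B A - 1\<close> are the coefficients of relations between
    the \<open>Gs\<close>, hence have no constant terms.\<close>
  have inv: "(\<Sum>i<?n. ?c (B k i) * ?c (A i j)) = (if k = j then 1 else 0)" if kj: "k < ?n" "j < ?n" for k j
  proof -
    have "Gs ! k = (\<Sum>i<?n. B k i * (\<Sum>j<?n. A i j * Gs ! j))" using B[OF kj(1)] A by simp
    also have "\<dots> = (\<Sum>i<?n. \<Sum>j<?n. B k i * A i j * Gs ! j)" by (simp add: sum_distrib_left mult.assoc)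
    also have "\<dots> = (\<Sum>j<?n. \<Sum>i<?n. B k i * A i j * Gs ! j)" by (rule sum.swap)
    also have "\<dots> = (\<Sum>j<?n. (\<Sum>i<?n. B k i * A i j) * Gs ! j)" by (simp add: sum_distrib_right)
    finally have e1: "Gs ! k = (\<Sum>j<?n. (\<Sum>i<?n. B k i * A i j) * Gs ! j)" .
    have "(\<Sum>j<?n. (if k = j then 1 else 0) * Gs ! j) = (\<Sum>j<?n. if k = j then Gs ! j else 0)"
      by (rule sum.cong) auto
    hence e2: "(\<Sum>j<?n. (if k = j then 1 else 0) * Gs ! j) = Gs ! k" using kj by simp
    have "(\<Sum>j<?n. ((\<Sum>i<?n. B k i * A i j) - (if k = j then 1 else 0)) * Gs ! j) = 0"
      unfolding left_diff_distrib sum_subtractf e1[symmetric] e2 by simp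
    from rel[OF _ this kj(2)] have "?c ((\<Sum>i<?n. B k i * A i j) - (if k = j then 1 else 0)) = 0" by simp
    thus ?thesis
      by (cases "k = j") (simp_all add: poly_eval_diff poly_eval_sum poly_eval_mult poly_eval_zero poly_eval_one)
  qed
  obtain p where p: "p permutes {..<?n}" "\<And>i. i < ?n \<Longrightarrow> ?c (A i (p i)) \<noteq> 0"
    by (rule transversal_of_left_invertible[where A = "\<lambda>i j. ?c (A i j)" and B = "\<lambda>i j. ?c (B i j)", OF inv]) blast+
  show ?thesis
  proof (rule that[OF p(1)], intro conjI)
    fix i assume i: "i < ?n"
    have "class_diff v (divisor_class v (D i)) (divisor_class v (E (p i))) = divisor_class v (\<lambda>j. 0)"
      by (rule degree_zero_if_constant_term[OF Adeg[OF i] p(2)[OF i]])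
    hence "divisor_class v (\<lambda>j. D i j - E (p i) j) = divisor_class v (\<lambda>j. 0)"
      by (simp add: class_diff_divisor_class)
    then obtain m where "\<forall>j. D i j - E (p i) j = 0 + pairing m (v j)" unfolding divisor_class_eq_iff by blast
    hence "\<forall>j. D i j = E (p i) j + pairing m (v j)" by (simp add: diff_eq_eq add.commute)
    thus "divisor_class v (D i) = divisor_class v (E (p i))" unfolding divisor_class_eq_iff by blast
    \<comment> \<open>Otherwise row \<open>i\<close> of \<open>A\<close> would be a relation between
      the \<open>Gs\<close> with a nonzero constant term. A nonzero \<open>Fs ! i\<close> later
      provides an effective divisor of its degree.\<close>
    show "Fs ! i \<noteq> 0"
    proof
      assume "Fs ! i = 0"
      hence "(\<Sum>j<?n. A i j * Gs ! j) = 0" using A[OF i] by simp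
      moreover have "p i < ?n" using permutes_in_image[OF p(1), of i] i by simp
      ultimately have "?c (A i (p i)) = 0" using rel[of "A i" "p i"] by simp
      thus False using p(2)[OF i] by simp
    qed
  qed
qed

text \<open>The dimension count for the exact sequence
  \<open>0 -> (S/I)(- E k) -> S/I -> S/(I + g) -> 0\<close>: a basis modulo the larger ideal and
  \<open>g\<close> times a basis in the lower degree together form a basis modulo
  \<open>I\<close>.\<close>

lemma hilbert_function_regular_step:
  fixes Gs :: "('r, 'k::field) cox_ring list"
  assumes reg: "regular_sequence Gs" and k: "k < length Gs"
    and G: "\<And>i. i \<le> k \<Longrightarrow> Gs ! i \<in> graded_piece v (divisor_class v (E i))"
  shows "hilbert_function v (ideal_gen (set (take k Gs))) (divisor_class v D)
    = hilbert_function v (ideal_gen (set (take (Suc k) Gs))) (divisor_class v D)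
      + hilbert_function v (ideal_gen (set (take k Gs))) (divisor_class v (\<lambda>j. D j - E k j))"
proof -
  let ?I = "ideal_gen (set (take k Gs))" and ?I' = "ideal_gen (set (take (Suc k) Gs))"
  let ?\<alpha> = "divisor_class v D" and ?\<beta> = "divisor_class v (\<lambda>j. D j - E k j)"
  define g where "g = Gs ! k"
  have I: "is_ideal ?I" "is_ideal ?I'" by (rule ideal.subspace_span)+
  have sub: "?I \<subseteq> ?I'" by (rule ideal.span_mono) (auto simp: take_Suc_conv_app_nth[OF k])
  have gI': "g \<in> ?I'" by (rule ideal.span_base) (simp add: take_Suc_conv_app_nth[OF k] g_def)
  have gdeg: "g \<in> graded_piece v (divisor_class v (E k))" using G[of k] by (simp add: g_def)
  have reg_g: "a \<in> ?I" if "a * g \<in> ?I" for a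
    using reg k that unfolding regular_sequence_def g_def by blast
  obtain E1 where E1: "basis_modulo (graded_piece v ?\<alpha>) ?I' E1" "hilbert_function v ?I' ?\<alpha> = card E1"
    by (rule hilbert_function_basis_exists[OF finite_monomials I(2)])
  obtain E2 where E2: "basis_modulo (graded_piece v ?\<beta>) ?I E2" "hilbert_function v ?I ?\<beta> = card E2"
    by (rule hilbert_function_basis_exists[OF finite_monomials I(1)])
  note E1' = E1(1)[unfolded basis_modulo_iff independent_modulo_def]
    and E2' = E2(1)[unfolded basis_modulo_iff independent_modulo_def]
  have fin: "finite E1" "finite E2" using E1' E2' by auto
  note subE = conjunct1[OF conjunct2[OF E1']] conjunct1[OF conjunct2[OF E2']]
    and repE = conjunct2[OF conjunct2[OF E1']] conjunct2[OF conjunct2[OF E2']]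
  have ind1: "\<forall>e\<in>E1. c e = 0" if "(\<Sum>e\<in>E1. scale_poly (c e) e) \<in> ?I'" for c
    using conjunct2[OF conjunct1[OF E1']] that by blast
  have indE2: "independent_modulo ?I E2" using E2(1) by (simp only: basis_modulo_iff)
  have indep2: "\<forall>e\<in>E2. c e = 0" if "(\<Sum>e\<in>E2. scale_poly (c e) (e * g)) \<in> ?I" for c
    by (rule independent_modulo_mult(1)[OF indE2 ideal.subspace_0[OF I(1)] reg_g that])
  have inj: "inj_on (\<lambda>e. e * g) E2"
    by (rule independent_modulo_mult(2)[OF indE2 ideal.subspace_0[OF I(1)] reg_g])
  have scI': "(\<Sum>e\<in>E2. scale_poly (c e) (e * g)) \<in> ?I'" for c
    using gI' by (intro ideal.subspace_sum[OF I(2)] ideal.subspace_scale[OF I(2)])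
  have disj: "E1 \<inter> (\<lambda>e. e * g) ` E2 = {}"
  proof (rule ccontr)
    assume "\<not> ?thesis"
    then obtain e where e: "e \<in> E1" "e \<in> (\<lambda>e. e * g) ` E2" by blast
    have "e \<in> ?I'" using e(2) ideal.subspace_scale[OF I(2) gI'] by auto
    moreover have "(\<Sum>x\<in>E1. scale_poly (if x = e then 1 else 0) x) = (\<Sum>x\<in>E1. if x = e then x else 0)"
      by (rule sum.cong) auto
    hence "(\<Sum>x\<in>E1. scale_poly (if x = e then 1 else 0) x) = e" using e(1) fin by simp
    ultimately have "(\<Sum>x\<in>E1. scale_poly (if x = e then 1 else 0) x) \<in> ?I'" by (simp only:)
    from bspec[OF ind1[OF this] e(1)] show False by simp
  qed
  let ?E = "E1 \<union> (\<lambda>e. e * g) ` E2"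
  have sumE: "(\<Sum>e\<in>?E. scale_poly (c e) e) = (\<Sum>e\<in>E1. scale_poly (c e) e) + (\<Sum>e\<in>E2. scale_poly (c (e * g)) (e * g))" for c
    using sum_scale_Un[OF fin(1) finite_imageI[OF fin(2)] disj, of c] by (simp add: sum.reindex[OF inj])
  have "basis_modulo (graded_piece v ?\<alpha>) ?I ?E"
    unfolding basis_modulo_iff independent_modulo_def
  proof (intro conjI allI impI)
    show "finite ?E" using fin by simp
    show "?E \<subseteq> graded_piece v ?\<alpha>"
    proof -
      have "e * g \<in> graded_piece v ?\<alpha>" if "e \<in> E2" for e
      proof -
        have "e \<in> graded_piece v ?\<beta>" using subE(2) that by blast
        from graded_piece_mult[OF this gdeg] show ?thesis by (simp add: Cl_mult)
      qed
      thus ?thesis using subE(1) by blast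
    qed
    show "\<forall>e\<in>?E. c e = 0" if c: "(\<Sum>e\<in>?E. scale_poly (c e) e) \<in> ?I" for c
    proof -
      have "(\<Sum>e\<in>E1. scale_poly (c e) e) + (\<Sum>e\<in>E2. scale_poly (c (e * g)) (e * g)) \<in> ?I'"
        using c sub unfolding sumE by blast
      from ideal.subspace_diff[OF I(2) this scI'[of "\<lambda>e. c (e * g)"]]
      have c1: "\<forall>e\<in>E1. c e = 0" by (intro ind1) simp
      hence "(\<Sum>e\<in>E1. scale_poly (c e) e) = 0" by simp
      hence "(\<Sum>e\<in>E2. scale_poly (c (e * g)) (e * g)) \<in> ?I" using c unfolding sumE by simp
      hence "\<forall>e\<in>E2. c (e * g) = 0" by (rule indep2)
      thus ?thesis using c1 by blast
    qed
    show "\<forall>f\<in>graded_piece v ?\<alpha>. \<exists>c. f - (\<Sum>e\<in>?E. scale_poly (c e) e) \<in> ?I"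
    proof
      fix f :: "('r, 'k) cox_ring" assume f: "f \<in> graded_piece v ?\<alpha>"
      then obtain c1 where c1: "f - (\<Sum>e\<in>E1. scale_poly (c1 e) e) \<in> ?I'" using bspec[OF repE(1)] by blast
      have "(\<Sum>e\<in>E1. scale_poly (c1 e) e) \<in> graded_piece v ?\<alpha>"
        using subE(1) by (intro graded_piece_sum graded_piece_scale) blast
      with f have "f - (\<Sum>e\<in>E1. scale_poly (c1 e) e) \<in> graded_piece v ?\<alpha>" by (rule graded_piece_diff)
      \<comment> \<open>The remainder lies in the larger ideal. Its homogeneous coefficient at
        \<open>g\<close> has the lower degree, so \<open>E2\<close> reduces it modulo the smaller
        ideal.\<close>
      then obtain a where a: "f - (\<Sum>e\<in>E1. scale_poly (c1 e) e) = (\<Sum>i<length (take (Suc k) Gs). a i * take (Suc k) Gs ! i)"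
        and adeg: "\<And>i. a i \<in> graded_piece v (class_diff v ?\<alpha> (divisor_class v (E i)))"
        by (rule homogeneous_ideal_representation[OF _ divisor_class_in_Cl c1, where \<delta> = "\<lambda>i. divisor_class v (E i)"])
           (use G k in auto)
      have a': "f - (\<Sum>e\<in>E1. scale_poly (c1 e) e) = (\<Sum>i<k. a i * take k Gs ! i) + a k * g"
        unfolding a using k by (simp add: g_def)
      have "a k \<in> graded_piece v ?\<beta>" using adeg[of k] by (simp add: class_diff_divisor_class)
      then obtain c2 where c2: "a k - (\<Sum>e\<in>E2. scale_poly (c2 e) e) \<in> ?I" using bspec[OF repE(2)] by blast
      define c where "c = (\<lambda>e. if e \<in> E1 then c1 e else c2 (inv_into E2 (\<lambda>e. e * g) e))"
      have s1: "(\<Sum>e\<in>E1. scale_poly (c e) e) = (\<Sum>e\<in>E1. scale_poly (c1 e) e)"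
        by (rule sum.cong) (auto simp: c_def)
      have s2: "(\<Sum>e\<in>E2. scale_poly (c (e * g)) (e * g)) = (\<Sum>e\<in>E2. scale_poly (c2 e) e) * g"
        unfolding sum_distrib_right
      proof (rule sum.cong)
        fix e assume e: "e \<in> E2"
        hence "e * g \<in> (\<lambda>e. e * g) ` E2" by (rule imageI)
        hence "e * g \<notin> E1" using disj by blast
        hence "c (e * g) = c2 e" using inv_into_f_f[OF inj e] by (simp add: c_def)
        thus "scale_poly (c (e * g)) (e * g) = scale_poly (c2 e) e * g" by (simp add: mult.assoc)
      qed simp
      have "f - (\<Sum>e\<in>?E. scale_poly (c e) e)
          = (\<Sum>i<k. a i * take k Gs ! i) + (a k - (\<Sum>e\<in>E2. scale_poly (c2 e) e)) * g"
        unfolding sumE s1 s2 using a' by (simp add: algebra_simps)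
      also have "\<dots> \<in> ?I"
      proof (rule ideal.subspace_add[OF I(1)])
        show "(\<Sum>i<k. a i * take k Gs ! i) \<in> ?I"
          unfolding ideal_gen_list using k by (intro exI[of _ a]) simp
        show "(a k - (\<Sum>e\<in>E2. scale_poly (c2 e) e)) * g \<in> ?I"
          using ideal.subspace_scale[OF I(1) c2, of g] by (simp add: mult.commute)
      qed
      finally show "\<exists>c. f - (\<Sum>e\<in>?E. scale_poly (c e) e) \<in> ?I" by (rule exI[of _ c])
    qed
  qed
  from hilbert_function_basis[OF finite_monomials I(1) this]
  show ?thesis using E1(2) E2(2) fin disj inj by (simp add: card_Un_disjoint card_image)
qed

text \<open>In the unfolded recursion a subset \<open>J\<close> records the steps at which the
  shifted term was taken, each with one change of sign.\<close>

lemma hilbert_function_regular_sequence: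
  fixes Gs :: "('r, 'k::field) cox_ring list"
  assumes reg: "regular_sequence Gs"
    and G: "\<And>i. i < length Gs \<Longrightarrow> Gs ! i \<in> graded_piece v (divisor_class v (E i))"
    and "k \<le> length Gs"
  shows "int (hilbert_function v (ideal_gen (set (take k Gs))) (divisor_class v D))
    = (\<Sum>J\<in>Pow {..<k}. (- 1) ^ card J * int (card (polytope_points v (\<lambda>j. D j - (\<Sum>i\<in>J. E i j)))))"
  using assms(3)
proof (induction k arbitrary: D)
  case 0
  have "hilbert_function v (ideal_gen (set (take 0 Gs))) (divisor_class v D) = card (polytope_points v D)"
    using hilbert_function_trivial[OF finite_monomials ideal.subspace_span, of D "{} :: ('r, 'k) cox_ring set"]
    by (simp add: card_monomials)
  thus ?case by simp
next
  case (Suc k)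
  have "int (hilbert_function v (ideal_gen (set (take (Suc k) Gs))) (divisor_class v D))
      = int (hilbert_function v (ideal_gen (set (take k Gs))) (divisor_class v D))
      - int (hilbert_function v (ideal_gen (set (take k Gs))) (divisor_class v (\<lambda>j. D j - E k j)))"
    using hilbert_function_regular_step[OF reg, of k E D] G Suc.prems by simp
  also have "\<dots> = (\<Sum>J\<in>Pow {..<k}. (- 1) ^ card J * int (card (polytope_points v (\<lambda>j. D j - (\<Sum>i\<in>J. E i j)))))
      + (\<Sum>J\<in>Pow {..<k}. (- 1) ^ card (insert k J) * int (card (polytope_points v (\<lambda>j. D j - (\<Sum>i\<in>insert k J. E i j)))))"
  proof -
    have ins: "card (insert k J) = Suc (card J)" "(\<Sum>i\<in>insert k J. E i j) = E k j + (\<Sum>i\<in>J. E i j)"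
      if "J \<in> Pow {..<k}" for J j
    proof -
      have "finite J" "k \<notin> J" using that finite_subset[of J "{..<k}"] by auto
      thus "card (insert k J) = Suc (card J)" "(\<Sum>i\<in>insert k J. E i j) = E k j + (\<Sum>i\<in>J. E i j)" by simp_all
    qed
    have "(\<Sum>J\<in>Pow {..<k}. (- 1) ^ card (insert k J) * int (card (polytope_points v (\<lambda>j. D j - (\<Sum>i\<in>insert k J. E i j)))))
      = (\<Sum>J\<in>Pow {..<k}. - ((- 1) ^ card J * int (card (polytope_points v (\<lambda>j. D j - E k j - (\<Sum>i\<in>J. E i j))))))"
      by (rule sum.cong) (simp_all add: ins diff_diff_eq)
    thus ?thesis using Suc.IH[of D] Suc.IH[of "\<lambda>j. D j - E k j"] Suc.prems by (simp add: sum_negf)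
  qed
  also have "\<dots> = (\<Sum>J\<in>Pow {..<Suc k}. (- 1) ^ card J * int (card (polytope_points v (\<lambda>j. D j - (\<Sum>i\<in>J. E i j)))))"
    by (rule sum_Pow_lessThan_Suc[symmetric])
  finally show ?case .
qed

end


subsection \<open>Points of the torus\<close>

lemma Cl_hom_divisor:
  fixes v :: "'r::finite \<Rightarrow> int ^ 'n" and g :: "'r divisor set \<Rightarrow> 'k::field"
  assumes g: "g \<in> hom (Cl v) mult_group"
  shows "g (monomial_degree v u) = (\<Prod>j\<in>UNIV. g (monomial_degree v (Poly_Mapping.single j 1)) ^ Poly_Mapping.lookup u j)"
proof -
  note g_hom = Cl_hom_sum[OF g]
  have sum: "g (divisor_class v (\<lambda>j. \<Sum>i\<in>A. F i j)) = (\<Prod>i\<in>A. g (divisor_class v (F i)))" if "finite A" for A F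
    using that by (induction A rule: finite_induct) (simp_all add: g_hom)
  have pow: "g (divisor_class v (\<lambda>j. int n * F j)) = g (divisor_class v F) ^ n" for n F
    by (induction n) (simp_all add: g_hom distrib_right)
  have "(\<lambda>j. int (Poly_Mapping.lookup u j))
      = (\<lambda>j. \<Sum>i\<in>UNIV. int (Poly_Mapping.lookup u i) * int (Poly_Mapping.lookup (Poly_Mapping.single i 1) j))"
  proof
    fix j
    have "(\<Sum>i\<in>UNIV. int (Poly_Mapping.lookup u i) * int (Poly_Mapping.lookup (Poly_Mapping.single i 1) j))
        = (\<Sum>i\<in>UNIV. if i = j then int (Poly_Mapping.lookup u i) else 0)"
      by (rule sum.cong) (auto simp: lookup_single when_def)
    thus "int (Poly_Mapping.lookup u j)
      = (\<Sum>i\<in>UNIV. int (Poly_Mapping.lookup u i) * int (Poly_Mapping.lookup (Poly_Mapping.single i 1) j))" by simp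
  qed
  thus ?thesis unfolding monomial_degree_def by (simp only: sum[OF finite] pow)
qed

text \<open>A group element \<open>g\<close> multiplies the value of a form of degree \<alpha> by
  \<open>g \<alpha>\<close>.\<close>

lemma poly_eval_orbit:
  fixes v :: "'r::finite \<Rightarrow> int ^ 'n"
  assumes "y \<in> orbit v x" "f \<in> graded_piece v \<alpha>" "poly_eval x f = 0"
  shows "poly_eval y f = 0"
proof -
  obtain g where g: "g \<in> hom (Cl v) mult_group" and y: "y = (\<lambda>j. g (monomial_degree v (Poly_Mapping.single j 1)) * x j)"
    using assms(1) unfolding orbit_def by blast
  have "poly_eval y f = (\<Sum>u\<in>Poly_Mapping.keys f. g \<alpha> * (Poly_Mapping.lookup f u * (\<Prod>j\<in>UNIV. x j ^ Poly_Mapping.lookup u j)))"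
    unfolding poly_eval_def
  proof (rule sum.cong)
    fix u assume "u \<in> Poly_Mapping.keys f"
    hence "monomial_degree v u = \<alpha>" using assms(2) by (simp add: graded_piece_def)
    hence "(\<Prod>j\<in>UNIV. y j ^ Poly_Mapping.lookup u j) = g \<alpha> * (\<Prod>j\<in>UNIV. x j ^ Poly_Mapping.lookup u j)"
      using Cl_hom_divisor[OF g, of u] by (simp add: y power_mult_distrib prod.distrib)
    thus "Poly_Mapping.lookup f u * (\<Prod>j\<in>UNIV. y j ^ Poly_Mapping.lookup u j)
      = g \<alpha> * (Poly_Mapping.lookup f u * (\<Prod>j\<in>UNIV. x j ^ Poly_Mapping.lookup u j))" by (simp add: mult_ac)
  qed simp
  also have "\<dots> = g \<alpha> * poly_eval x f" by (simp add: poly_eval_def sum_distrib_left)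
  finally show ?thesis using assms(3) by simp
qed

lemma self_mem_orbit: "x \<in> orbit v x"
proof -
  have "(\<lambda>_. 1) \<in> hom (Cl v) mult_group" by (simp add: hom_def mult_group_def)
  thus ?thesis unfolding orbit_def by force
qed

lemma orbit_subset:
  assumes "y \<in> orbit v x"
  shows "orbit v y \<subseteq> orbit v x"
proof
  fix z assume "z \<in> orbit v y"
  then obtain g' where g': "g' \<in> hom (Cl v) mult_group" "z = (\<lambda>j. g' (monomial_degree v (Poly_Mapping.single j 1)) * y j)"
    unfolding orbit_def by blast
  obtain g where g: "g \<in> hom (Cl v) mult_group" "y = (\<lambda>j. g (monomial_degree v (Poly_Mapping.single j 1)) * x j)"
    using assms unfolding orbit_def by blast
  have "(\<lambda>\<alpha>. g' \<alpha> * g \<alpha>) \<in> hom (Cl v) mult_group"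
    using g(1) g'(1) by (auto simp: hom_def mult_group_def Pi_def)
  moreover have "z = (\<lambda>j. (g' (monomial_degree v (Poly_Mapping.single j 1)) * g (monomial_degree v (Poly_Mapping.single j 1))) * x j)"
    by (simp add: g(2) g'(2) mult.assoc)
  ultimately show "z \<in> orbit v x"
    unfolding orbit_def by (intro CollectI exI[of _ "\<lambda>\<alpha>. g' \<alpha> * g \<alpha>"] conjI)
qed

definition char_eval :: "('r::finite \<Rightarrow> int ^ 'n) \<Rightarrow> int ^ 'n \<Rightarrow> ('r \<Rightarrow> 'k::field) \<Rightarrow> 'k" where
  "char_eval v m x = (\<Prod>j\<in>UNIV. x j powi pairing m (v j))"

text \<open>The quotients \<open>y j / x j\<close> define a homomorphism on divisors. Agreement of
  all characters says that it is trivial on principal divisors, so it descends to the class group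
  and carries \<open>x\<close> to \<open>y\<close>.\<close>

lemma mem_orbit_if_characters_agree:
  fixes v :: "'r::finite \<Rightarrow> int ^ 'n" and x y :: "'r \<Rightarrow> 'k::field"
  assumes "\<And>j. x j \<noteq> 0" "\<And>j. y j \<noteq> 0" "\<And>m. char_eval v m x = char_eval v m y"
  shows "y \<in> orbit v x"
proof -
  define t where "t = (\<lambda>j. y j / x j)"
  have t0: "t j \<noteq> 0" for j using assms by (simp add: t_def)
  define \<gamma> where "\<gamma> = (\<lambda>D. \<Prod>j\<in>UNIV. t j powi D j)"
  have \<gamma>_add: "\<gamma> (\<lambda>j. D j + E j) = \<gamma> D * \<gamma> E" for D E
    using t0 by (simp add: \<gamma>_def power_int_add prod.distrib)
  have \<gamma>0: "\<gamma> D \<noteq> 0" for D using t0 by (simp add: \<gamma>_def)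
  have triv: "\<gamma> (\<lambda>j. pairing m (v j)) = 1" for m
  proof -
    have "\<gamma> (\<lambda>j. pairing m (v j)) = char_eval v m y / char_eval v m x"
      by (simp add: \<gamma>_def t_def char_eval_def power_int_divide_distrib prod_dividef)
    moreover have "char_eval v m x \<noteq> 0" using assms(1) by (simp add: char_eval_def)
    ultimately show ?thesis using assms(3) by simp
  qed
  define g where "g = (\<lambda>\<alpha>. \<gamma> (SOME D. D \<in> \<alpha>))"
  have g: "g (divisor_class v D) = \<gamma> D" for D
  proof -
    have "(SOME E. E \<in> divisor_class v D) \<in> divisor_class v D"
      by (rule someI[of _ D]) (rule self_mem_divisor_class)
    then obtain m where m: "\<And>j. (SOME E. E \<in> divisor_class v D) j = D j + pairing m (v j)"
      unfolding mem_divisor_class_iff by blast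
    hence "(SOME E. E \<in> divisor_class v D) = (\<lambda>j. D j + pairing m (v j))" by (rule ext)
    thus ?thesis using triv[of m] by (simp add: g_def \<gamma>_add)
  qed
  have "g \<in> hom (Cl v) mult_group"
  proof (rule homI)
    fix a assume "a \<in> carrier (Cl v)"
    thus "g a \<in> carrier mult_group" using \<gamma>0 by (simp add: g_def mult_group_def)
  next
    fix a b assume "a \<in> carrier (Cl v)" "b \<in> carrier (Cl v)"
    then obtain D E where "a = divisor_class v D" "b = divisor_class v E" unfolding carrier_Cl by blast
    thus "g (a \<otimes>\<^bsub>Cl v\<^esub> b) = g a \<otimes>\<^bsub>mult_group\<^esub> g b" by (simp add: Cl_mult g \<gamma>_add mult_group_def)
  qed
  moreover have "y = (\<lambda>j. g (monomial_degree v (Poly_Mapping.single j 1)) * x j)"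
  proof
    fix j
    have "g (monomial_degree v (Poly_Mapping.single j 1)) = (\<Prod>i\<in>UNIV. if i = j then t i else 1)"
      unfolding monomial_degree_def g \<gamma>_def by (rule prod.cong) (auto simp: lookup_single when_def)
    thus "y j = g (monomial_degree v (Poly_Mapping.single j 1)) * x j" using assms(1)[of j] by (simp add: t_def)
  qed
  ultimately show ?thesis unfolding orbit_def by (intro CollectI exI[of _ g] conjI)
qed

lemma monomial_degree_uniform:
  fixes v :: "'r::finite \<Rightarrow> int ^ 'n"
  assumes "\<And>j. int (Poly_Mapping.lookup u j) = int c + pairing m (v j)"
  shows "monomial_degree v u = divisor_class v (\<lambda>_. int c)"
  unfolding monomial_degree_def divisor_class_eq_iff using assms by blast

text \<open>Some character takes different values at the two points. Subtracting its value at
  \<open>y\<close> and multiplying by a power of the product of all variables to clear denominators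
  gives the form.\<close>

lemma separate_two_orbits:
  fixes v :: "'r::finite \<Rightarrow> int ^ 'n" and x y :: "'r \<Rightarrow> 'k::field"
  assumes x: "\<And>j. x j \<noteq> 0" and y: "\<And>j. y j \<noteq> 0" and ne: "orbit v x \<noteq> orbit v y"
  shows "\<exists>c Q. Q \<in> graded_piece v (divisor_class v (\<lambda>_. int c)) \<and> poly_eval x Q \<noteq> 0 \<and> poly_eval y Q = 0"
proof -
  have "\<exists>m. char_eval v m x \<noteq> char_eval v m y"
  proof (rule ccontr)
    assume "\<not> ?thesis"
    hence eq: "char_eval v m x = char_eval v m y" for m by blast
    have "y \<in> orbit v x" by (rule mem_orbit_if_characters_agree[OF x y eq])
    moreover have "x \<in> orbit v y" by (rule mem_orbit_if_characters_agree[OF y x eq[symmetric]])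
    ultimately show False using ne orbit_subset[of y v x] orbit_subset[of x v y] by (simp add: subset_antisym)
  qed
  then obtain m where m: "char_eval v m x \<noteq> char_eval v m y" by blast
  \<comment> \<open>Large enough to make all exponents \<open>c + pairing m (v j)\<close>
    nonnegative.\<close>
  define c where "c = (\<Sum>j\<in>UNIV. nat \<bar>pairing m (v j)\<bar>)"
  have c: "\<bar>pairing m (v j)\<bar> \<le> int c" for j
  proof -
    have "nat \<bar>pairing m (v j)\<bar> \<le> c" unfolding c_def by (rule member_le_sum) auto
    thus ?thesis by linarith
  qed
  define u0 :: "'r \<Rightarrow>\<^sub>0 nat" where "u0 = Abs_poly_mapping (\<lambda>j. c)"
  define u1 :: "'r \<Rightarrow>\<^sub>0 nat" where "u1 = Abs_poly_mapping (\<lambda>j. nat (int c + pairing m (v j)))"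
  have u0: "Poly_Mapping.lookup u0 j = c" for j by (simp add: u0_def lookup_Abs_poly_mapping)
  have u1: "int (Poly_Mapping.lookup u1 j) = int c + pairing m (v j)" for j
    using c[of j] by (simp add: u1_def lookup_Abs_poly_mapping)
  have eval1: "(\<Prod>j\<in>UNIV. z j ^ Poly_Mapping.lookup u1 j) = (\<Prod>j\<in>UNIV. z j ^ c) * char_eval v m z"
    if z: "\<And>j. z j \<noteq> 0" for z :: "'r \<Rightarrow> 'k"
  proof -
    have "z j ^ Poly_Mapping.lookup u1 j = z j ^ c * z j powi pairing m (v j)" for j
    proof -
      have "z j ^ Poly_Mapping.lookup u1 j = z j powi (int c + pairing m (v j))"
        unfolding u1[symmetric] by (rule power_int_of_nat[symmetric])
      thus ?thesis using z[of j] by (simp add: power_int_add)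
    qed
    thus ?thesis by (simp add: char_eval_def prod.distrib)
  qed
  define Q where "Q = monom_of u1 - scale_poly (char_eval v m y) (monom_of u0)"
  have ev: "poly_eval z Q = (\<Prod>j\<in>UNIV. z j ^ c) * (char_eval v m z - char_eval v m y)"
    if z: "\<And>j. z j \<noteq> 0" for z :: "'r \<Rightarrow> 'k"
    using eval1[OF z] by (simp add: Q_def poly_eval_diff poly_eval_mult poly_eval_single u0 right_diff_distrib)
  have "monomial_degree v u1 = divisor_class v (\<lambda>_. int c)" "monomial_degree v u0 = divisor_class v (\<lambda>_. int c)"
    using monomial_degree_uniform[of u1 c m v] monomial_degree_uniform[of u0 c 0 v] u1 u0 by simp_all
  hence "Q \<in> graded_piece v (divisor_class v (\<lambda>_. int c))"
    unfolding Q_def using graded_piece_monom[of u1 1 v] graded_piece_monom[of u0 1 v]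
    by (intro graded_piece_diff graded_piece_scale) simp_all
  moreover have "poly_eval x Q \<noteq> 0" using m x by (simp add: ev[OF x])
  moreover have "poly_eval y Q = 0" by (simp add: ev[OF y])
  ultimately show ?thesis by blast
qed

text \<open>For each point the forms separating it from the other points are multiplied together.
  Powers of the product of all variables, which vanishes nowhere on the torus, bring the products to
  one common degree.\<close>

lemma interpolation:
  fixes v :: "'r::finite \<Rightarrow> int ^ 'n" and Z :: "('r \<Rightarrow> 'k::field) set"
  assumes fin: "finite Z" and nz: "\<And>z j. z \<in> Z \<Longrightarrow> z j \<noteq> 0" and inj: "inj_on (orbit v) Z"
  shows "\<exists>C0. \<forall>C\<ge>C0. \<exists>f. \<forall>z\<in>Z. f z \<in> graded_piece v (divisor_class v (\<lambda>_. int C)) \<and>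
    poly_eval z (f z) \<noteq> 0 \<and> (\<forall>z'\<in>Z. z' \<noteq> z \<longrightarrow> poly_eval z' (f z) = 0)"
proof -
  have "\<exists>c Q. z \<in> Z \<longrightarrow> z' \<in> Z \<longrightarrow> z' \<noteq> z \<longrightarrow>
      Q \<in> graded_piece v (divisor_class v (\<lambda>_. int c)) \<and> poly_eval z Q \<noteq> 0 \<and> poly_eval z' Q = 0" for z z'
  proof (cases "z \<in> Z \<and> z' \<in> Z \<and> z' \<noteq> z")
    case True
    have "\<And>j. z j \<noteq> 0" "\<And>j. z' j \<noteq> 0" using nz True by auto
    moreover have "orbit v z \<noteq> orbit v z'" using inj True by (auto simp: inj_on_def)
    ultimately obtain c Q where "Q \<in> graded_piece v (divisor_class v (\<lambda>_. int c)) \<and>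
        poly_eval z Q \<noteq> 0 \<and> poly_eval z' Q = 0"
      using separate_two_orbits[of z z' v] by blast
    thus ?thesis by (intro exI[of _ c] exI[of _ Q] impI)
  qed blast
  hence "\<forall>p. \<exists>q. fst p \<in> Z \<longrightarrow> snd p \<in> Z \<longrightarrow> snd p \<noteq> fst p \<longrightarrow>
      snd q \<in> graded_piece v (divisor_class v (\<lambda>_. int (fst q))) \<and> poly_eval (fst p) (snd q) \<noteq> 0 \<and> poly_eval (snd p) (snd q) = 0"
    by (metis fst_conv snd_conv)
  from choice[OF this] obtain q where q: "\<And>z z'. z \<in> Z \<Longrightarrow> z' \<in> Z \<Longrightarrow> z' \<noteq> z \<Longrightarrow>
      snd (q (z, z')) \<in> graded_piece v (divisor_class v (\<lambda>_. int (fst (q (z, z'))))) \<and>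
      poly_eval z (snd (q (z, z'))) \<noteq> 0 \<and> poly_eval z' (snd (q (z, z'))) = 0"
    by auto
  define c where "c = (\<lambda>z. \<Sum>z'\<in>Z - {z}. fst (q (z, z')))"
  define one_vec :: "'r \<Rightarrow>\<^sub>0 nat" where "one_vec = Abs_poly_mapping (\<lambda>j. 1)"
  have one_vec: "Poly_Mapping.lookup one_vec j = 1" for j by (simp add: one_vec_def lookup_Abs_poly_mapping)
  have one_deg: "monom_of one_vec \<in> graded_piece v (divisor_class v (\<lambda>_. 1))"
    using graded_piece_monom[of one_vec 1 v] monomial_degree_uniform[of one_vec 1 0 v] by (simp add: one_vec)
  show ?thesis
  proof (rule exI[of _ "\<Sum>z\<in>Z. c z"], intro allI impI)
    fix C assume C: "C \<ge> (\<Sum>z\<in>Z. c z)"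
    define f where "f = (\<lambda>z. (\<Prod>z'\<in>Z - {z}. snd (q (z, z'))) * monom_of one_vec ^ (C - c z))"
    have "f z \<in> graded_piece v (divisor_class v (\<lambda>_. int C)) \<and>
      poly_eval z (f z) \<noteq> 0 \<and> (\<forall>z'\<in>Z. z' \<noteq> z \<longrightarrow> poly_eval z' (f z) = 0)" if z: "z \<in> Z" for z
    proof (intro conjI ballI impI)
      have cz: "c z \<le> C" using member_le_sum[of z Z c] z fin C by simp
      have "(\<Prod>z'\<in>Z - {z}. snd (q (z, z'))) \<in> graded_piece v (divisor_class v (\<lambda>_. \<Sum>z'\<in>Z - {z}. int (fst (q (z, z')))))"
        by (rule graded_piece_prod) (use q z in auto)
      moreover have "monom_of one_vec ^ (C - c z) \<in> graded_piece v (divisor_class v (\<lambda>_. int (C - c z) * 1))"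
        by (rule graded_piece_power[OF one_deg])
      ultimately have "f z \<in> graded_piece v (divisor_class v (\<lambda>_. (\<Sum>z'\<in>Z - {z}. int (fst (q (z, z')))) + int (C - c z) * 1))"
        unfolding f_def Cl_mult[symmetric] by (rule graded_piece_mult)
      moreover have "(\<Sum>z'\<in>Z - {z}. int (fst (q (z, z')))) + int (C - c z) * 1 = int C"
        using cz by (simp add: c_def)
      ultimately show "f z \<in> graded_piece v (divisor_class v (\<lambda>_. int C))" by simp
      have "poly_eval z (monom_of one_vec) \<noteq> 0" using nz[OF z] by (simp add: poly_eval_single one_vec)
      thus "poly_eval z (f z) \<noteq> 0" using q[OF z] fin by (auto simp: f_def poly_eval_mult poly_eval_prod poly_eval_power)
      fix z' assume z': "z' \<in> Z" "z' \<noteq> z"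
      hence "(\<Prod>x\<in>Z - {z}. poly_eval z' (snd (q (z, x)))) = 0"
        using q[OF z z'] fin by (intro prod_zero bexI[of _ z']) auto
      thus "poly_eval z' (f z) = 0" by (simp add: f_def poly_eval_mult poly_eval_prod)
    qed
    thus "\<exists>f. \<forall>z\<in>Z. f z \<in> graded_piece v (divisor_class v (\<lambda>_. int C)) \<and>
      poly_eval z (f z) \<noteq> 0 \<and> (\<forall>z'\<in>Z. z' \<noteq> z \<longrightarrow> poly_eval z' (f z) = 0)" by blast
  qed
qed

section \<open>Ideals of reduced subschemes contained in the torus\<close>

locale torus_subscheme = toric_fan \<Sigma> v
  for \<Sigma> :: "(real ^ 'n) set set" and v :: "'r::finite \<Rightarrow> int ^ 'n" +
  fixes Y :: "('r \<Rightarrow> 'k::alg_closed_field) set set" and I :: "('r, 'k) cox_ring set"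
  assumes torus: "Y \<subseteq> dense_torus v" and ideal_of: "is_ideal_of \<Sigma> v Y I"
begin

abbreviation B :: "('r, 'k) cox_ring set" where "B \<equiv> irrelevant_ideal \<Sigma> v"

lemma is_ideal_I: "is_ideal I"
  using ideal_of by (simp add: is_ideal_of_def radical_ideal_def)

text \<open>The group acts by nonzero factors on the coordinates, so nonvanishing passes from one
  representative of an orbit to all others.\<close>

lemma points_in_torus:
  assumes "x \<in> zero_set I - zero_set B"
  shows "orbit v x \<in> Y" "x j \<noteq> 0"
proof -
  show "orbit v x \<in> Y" using ideal_of assms by (auto simp: is_ideal_of_def closed_subset_of_ideal_def)
  then obtain x' where x': "orbit v x = orbit v x'" "\<forall>j. x' j \<noteq> 0" using torus by (auto simp: dense_torus_def)
  have "x \<in> orbit v x'" using self_mem_orbit[of x v] x'(1) by simp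
  then obtain g where g: "g \<in> hom (Cl v) mult_group" "x = (\<lambda>j. g (monomial_degree v (Poly_Mapping.single j 1)) * x' j)"
    unfolding orbit_def by blast
  have "g (monomial_degree v (Poly_Mapping.single j 1)) \<noteq> 0"
    unfolding monomial_degree_def by (rule Cl_hom_sum(2)[OF g(1)])
  thus "x j \<noteq> 0" using x'(2) by (simp add: g(2))
qed

lemma points_of_Y: "y \<in> Y \<Longrightarrow> \<exists>x. x \<in> zero_set I - zero_set B \<and> orbit v x = y"
  using ideal_of by (auto simp: is_ideal_of_def closed_subset_of_ideal_def)

text \<open>For \<open>b\<close> in \<open>B\<close> the product \<open>f * b\<close> vanishes on
  all of \<open>zero_set I\<close>, also where \<open>f\<close> may not. The Nullstellensatz and
  radicality put it into \<open>I\<close>, and saturation removes \<open>b\<close>.\<close>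

lemma vanishing_in_ideal:
  assumes f: "\<And>x. x \<in> zero_set I - zero_set B \<Longrightarrow> poly_eval x f = 0"
  shows "f \<in> I"
proof -
  have "f * b \<in> I" if b: "b \<in> B" for b
  proof -
    have "poly_eval x (f * b) = 0" if "x \<in> zero_set I" for x
      using f[of x] b that by (cases "x \<in> zero_set B") (auto simp: poly_eval_mult zero_set_def)
    hence "\<exists>k. (f * b) ^ k \<in> I" by (rule nullstellensatz[OF is_ideal_I])
    thus ?thesis using ideal_of by (auto simp: is_ideal_of_def radical_ideal_def)
  qed
  thus ?thesis using ideal_of by (auto simp: is_ideal_of_def saturated_ideal_def)
qed

lemma monomial_cancel:
  assumes "f * monom_of u \<in> I"
  shows "f \<in> I"
proof (rule vanishing_in_ideal)
  fix x assume x: "x \<in> zero_set I - zero_set B"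
  have "poly_eval x (f * monom_of u) = 0" using assms x by (auto simp: zero_set_def)
  moreover have "poly_eval x (monom_of u) \<noteq> 0" using points_in_torus(2)[OF x] by (simp add: poly_eval_single)
  ultimately show "poly_eval x f = 0" by (simp add: poly_eval_mult)
qed

lemma hilbert_function_mono:
  assumes "class_le v (divisor_class v D) (divisor_class v D')"
  shows "hilbert_function v I (divisor_class v D) \<le> hilbert_function v I (divisor_class v D')"
proof -
  obtain u where "class_diff v (divisor_class v D') (divisor_class v D) = monomial_degree v u"
    using assms unfolding class_le_def class_semigroup_def by blast
  hence u: "monomial_degree v u = divisor_class v (\<lambda>j. D' j - D j)" by (simp add: class_diff_divisor_class)
  obtain E where E: "basis_modulo (graded_piece v (divisor_class v D)) I E" "hilbert_function v I (divisor_class v D) = card E"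
    by (rule hilbert_function_basis_exists[OF finite_monomials is_ideal_I])
  have E': "independent_modulo I E" "E \<subseteq> graded_piece v (divisor_class v D)"
    using E(1) by (simp_all add: basis_modulo_iff)
  note m = independent_modulo_mult(2,3)[OF E'(1) ideal.subspace_0[OF is_ideal_I] monomial_cancel[of _ u]]
  have "(\<lambda>e. e * monom_of u) ` E \<subseteq> graded_piece v (divisor_class v D')"
  proof
    fix f assume "f \<in> (\<lambda>e. e * monom_of u) ` E"
    then obtain e where e: "e \<in> E" "f = e * monom_of u" by blast
    have "e \<in> graded_piece v (divisor_class v D)" using e(1) E'(2) by blast
    from graded_piece_mult[OF this graded_piece_monom[of u 1 v]] e(2)
    show "f \<in> graded_piece v (divisor_class v D')" by (simp add: u Cl_mult)
  qed
  from hilbert_function_ge[OF finite_monomials is_ideal_I m(2) this]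
  show ?thesis using E(2) m(1) by (simp add: card_image)
qed

text \<open>The bound is formulated for finite subsets because the finiteness of \<open>Y\<close>
  will be derived from it. Equality holds for \<open>Z = Y\<close> because a form is determined
  modulo \<open>I\<close> by its values at one representative of each point.\<close>

lemma card_points_le_hilbert_function:
  assumes "finite Z" "Z \<subseteq> Y"
  shows "\<exists>C0. \<forall>C\<ge>C0. card Z \<le> hilbert_function v I (divisor_class v (\<lambda>_. int C)) \<and>
    (Z = Y \<longrightarrow> hilbert_function v I (divisor_class v (\<lambda>_. int C)) = card Z)"
proof -
  have "\<forall>y. \<exists>x. y \<in> Y \<longrightarrow> x \<in> zero_set I - zero_set B \<and> orbit v x = y" using points_of_Y by blast
  from choice[OF this] obtain p where p: "\<And>y. y \<in> Y \<Longrightarrow> p y \<in> zero_set I - zero_set B \<and> orbit v (p y) = y"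
    by blast
  have inj: "inj_on p Z" by (rule inj_onI) (metis p assms(2) subsetD)
  have "finite (p ` Z)" using assms(1) by simp
  moreover have "x j \<noteq> 0" if "x \<in> p ` Z" for x j using that p assms(2) points_in_torus(2) by blast
  moreover have "inj_on (orbit v) (p ` Z)" by (rule inj_onI) (metis p assms(2) imageE subsetD)
  ultimately obtain C0 where C0: "\<forall>C\<ge>C0. \<exists>f. \<forall>x\<in>p ` Z. f x \<in> graded_piece v (divisor_class v (\<lambda>_. int C)) \<and>
    poly_eval x (f x) \<noteq> 0 \<and> (\<forall>x'\<in>p ` Z. x' \<noteq> x \<longrightarrow> poly_eval x' (f x) = 0)"
    using interpolation[of "p ` Z" v] by blast
  have "card Z \<le> hilbert_function v I (divisor_class v (\<lambda>_. int C)) \<and>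
    (Z = Y \<longrightarrow> hilbert_function v I (divisor_class v (\<lambda>_. int C)) = card Z)" if C: "C \<ge> C0" for C
  proof -
    let ?V = "graded_piece v (divisor_class v (\<lambda>_. int C)) :: ('r, 'k) cox_ring set"
    obtain f where f: "\<forall>x\<in>p ` Z. f x \<in> ?V \<and> poly_eval x (f x) \<noteq> 0 \<and> (\<forall>x'\<in>p ` Z. x' \<noteq> x \<longrightarrow> poly_eval x' (f x) = 0)"
      using C0 C by blast
    define F where "F = (\<lambda>y. f (p y))"
    have FV: "F y \<in> ?V" if "y \<in> Z" for y using f that by (simp add: F_def)
    have Fd: "poly_eval (p y) (F y) \<noteq> 0" if "y \<in> Z" for y using f that by (simp add: F_def)
    have Fo: "poly_eval (p y') (F y) = 0" if "y \<in> Z" "y' \<in> Z" "y' \<noteq> y" for y y'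
    proof -
      have "p y' \<noteq> p y" using inj that by (auto simp: inj_on_def)
      thus ?thesis using f that by (simp add: F_def)
    qed
    have injF: "inj_on F Z" by (rule inj_onI) (metis Fd Fo)
    have ev: "poly_eval (p y) (\<Sum>e\<in>F ` Z. scale_poly (c e) e) = c (F y) * poly_eval (p y) (F y)" if y: "y \<in> Z" for c y
    proof -
      have "poly_eval (p y) (\<Sum>e\<in>F ` Z. scale_poly (c e) e) = (\<Sum>y'\<in>Z. c (F y') * poly_eval (p y) (F y'))"
        by (simp add: sum.reindex[OF injF] poly_eval_sum poly_eval_mult poly_eval_single)
      also have "\<dots> = (\<Sum>y'\<in>Z. if y' = y then c (F y) * poly_eval (p y) (F y) else 0)"
        by (rule sum.cong) (use Fo y in auto)
      finally show ?thesis using y assms(1) by simp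
    qed
    have ind: "independent_modulo I (F ` Z)"
      unfolding independent_modulo_def
    proof (intro conjI allI impI ballI)
      show "finite (F ` Z)" using assms(1) by simp
      fix c e assume c: "(\<Sum>e\<in>F ` Z. scale_poly (c e) e) \<in> I" and "e \<in> F ` Z"
      then obtain y where y: "y \<in> Z" "e = F y" by blast
      have "poly_eval (p y) (\<Sum>e\<in>F ` Z. scale_poly (c e) e) = 0"
        using c p[of y] y(1) assms(2) by (auto simp: zero_set_def)
      thus "c e = 0" using ev[OF y(1), of c] Fd[OF y(1)] y(2) by simp
    qed
    have sub: "F ` Z \<subseteq> ?V" using FV by blast
    have "card Z \<le> hilbert_function v I (divisor_class v (\<lambda>_. int C))"
      using hilbert_function_ge[OF finite_monomials is_ideal_I ind sub] by (simp add: card_image[OF injF])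
    moreover have "hilbert_function v I (divisor_class v (\<lambda>_. int C)) = card Z" if ZY: "Z = Y"
    proof -
      have "basis_modulo ?V I (F ` Z)" unfolding basis_modulo_iff
      proof (intro conjI ind sub ballI)
        fix g assume g: "g \<in> ?V"
        define c where "c = (\<lambda>e. poly_eval (p (inv_into Z F e)) g / poly_eval (p (inv_into Z F e)) e)"
        define g' where "g' = g - (\<Sum>e\<in>F ` Z. scale_poly (c e) e)"
        have g'V: "g' \<in> ?V" unfolding g'_def
          using g sub by (intro graded_piece_diff graded_piece_sum graded_piece_scale) auto
        have zero: "poly_eval (p y) g' = 0" if y: "y \<in> Z" for y
        proof -
          have "c (F y) * poly_eval (p y) (F y) = poly_eval (p y) g"
            using Fd[OF y] by (simp add: c_def inv_into_f_f[OF injF y])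
          thus ?thesis by (simp add: g'_def poly_eval_diff ev[OF y])
        qed
        have "g' \<in> I"
        proof (rule vanishing_in_ideal)
          fix x assume x: "x \<in> zero_set I - zero_set B"
          hence y: "orbit v x \<in> Y" by (rule points_in_torus(1))
          hence "orbit v (p (orbit v x)) = orbit v x" using p by blast
          \<comment> \<open>\<open>x\<close> need not be the chosen representative, but the
            vanishing of a form depends only on the orbit.\<close>
          hence "x \<in> orbit v (p (orbit v x))" using self_mem_orbit[of x v] by simp
          thus "poly_eval x g' = 0" by (rule poly_eval_orbit[OF _ g'V]) (rule zero, use y ZY in simp)
        qed
        thus "\<exists>c. g - (\<Sum>e\<in>F ` Z. scale_poly (c e) e) \<in> I" unfolding g'_def by (rule exI[of _ c])
      qed
      from hilbert_function_basis[OF finite_monomials is_ideal_I this] show ?thesis by (simp add: card_image[OF injF])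
    qed
    ultimately show ?thesis by blast
  qed
  thus ?thesis by blast
qed

end


subsection \<open>The alternating count is multilinear\<close>

lemma class_le_iff_effective:
  fixes v :: "'r::finite \<Rightarrow> int ^ 'n"
  shows "class_le v (divisor_class v D) (divisor_class v D') \<longleftrightarrow> (\<exists>m. \<forall>j. D j + pairing m (v j) \<le> D' j)"
proof
  assume "class_le v (divisor_class v D) (divisor_class v D')"
  then obtain u where "monomial_degree v u = divisor_class v (\<lambda>j. D' j - D j)"
    unfolding class_le_def class_semigroup_def class_diff_divisor_class by (metis imageE)
  then obtain m where m: "\<And>j. int (Poly_Mapping.lookup u j) = D' j - D j + pairing m (v j)"
    unfolding monomial_degree_def divisor_class_eq_iff by blast
  have "D j + pairing (- m) (v j) \<le> D' j" for j using m[of j] by (simp add: pairing_uminus_left)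
  thus "\<exists>m. \<forall>j. D j + pairing m (v j) \<le> D' j" by blast
next
  assume "\<exists>m. \<forall>j. D j + pairing m (v j) \<le> D' j"
  then obtain m where m: "\<And>j. D j + pairing m (v j) \<le> D' j" by blast
  define u :: "'r \<Rightarrow>\<^sub>0 nat" where "u = Abs_poly_mapping (\<lambda>j. nat (D' j - D j - pairing m (v j)))"
  have "int (Poly_Mapping.lookup u j) = D' j - D j + pairing (- m) (v j)" for j
    using m[of j] by (simp add: u_def lookup_Abs_poly_mapping pairing_uminus_left)
  hence "monomial_degree v u = divisor_class v (\<lambda>j. D' j - D j)"
    unfolding monomial_degree_def divisor_class_eq_iff by blast
  thus "class_le v (divisor_class v D) (divisor_class v D')"
    unfolding class_le_def class_semigroup_def class_diff_divisor_class by (metis rangeI)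
qed

section \<open>Nef divisors and multilinearity\<close>

context toric_fan
begin

text \<open>Existence of lattice vertices combines the Cartier condition on the maximal cones with
  convexity of the support function.\<close>

definition nef :: "'r divisor \<Rightarrow> bool" where
  "nef D \<longleftrightarrow> (\<exists>\<mu>. vertex_data D \<mu>)"

lemma nef_add: "nef D \<Longrightarrow> nef E \<Longrightarrow> nef (\<lambda>j. D j + E j)"
  using vertex_data_add unfolding nef_def by blast

lemma nef_zero: "nef (\<lambda>j. 0)"
  using vertex_data_zero unfolding nef_def by blast

lemma nef_sum: "(\<And>i. i \<in> A \<Longrightarrow> nef (D i)) \<Longrightarrow> nef (\<lambda>j. \<Sum>i\<in>A. D i j)"
  by (induction A rule: infinite_finite_induct) (simp_all add: nef_zero nef_add)

lemma nef_scale: "nef D \<Longrightarrow> nef (\<lambda>j. int K * D j)"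
  using nef_sum[of "{..<K}" "\<lambda>_. D"] by simp

lemma nef_translate:
  assumes "nef D" "\<And>j. E j = D j + pairing m (v j)"
  shows "nef E"
proof -
  obtain \<mu> where \<mu>: "vertex_data D \<mu>" using assms(1) by (auto simp: nef_def)
  have "vertex_data (\<lambda>j. pairing m (v j)) (\<lambda>s. - m)"
    by (simp add: vertex_data_def pairing_uminus_left)
  from vertex_data_add[OF \<mu> this] have "nef (\<lambda>j. D j + pairing m (v j))" by (auto simp: nef_def)
  moreover have "E = (\<lambda>j. D j + pairing m (v j))" using assms(2) by auto
  ultimately show ?thesis by simp
qed

text \<open>On a maximal chart the character of the local datum is a section. Written through global
  sections, it is a product of a regular character \<open>a\<close> of the chart and a character
  \<open>b\<close> of a global section. The inequalities for \<open>a\<close> and \<open>b\<close>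
  add up to an equality on the rays of the cone, so \<open>b\<close> is the local datum itself,
  which is therefore global.\<close>

lemma semi_ample_nef:
  assumes "semi_ample TYPE('k::field) \<Sigma> v \<alpha>"
  obtains D where "\<alpha> = divisor_class v D" "nef D"
proof -
  obtain D where D: "cartier \<Sigma> v D" "globally_generated TYPE('k) \<Sigma> v D" "\<alpha> = divisor_class v D"
    using assms by (auto simp: semi_ample_def)
  have "\<exists>m. (\<forall>j\<in>s. pairing m (v j) = - D j) \<and> (\<forall>j. pairing m (v j) \<ge> - D j)" if s: "s \<in> max_cones" for s
  proof -
    obtain \<sigma> where \<sigma>: "\<sigma> \<in> \<Sigma>" "s = rays_of \<sigma>" using s by (rule max_conesE)
    have "\<exists>m. \<forall>j. ray v j \<subseteq> \<sigma> \<longrightarrow> pairing m (v j) = D j" using D(1) \<sigma>(1) by (simp add: cartier_def)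
    then obtain m0 where "\<forall>j. ray v j \<subseteq> \<sigma> \<longrightarrow> pairing m0 (v j) = D j" by blast
    hence m0: "pairing m0 (v j) = D j" if "j \<in> s" for j using that by (simp add: \<sigma>(2) rays_of_def)
    \<comment> \<open>\<open>cartier\<close> uses the divisor of a character, while a vertex of the
      polytope has the values \<open>- D j\<close>.\<close>
    define m where "m = - m0"
    have m: "pairing m (v j) = - D j" if "j \<in> s" for j using m0[OF that] by (simp add: m_def pairing_uminus_left)
    define f :: "(int ^ 'n) \<Rightarrow>\<^sub>0 'k" where "f = Poly_Mapping.single m 1"
    have "f \<in> local_sections \<sigma> v D" using m \<sigma>(2) by (auto simp: f_def local_sections_def rays_of_def)
    from bspec[OF bspec[OF D(2)[unfolded globally_generated_def] \<sigma>(1)] this]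
    obtain T h where T: "finite T" "T \<subseteq> global_sections \<Sigma> v D"
      and h: "\<forall>t\<in>T. h t \<in> local_sections \<sigma> v (\<lambda>j. 0)" "f = (\<Sum>t\<in>T. h t * t)"
      by (elim exE conjE)
    have "Poly_Mapping.lookup f m \<noteq> 0" by (simp add: f_def)
    hence "(\<Sum>t\<in>T. Poly_Mapping.lookup (h t * t) m) \<noteq> 0" unfolding h(2) lookup_sum .
    then obtain t where t: "t \<in> T" "m \<in> Poly_Mapping.keys (h t * t)"
      using sum.neutral[of T "\<lambda>t. Poly_Mapping.lookup (h t * t) m"] by (auto simp only: in_keys_iff)
    from subsetD[OF keys_mult t(2)] obtain a b
      where ab: "m = a + b" "a \<in> Poly_Mapping.keys (h t)" "b \<in> Poly_Mapping.keys t"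
      by (elim CollectE exE conjE)
    have a: "pairing a (v j) \<ge> 0" if "j \<in> s" for j
      using h(1) t(1) ab(2) that \<sigma>(2) by (fastforce simp: local_sections_def rays_of_def)
    have b: "pairing b (v j) \<ge> - D j" for j
    proof -
      have "t \<in> local_sections (ray v j) v D" using T(2) t(1) ray_in_fan[of j] by (auto simp: global_sections_def)
      thus ?thesis using ab(3) by (auto simp: local_sections_def)
    qed
    have "pairing (b - m) (v j) = 0" if "j \<in> s" for j
      using a[OF that] b[of j] m[OF that] arg_cong[OF ab(1), of "\<lambda>x. pairing x (v j)"]
      unfolding pairing_diff_left pairing_add_left by linarith
    hence "b - m = 0" by (rule pairing_eq_0_imp[OF _ s])
    thus ?thesis using m b by auto
  qed
  hence "\<forall>s. \<exists>m. s \<in> max_cones \<longrightarrow> (\<forall>j\<in>s. pairing m (v j) = - D j) \<and> (\<forall>j. pairing m (v j) \<ge> - D j)" by blast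
  from choice[OF this] obtain \<mu> where "\<forall>s. s \<in> max_cones \<longrightarrow> (\<forall>j\<in>s. pairing (\<mu> s) (v j) = - D j) \<and> (\<forall>j. pairing (\<mu> s) (v j) \<ge> - D j)"
    by blast
  hence "vertex_data D \<mu>" by (simp add: vertex_data_def)
  thus ?thesis using D(3) by (intro that[of D]) (auto simp: nef_def)
qed

text \<open>For n nef divisors \<open>d i\<close> and nef \<open>E\<close> this is, up to the sign
  \<open>(- 1) ^ n\<close>, the mixed volume of the polytopes in the normalisation of Bernstein's
  theorem.\<close>

definition alternating_count :: "'i set \<Rightarrow> 'r divisor \<Rightarrow> ('i \<Rightarrow> 'r divisor) \<Rightarrow> int" where
  "alternating_count A E d = (\<Sum>J\<in>Pow A. (- 1) ^ card J * int (card (polytope_points v (\<lambda>j. E j + (\<Sum>i\<in>J. d i j)))))"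

lemma alternating_count_shift:
  assumes "finite A" "card A = CARD('n)" "\<And>i. i \<in> A \<Longrightarrow> nef (d i)" "nef E"
  shows "alternating_count A E d = alternating_count A (\<lambda>j. 0) d"
proof -
  have "\<forall>i. \<exists>\<mu>. i \<in> A \<longrightarrow> vertex_data (d i) \<mu>" using assms(3) by (auto simp: nef_def)
  from choice[OF this] obtain \<mu> where \<mu>: "\<And>i. i \<in> A \<Longrightarrow> vertex_data (d i) (\<mu> i)" by blast
  obtain \<nu> where \<nu>: "vertex_data E \<nu>" using assms(4) by (auto simp: nef_def)
  show ?thesis
    using alternating_count_constant[OF assms(1,2) \<mu> \<nu>] by (simp add: alternating_count_def)
qed

text \<open>Pairing \<open>J\<close> with \<open>insert i J\<close> exhibits the difference in the
  direction \<open>d i\<close>.\<close>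

lemma alternating_count_split:
  assumes "finite A" "i \<in> A"
  shows "alternating_count A E d = (\<Sum>J\<in>Pow (A - {i}). (- 1) ^ card J *
    (int (card (polytope_points v (\<lambda>j. E j + (\<Sum>k\<in>J. d k j)))) - int (card (polytope_points v (\<lambda>j. E j + d i j + (\<Sum>k\<in>J. d k j))))))"
proof -
  let ?f = "\<lambda>J. (- 1) ^ card J * int (card (polytope_points v (\<lambda>j. E j + (\<Sum>i\<in>J. d i j))))"
  have A: "A = insert i (A - {i})" using assms(2) by blast
  have inj: "inj_on (insert i) (Pow (A - {i}))" by (rule inj_onI) (auto dest: equalityD1 equalityD2)
  have "alternating_count A E d = sum ?f (Pow (insert i (A - {i})))"
    unfolding alternating_count_def using A by simp
  also have "\<dots> = sum ?f (Pow (A - {i})) + sum ?f (insert i ` Pow (A - {i}))"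
    unfolding Pow_insert by (rule sum.union_disjoint) (use assms(1) in auto)
  also have "sum ?f (insert i ` Pow (A - {i})) = (\<Sum>J\<in>Pow (A - {i}). ?f (insert i J))"
    by (simp add: sum.reindex[OF inj])
  also have "\<dots> = (\<Sum>J\<in>Pow (A - {i}). - ((- 1) ^ card J * int (card (polytope_points v (\<lambda>j. E j + d i j + (\<Sum>k\<in>J. d k j))))))"
  proof (rule sum.cong)
    fix J assume "J \<in> Pow (A - {i})"
    hence "finite J" "i \<notin> J" using assms(1) finite_subset[of J A] by auto
    thus "?f (insert i J) = - ((- 1) ^ card J * int (card (polytope_points v (\<lambda>j. E j + d i j + (\<Sum>k\<in>J. d k j)))))"
      by (simp add: add.assoc)
  qed simp
  finally show ?thesis by (simp add: sum.distrib[symmetric] right_diff_distrib)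
qed

text \<open>With N the point count, \<open>N(0) - N(a + b)\<close> splits into
  \<open>N(0) - N(a)\<close> and \<open>N(a) - N(a + b)\<close>. The second part is the count for
  \<open>b\<close> shifted by \<open>a\<close>, and the shift can be removed because
  \<open>a\<close> is nef.\<close>

lemma alternating_count_add:
  assumes A: "finite A" "card A = CARD('n)" "i \<in> A"
    and nef: "\<And>k. k \<in> A \<Longrightarrow> nef (d k)" "nef a" "nef b"
  shows "alternating_count A (\<lambda>j. 0) (d(i := \<lambda>j. a j + b j))
    = alternating_count A (\<lambda>j. 0) (d(i := a)) + alternating_count A (\<lambda>j. 0) (d(i := b))"
proof -
  let ?N = "\<lambda>E J. int (card (polytope_points v (\<lambda>j. E j + (\<Sum>k\<in>J. d k j))))"
  have split: "alternating_count A E (d(i := c)) = (\<Sum>J\<in>Pow (A - {i}). (- 1) ^ card J * (?N E J - ?N (\<lambda>j. E j + c j) J))"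
    for E c
    unfolding alternating_count_split[OF A(1,3)]
  proof (rule sum.cong)
    fix J assume "J \<in> Pow (A - {i})"
    hence "(\<Sum>k\<in>J. (d(i := c)) k j) = (\<Sum>k\<in>J. d k j)" for j by (intro sum.cong) auto
    thus "(- 1) ^ card J * (int (card (polytope_points v (\<lambda>j. E j + (\<Sum>k\<in>J. (d(i := c)) k j))))
        - int (card (polytope_points v (\<lambda>j. E j + (d(i := c)) i j + (\<Sum>k\<in>J. (d(i := c)) k j)))))
      = (- 1) ^ card J * (?N E J - ?N (\<lambda>j. E j + c j) J)" by (simp only: fun_upd_same)
  qed simp
  have "alternating_count A (\<lambda>j. 0) (d(i := b)) = alternating_count A a (d(i := b))"
    by (rule alternating_count_shift[symmetric]) (use A nef in auto)
  thus ?thesis unfolding split by (simp add: sum.distrib[symmetric] distrib_left[symmetric])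
qed

lemma alternating_count_scale:
  assumes A: "finite A" "card A = CARD('n)" "i \<in> A" and nef: "\<And>k. k \<in> A \<Longrightarrow> nef (d k)"
  shows "alternating_count A (\<lambda>j. 0) (d(i := \<lambda>j. int K * d i j)) = int K * alternating_count A (\<lambda>j. 0) d"
proof (induction K)
  case 0
  show ?case unfolding alternating_count_split[OF A(1,3)] by simp
next
  case (Suc K)
  have "(\<lambda>j. int (Suc K) * d i j) = (\<lambda>j. int K * d i j + d i j)" by (simp add: distrib_right add.commute)
  moreover have "alternating_count A (\<lambda>j. 0) (d(i := \<lambda>j. int K * d i j + d i j))
      = alternating_count A (\<lambda>j. 0) (d(i := \<lambda>j. int K * d i j)) + alternating_count A (\<lambda>j. 0) (d(i := d i))"
    by (rule alternating_count_add[OF A nef]) (use A nef nef_scale in auto)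
  ultimately show ?case using Suc.IH by (simp only: fun_upd_triv) (simp add: distrib_right)
qed

lemma alternating_count_scale_all:
  assumes A: "finite A" "card A = CARD('n)" and nef: "\<And>k. k \<in> A \<Longrightarrow> nef (d k)"
  shows "alternating_count A (\<lambda>j. 0) (\<lambda>i j. int K * d i j) = int K ^ CARD('n) * alternating_count A (\<lambda>j. 0) d"
proof -
  have "alternating_count A (\<lambda>j. 0) (\<lambda>i j. if i \<in> B then int K * d i j else d i j) = int K ^ card B * alternating_count A (\<lambda>j. 0) d"
    if "finite B" "B \<subseteq> A" for B
    using that
  proof (induction B rule: finite_induct)
    case (insert x B)
    let ?d = "\<lambda>i j. if i \<in> B then int K * d i j else d i j"
    have "nef (?d k)" if "k \<in> A" for k using nef[OF that] nef_scale by (cases "k \<in> B") auto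
    moreover have "(\<lambda>i j. if i \<in> insert x B then int K * d i j else d i j) = ?d(x := \<lambda>j. int K * ?d x j)"
      using insert.hyps(2) by (intro ext) auto
    ultimately have "alternating_count A (\<lambda>j. 0) (\<lambda>i j. if i \<in> insert x B then int K * d i j else d i j)
        = int K * alternating_count A (\<lambda>j. 0) ?d"
      using alternating_count_scale[OF A, of x ?d K] insert.prems by (simp only: insert_subset)
    thus ?case using insert by simp
  qed simp
  from this[OF A(1) subset_refl] have "alternating_count A (\<lambda>j. 0) (\<lambda>i j. if i \<in> A then int K * d i j else d i j)
      = int K ^ CARD('n) * alternating_count A (\<lambda>j. 0) d" by (simp add: A(2))
  moreover have "alternating_count A (\<lambda>j. 0) (\<lambda>i j. if i \<in> A then int K * d i j else d i j) = alternating_count A (\<lambda>j. 0) (\<lambda>i j. int K * d i j)"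
  proof -
    have "(\<Sum>i\<in>J. if i \<in> A then int K * d i j else d i j) = (\<Sum>i\<in>J. int K * d i j)" if "J \<in> Pow A" for J j
      by (rule sum.cong) (use that in auto)
    thus ?thesis unfolding alternating_count_def by (intro sum.cong) simp_all
  qed
  ultimately show ?thesis by simp
qed

text \<open>The polytope of \<open>K D\<close> has at least \<open>(K/2)\<^sup>n\<close> lattice points, but its facets have only
  \<open>O(K\<^bsup>n - 1\<^esup>)\<close> of them.\<close>

lemma interior_lattice_point:
  assumes A: "finite A" "card A = CARD('n)" and nef: "\<And>k. k \<in> A \<Longrightarrow> nef (d k)"
    and eff: "\<And>k j. k \<in> A \<Longrightarrow> d k j \<ge> 0" and nz: "alternating_count A (\<lambda>j. 0) d \<noteq> 0"
  shows "\<exists>K m. \<forall>j. pairing m (v j) + int K * (\<Sum>i\<in>A. d i j) \<ge> 1"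
proof (rule ccontr)
  assume no: "\<not> ?thesis"
  let ?D = "\<lambda>j. \<Sum>i\<in>A. d i j"
  let ?n = "CARD('n)"
  obtain R where R: "\<And>K. polytope_points v (\<lambda>j. int K * ?D j) \<subseteq> lattice_box (K * R)"
    using polytope_points_bounded[of ?D] by blast
  \<comment> \<open>Collects the constants: \<open>2 ^ n\<close> subsets, one hyperplane per ray,
    and the box bound. Then \<open>K = M + 1\<close> contradicts
    \<open>K ^ n \<le> M * K ^ (n - 1)\<close>.\<close>
  define M where "M = 2 ^ ?n * (CARD('r) * (2 * R + 1) ^ (?n - 1))"
  define K where "K = Suc M"
  let ?P = "polytope_points v (\<lambda>j. int K * ?D j)"
  have lower: "K ^ ?n \<le> 2 ^ ?n * card ?P"
  proof -
    \<comment> \<open>As all \<open>d i\<close> are effective, the polytope of a partial sum lies in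
      that of the full sum.\<close>
    have le: "card (polytope_points v (\<lambda>j. 0 + (\<Sum>i\<in>J. int K * d i j))) \<le> card ?P" if J: "J \<in> Pow A" for J
    proof (rule card_mono[OF finite_polytope_points])
      have "(\<Sum>i\<in>J. int K * d i j) \<le> int K * ?D j" for j
        unfolding sum_distrib_left using J eff A(1) by (intro sum_mono2) auto
      thus "polytope_points v (\<lambda>j. 0 + (\<Sum>i\<in>J. int K * d i j)) \<subseteq> ?P"
        unfolding polytope_points_def by (auto intro: order_trans[rotated])
    qed
    have scale: "alternating_count A (\<lambda>j. 0) (\<lambda>i j. int K * d i j) = int K ^ ?n * alternating_count A (\<lambda>j. 0) d"
      by (rule alternating_count_scale_all) (use A nef in auto)
    have "int K ^ ?n * 1 \<le> int K ^ ?n * \<bar>alternating_count A (\<lambda>j. 0) d\<bar>"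
      using nz by (intro mult_left_mono) auto
    also have "\<dots> = \<bar>alternating_count A (\<lambda>j. 0) (\<lambda>i j. int K * d i j)\<bar>"
      unfolding scale by (simp add: abs_mult)
    also have "\<dots> \<le> (\<Sum>J\<in>Pow A. \<bar>(- 1) ^ card J * int (card (polytope_points v (\<lambda>j. 0 + (\<Sum>i\<in>J. int K * d i j))))\<bar>)"
      unfolding alternating_count_def by (rule sum_abs)
    also have "\<dots> \<le> (\<Sum>J\<in>Pow A. int (card ?P))"
      using le by (intro sum_mono) (simp add: abs_mult power_abs)
    also have "\<dots> = int (2 ^ ?n * card ?P)" using A by (simp add: card_Pow)
    finally have "int (K ^ ?n) \<le> int (2 ^ ?n * card ?P)" by simp
    thus ?thesis by (simp only: of_nat_le_iff)
  qed
  have "?P \<subseteq> (\<Union>j. {m \<in> lattice_box (K * R). pairing m (v j) = - (int K * ?D j)})"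
  proof
    fix m assume m: "m \<in> ?P"
    obtain j where "\<not> pairing m (v j) + int K * ?D j \<ge> 1" using no by blast
    moreover have "- (int K * ?D j) \<le> pairing m (v j)" using m by (simp add: polytope_points_def)
    ultimately have "pairing m (v j) = - (int K * ?D j)" by linarith
    moreover have "m \<in> lattice_box (K * R)" using subsetD[OF R m] .
    ultimately show "m \<in> (\<Union>j. {m \<in> lattice_box (K * R). pairing m (v j) = - (int K * ?D j)})"
      by (intro UN_I[of j]) simp_all
  qed
  hence "card ?P \<le> card (\<Union>j. {m \<in> lattice_box (K * R). pairing m (v j) = - (int K * ?D j)})"
    by (intro card_mono finite_UN_I) (auto intro: finite_subset[OF _ finite_lattice_box])
  also have "\<dots> \<le> (\<Sum>j\<in>UNIV. card {m \<in> lattice_box (K * R). pairing m (v j) = - (int K * ?D j)})"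
    by (rule card_UN_le) simp
  also have "\<dots> \<le> (\<Sum>j\<in>(UNIV :: 'r set). (2 * (K * R) + 1) ^ (?n - 1))"
  proof (rule sum_mono)
    fix j
    have "v j \<noteq> 0" using w_nonzero[of j] by auto
    thus "card {m \<in> lattice_box (K * R). pairing m (v j) = - (int K * ?D j)} \<le> (2 * (K * R) + 1) ^ (?n - 1)"
      by (rule card_lattice_box_hyperplane)
  qed
  also have "\<dots> \<le> (\<Sum>j\<in>(UNIV :: 'r set). (K * (2 * R + 1)) ^ (?n - 1))"
    by (intro sum_mono power_mono) (auto simp: K_def)
  also have "\<dots> = CARD('r) * (2 * R + 1) ^ (?n - 1) * K ^ (?n - 1)"
    by (simp only: sum_constant power_mult_distrib of_nat_id mult_ac)
  finally have "2 ^ ?n * card ?P \<le> M * K ^ (?n - 1)" unfolding M_def mult.assoc by (intro mult_left_mono) simp_all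
  with lower have "K ^ ?n \<le> M * K ^ (?n - 1)" by (rule order_trans)
  moreover have "Suc (?n - 1) = ?n" by simp
  hence "K ^ ?n = K * K ^ (?n - 1)" by (metis power_Suc)
  ultimately have "K * K ^ (?n - 1) \<le> M * K ^ (?n - 1)" by (simp only:)
  hence "K \<le> M" by (simp add: K_def)
  thus False by (simp add: K_def)
qed

text \<open>Replacing \<open>J\<close> by its complement turns the subtracted degrees of the Hilbert
  function formula into added ones, so that only nef divisors are involved when \<open>E\<close> and
  the \<open>d i\<close> are nef.\<close>

lemma alternating_count_complement:
  assumes A: "finite A"
  shows "(\<Sum>J\<in>Pow A. (- 1) ^ card J * int (card (polytope_points v (\<lambda>j. (\<Sum>i\<in>A. d i j) + E j - (\<Sum>i\<in>J. d i j)))))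
    = (- 1) ^ card A * alternating_count A E d"
proof -
  have "bij_betw (\<lambda>J. A - J) (Pow A) (Pow A)"
    by (rule bij_betwI[where g = "\<lambda>J. A - J"]) auto
  hence "(\<Sum>J\<in>Pow A. (- 1) ^ card J * int (card (polytope_points v (\<lambda>j. (\<Sum>i\<in>A. d i j) + E j - (\<Sum>i\<in>J. d i j)))))
    = (\<Sum>J\<in>Pow A. (- 1) ^ card (A - J) * int (card (polytope_points v (\<lambda>j. (\<Sum>i\<in>A. d i j) + E j - (\<Sum>i\<in>A - J. d i j)))))"
    by (rule sum.reindex_bij_betw[symmetric])
  also have "\<dots> = (\<Sum>J\<in>Pow A. (- 1) ^ card A * ((- 1) ^ card J * int (card (polytope_points v (\<lambda>j. E j + (\<Sum>i\<in>J. d i j))))))"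
  proof (rule sum.cong)
    fix J assume J: "J \<in> Pow A"
    hence fin: "finite J" using A finite_subset by blast
    have "(\<Sum>i\<in>A. d i j) + E j - (\<Sum>i\<in>A - J. d i j) = E j + (\<Sum>i\<in>J. d i j)" for j
      using sum.subset_diff[of J A "\<lambda>i. d i j"] J A by simp
    moreover have "(- 1) ^ card A * (- 1) ^ card J = ((- 1) ^ card (A - J) :: int)"
    proof -
      have "card A = card (A - J) + card J" using J A card_mono[of A J] by (simp add: card_Diff_subset[OF fin])
      thus ?thesis by (simp add: power_add flip: power_mult_distrib)
    qed
    ultimately show "(- 1) ^ card (A - J) * int (card (polytope_points v (\<lambda>j. (\<Sum>i\<in>A. d i j) + E j - (\<Sum>i\<in>A - J. d i j))))
      = (- 1) ^ card A * ((- 1) ^ card J * int (card (polytope_points v (\<lambda>j. E j + (\<Sum>i\<in>J. d i j)))))"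
      by (simp only: mult.assoc[symmetric])
  qed simp
  finally show ?thesis by (simp add: alternating_count_def sum_distrib_left)
qed

end


subsection \<open>The Hilbert function of a complete intersection in the torus\<close>

locale torus_complete_intersection = torus_subscheme \<Sigma> v Y I
  for \<Sigma> :: "(real ^ 'n) set set" and v :: "'r::finite \<Rightarrow> int ^ 'n"
    and Y :: "('r \<Rightarrow> 'k::alg_closed_field) set set" and I :: "('r, 'k) cox_ring set" +
  fixes Fs :: "('r, 'k) cox_ring list" and \<alpha>s :: "nat \<Rightarrow> 'r divisor set"
  assumes complete_intersection: "complete_intersection_ideal v I CARD('n)"
    and length_Fs: "length Fs = CARD('n)" and ideal_Fs: "ideal_gen (set Fs) = I"
    and degrees: "\<And>i. i < CARD('n) \<Longrightarrow> Fs ! i \<in> graded_piece v (\<alpha>s i) \<and> semi_ample TYPE('k) \<Sigma> v (\<alpha>s i)"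
begin

text \<open>The formula arises from \<open>Gs\<close> but has to be expressed through the degrees of
  \<open>Fs\<close>. The representatives are also made effective, which the comparison of polytopes
  and the inequality H(0) \<le> H(\<alpha>1 + ... + \<alpha>n) require.\<close>

lemma effective_representatives:
  obtains d where "\<And>i. i < CARD('n) \<Longrightarrow> \<alpha>s i = divisor_class v (d i)"
    and "\<And>i. i < CARD('n) \<Longrightarrow> nef (d i)" and "\<And>i j. i < CARD('n) \<Longrightarrow> d i j \<ge> 0"
    and "\<And>D. int (hilbert_function v I (divisor_class v D))
      = (\<Sum>J\<in>Pow {..<CARD('n)}. (- 1) ^ card J * int (card (polytope_points v (\<lambda>j. D j - (\<Sum>i\<in>J. d i j)))))"
proof -
  let ?n = "CARD('n)"
  obtain Gs where Gs: "length Gs = ?n" "\<forall>G\<in>set Gs. homogeneous v G" "regular_sequence Gs" "ideal_gen (set Gs) = I"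
    using complete_intersection unfolding complete_intersection_ideal_def by blast
  have "\<exists>E. i < ?n \<longrightarrow> Gs ! i \<in> graded_piece v (divisor_class v E)" for i
  proof (cases "i < ?n")
    case True
    hence "homogeneous v (Gs ! i)" using Gs by simp
    then obtain \<gamma> where "\<gamma> \<in> carrier (Cl v)" "Gs ! i \<in> graded_piece v \<gamma>" unfolding homogeneous_def by blast
    thus ?thesis unfolding carrier_Cl by blast
  qed simp
  hence "\<forall>i. \<exists>E. i < ?n \<longrightarrow> Gs ! i \<in> graded_piece v (divisor_class v E)" by blast
  from choice[OF this] obtain E where E: "\<And>i. i < ?n \<Longrightarrow> Gs ! i \<in> graded_piece v (divisor_class v (E i))" by blast
  have "\<exists>D. i < ?n \<longrightarrow> \<alpha>s i = divisor_class v D \<and> nef D" for i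
  proof (cases "i < ?n")
    case True
    hence "semi_ample TYPE('k) \<Sigma> v (\<alpha>s i)" using degrees by blast
    then obtain D where "\<alpha>s i = divisor_class v D" "nef D" by (rule semi_ample_nef)
    thus ?thesis by blast
  qed simp
  hence "\<forall>i. \<exists>D. i < ?n \<longrightarrow> \<alpha>s i = divisor_class v D \<and> nef D" by blast
  from choice[OF this] obtain D' where D': "\<And>i. i < ?n \<Longrightarrow> \<alpha>s i = divisor_class v (D' i)" "\<And>i. i < ?n \<Longrightarrow> nef (D' i)"
    by blast
  have F: "Fs ! i \<in> graded_piece v (divisor_class v (D' i))" if "i < ?n" for i
    using degrees[OF that] D'(1)[OF that] by simp
  have "ideal_gen (set Fs) = ideal_gen (set Gs)" using ideal_Fs Gs(4) by simp
  then obtain p where p: "p permutes {..<?n}"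
    and pF: "\<And>i. i < ?n \<Longrightarrow> divisor_class v (D' i) = divisor_class v (E (p i)) \<and> Fs ! i \<noteq> 0"
    using generators_same_degrees[OF Gs(3,1) length_Fs _ F E] by blast
  have "\<exists>d. i < ?n \<longrightarrow> divisor_class v d = divisor_class v (D' i) \<and> nef d \<and> (\<forall>j. d j \<ge> 0)" for i
  proof (cases "i < ?n")
    case True
    hence "Poly_Mapping.keys (Fs ! i) \<noteq> {}" using pF by simp
    then obtain u where u: "u \<in> Poly_Mapping.keys (Fs ! i)" by blast
    \<comment> \<open>The exponents of any monomial of the nonzero form \<open>Fs ! i\<close> are an
      effective divisor of its degree; it is nef as a translate of \<open>D' i\<close>.\<close>
    define d where "d = (\<lambda>j. int (Poly_Mapping.lookup u j))"
    have cl: "divisor_class v d = divisor_class v (D' i)"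
      using F[OF True] u by (simp add: graded_piece_def monomial_degree_def d_def)
    then obtain m where "\<forall>j. d j = D' i j + pairing m (v j)" unfolding divisor_class_eq_iff by blast
    hence "nef d" using nef_translate[OF D'(2)[OF True], of d m] by simp
    moreover have "\<forall>j. d j \<ge> 0" by (simp add: d_def)
    ultimately show ?thesis using cl by (intro exI[of _ d]) simp
  qed simp
  hence "\<forall>i. \<exists>d. i < ?n \<longrightarrow> divisor_class v d = divisor_class v (D' i) \<and> nef d \<and> (\<forall>j. d j \<ge> 0)" by (rule allI)
  from choice[OF this] obtain d
    where "\<forall>i. i < ?n \<longrightarrow> divisor_class v (d i) = divisor_class v (D' i) \<and> nef (d i) \<and> (\<forall>j. d i j \<ge> 0)" ..
  hence d: "\<And>i. i < ?n \<Longrightarrow> divisor_class v (d i) = divisor_class v (D' i)"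
    "\<And>i. i < ?n \<Longrightarrow> nef (d i)" "\<And>i j. i < ?n \<Longrightarrow> d i j \<ge> 0" by simp_all
  \<comment> \<open>The inverse matching assigns to each member of \<open>Gs\<close> a divisor of
    the list \<open>d\<close>. The sum over all subsets of indices does not change under the
    permutation.\<close>
  define q where "q = inv_into UNIV p"
  have q: "q permutes {..<?n}" unfolding q_def by (rule permutes_inv[OF p])
  have G: "Gs ! i \<in> graded_piece v (divisor_class v (d (q i)))" if i: "i < ?n" for i
  proof -
    have qi: "q i < ?n" using permutes_in_image[OF q, of i] i by simp
    have "p (q i) = i" unfolding q_def by (rule permutes_inverses(1)[OF p])
    hence "divisor_class v (d (q i)) = divisor_class v (E i)" using d(1)[OF qi] pF[OF qi] by simp
    thus ?thesis using E[OF i] by simp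
  qed
  have HF: "int (hilbert_function v I (divisor_class v D))
      = (\<Sum>J\<in>Pow {..<?n}. (- 1) ^ card J * int (card (polytope_points v (\<lambda>j. D j - (\<Sum>i\<in>J. d i j)))))" for D
  proof -
    have "int (hilbert_function v I (divisor_class v D))
      = (\<Sum>J\<in>Pow {..<?n}. (- 1) ^ card J * int (card (polytope_points v (\<lambda>j. D j - (\<Sum>i\<in>J. d (q i) j)))))"
      using hilbert_function_regular_sequence[OF Gs(3), of "\<lambda>i. d (q i)" ?n D] G by (simp add: Gs(1,4))
    also have "\<dots> = (\<Sum>J\<in>Pow {..<?n}. (- 1) ^ card (q ` J) * int (card (polytope_points v (\<lambda>j. D j - (\<Sum>i\<in>q ` J. d i j)))))"
    proof (rule sum.cong)
      fix J assume "J \<in> Pow {..<?n}"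
      have "inj_on q J" by (rule inj_on_subset[OF permutes_inj[OF q] subset_UNIV])
      thus "(- 1) ^ card J * int (card (polytope_points v (\<lambda>j. D j - (\<Sum>i\<in>J. d (q i) j))))
        = (- 1) ^ card (q ` J) * int (card (polytope_points v (\<lambda>j. D j - (\<Sum>i\<in>q ` J. d i j))))"
        by (simp add: sum.reindex card_image)
    qed simp
    also have "\<dots> = (\<Sum>J\<in>Pow {..<?n}. (- 1) ^ card J * int (card (polytope_points v (\<lambda>j. D j - (\<Sum>i\<in>J. d i j)))))"
      by (rule sum.reindex_bij_betw[OF bij_betw_Pow[OF permutes_imp_bij[OF q]]])
    finally show ?thesis .
  qed
  have cl: "\<alpha>s i = divisor_class v (d i)" if "i < ?n" for i using D'(1)[OF that] d(1)[OF that] by simp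
  show ?thesis by (rule that[OF cl d(2,3) HF])
qed

lemma one_not_in_I: "1 \<notin> I"
proof
  assume "1 \<in> I"
  hence "f \<in> I" for f using ideal.subspace_scale[OF is_ideal_I, of 1 f] by simp
  thus False using complete_intersection by (auto simp: complete_intersection_ideal_def regular_sequence_def)
qed

lemma hilbert_function_zero_pos: "hilbert_function v I (divisor_class v (\<lambda>j. 0)) \<ge> 1"
proof -
  have "c = 0" if "scale_poly c 1 \<in> I" for c :: 'k
  proof (rule ccontr)
    assume "c \<noteq> 0"
    have "scale_poly (inverse c) (scale_poly c 1) \<in> I" by (rule ideal.subspace_scale[OF is_ideal_I that])
    thus False using \<open>c \<noteq> 0\<close> one_not_in_I by (simp add: mult_single)
  qed
  hence "independent_modulo I {1}" by (auto simp: independent_modulo_def)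
  moreover have "{1 :: ('r, 'k) cox_ring} \<subseteq> graded_piece v (divisor_class v (\<lambda>j. 0))"
    using graded_piece_monom[of "0 :: 'r \<Rightarrow>\<^sub>0 nat" "1::'k" v] by (simp add: monomial_degree_def)
  ultimately show ?thesis using hilbert_function_ge[OF finite_monomials is_ideal_I] by fastforce
qed

text \<open>A form of degree \<alpha> in the ideal has coefficients of degree \<alpha> - \<alpha>i
  at the \<open>Fs\<close>. There are no monomials of these degrees, so the form is zero.\<close>

lemma hilbert_function_if_not_ge_degrees:
  assumes \<alpha>: "\<alpha> \<in> carrier (Cl v)" and no: "\<forall>i<CARD('n). \<not> class_le v (\<alpha>s i) \<alpha>"
  shows "hilbert_function v I \<alpha> = card (lattice_points (class_polytope v \<alpha>))"
proof -
  obtain D where D: "\<alpha> = divisor_class v D" using \<alpha> unfolding carrier_Cl by blast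
  have "graded_piece v \<alpha> \<inter> I \<subseteq> {0}"
  proof
    fix f assume f: "f \<in> graded_piece v \<alpha> \<inter> I"
    hence "f \<in> ideal_gen (set Fs)" using ideal_Fs by simp
    moreover have "\<alpha>s i \<in> carrier (Cl v)" if i: "i < CARD('n)" for i
    proof -
      have "semi_ample TYPE('k) \<Sigma> v (\<alpha>s i)" using degrees[OF i] by blast
      thus ?thesis by (auto simp: semi_ample_def)
    qed
    ultimately obtain a where a: "f = (\<Sum>i<length Fs. a i * Fs ! i)" "\<And>i. a i \<in> graded_piece v (class_diff v \<alpha> (\<alpha>s i))"
      using homogeneous_ideal_representation[of f v \<alpha> Fs \<alpha>s] f \<alpha> degrees length_Fs by auto
    have "a i = 0" if i: "i < CARD('n)" for i
    proof (rule ccontr)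
      assume "a i \<noteq> 0"
      hence "Poly_Mapping.keys (a i) \<noteq> {}" by simp
      then obtain u where "u \<in> Poly_Mapping.keys (a i)" by blast
      hence "monomial_degree v u = class_diff v \<alpha> (\<alpha>s i)" using a(2)[of i] by (simp add: graded_piece_def)
      hence "class_le v (\<alpha>s i) \<alpha>" unfolding class_le_def class_semigroup_def by (metis rangeI)
      thus False using no i by blast
    qed
    thus "f \<in> {0}" using a(1) length_Fs by simp
  qed
  from hilbert_function_trivial[OF _ is_ideal_I this] show ?thesis
    unfolding D using finite_monomials[of D] by (simp add: card_monomials card_lattice_points)
qed

text \<open>A squeeze: H at the sum is at most H at \<open>D\<close>, which is at most
  \<open>card Y\<close>, which is at most H at the sum. The last bound holds for every finite subset
  of \<open>Y\<close> and so also makes \<open>Y\<close> finite.\<close>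

lemma hilbert_function_eq_card_points:
  assumes "\<And>i. i < CARD('n) \<Longrightarrow> \<alpha>s i = divisor_class v (d i)"
    and nef: "\<And>i. i < CARD('n) \<Longrightarrow> nef (d i)" and eff: "\<And>i j. i < CARD('n) \<Longrightarrow> d i j \<ge> 0"
    and HF: "\<And>D. int (hilbert_function v I (divisor_class v D))
      = (\<Sum>J\<in>Pow {..<CARD('n)}. (- 1) ^ card J * int (card (polytope_points v (\<lambda>j. D j - (\<Sum>i\<in>J. d i j)))))"
    and le: "class_le v (divisor_class v (\<lambda>j. \<Sum>i<CARD('n). d i j)) (divisor_class v D)"
  shows "finite Y \<and> hilbert_function v I (divisor_class v D) = card Y"
proof -
  let ?n = "CARD('n)" and ?A = "{..<CARD('n)}"
  let ?H = "\<lambda>D. hilbert_function v I (divisor_class v D)"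
  let ?D = "\<lambda>j. \<Sum>i<?n. d i j"
  have nefA: "nef (d i)" if "i \<in> ?A" for i using nef that by simp
  have const: "?H (\<lambda>j. ?D j + E j) = ?H ?D" if E: "nef E" for E
  proof -
    have shift: "alternating_count ?A E d = alternating_count ?A (\<lambda>j. 0) d"
      by (rule alternating_count_shift) (use nef E in auto)
    have "int (?H (\<lambda>j. ?D j + E j)) = (- 1) ^ card ?A * alternating_count ?A E d"
      unfolding HF by (rule alternating_count_complement) simp
    also have "\<dots> = int (?H (\<lambda>j. ?D j + 0))"
      unfolding HF shift by (rule alternating_count_complement[symmetric]) simp
    finally show ?thesis by simp
  qed
  have "int (?H ?D) = (- 1) ^ card ?A * alternating_count ?A (\<lambda>j. 0) d"
    unfolding HF using alternating_count_complement[of ?A d "\<lambda>j. 0"] by simp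
  moreover have "?H (\<lambda>j. 0) \<le> ?H ?D"
  proof (rule hilbert_function_mono)
    have "0 + pairing 0 (v j) \<le> ?D j" for j
    proof -
      have "0 \<le> ?D j" by (rule sum_nonneg) (use eff in auto)
      thus ?thesis by simp
    qed
    thus "class_le v (divisor_class v (\<lambda>j. 0)) (divisor_class v ?D)" unfolding class_le_iff_effective by blast
  qed
  ultimately have nz: "alternating_count ?A (\<lambda>j. 0) d \<noteq> 0" using hilbert_function_zero_pos by auto
  obtain K m where Km: "\<And>j. pairing m (v j) + int K * ?D j \<ge> 1"
    using interior_lattice_point[of ?A d] nef eff nz by auto
  have upper: "?H (\<lambda>_. int C) \<le> ?H ?D" for C
  proof -
    \<comment> \<open>\<open>C\<close> copies of the inequality of the interior lattice point give
      the dominating degree; the translation by \<open>- C m\<close> is principal. The additional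
      summand \<open>?D\<close> places it among the degrees where H is constant.\<close>
    have "class_le v (divisor_class v (\<lambda>_. int C)) (divisor_class v (\<lambda>j. ?D j + int (C * K) * ?D j))"
      unfolding class_le_iff_effective
    proof (intro exI allI)
      fix j
      let ?m = "- (\<Sum>k<C. m)"
      have "int C * 1 \<le> int C * (pairing m (v j) + int K * ?D j)" using Km[of j] by (intro mult_left_mono) auto
      moreover have "?D j \<ge> 0" using eff by (intro sum_nonneg) auto
      moreover have "pairing ?m (v j) = - (int C * pairing m (v j))"
        unfolding pairing_uminus_left pairing_sum_left by simp
      ultimately show "int C + pairing ?m (v j) \<le> ?D j + int (C * K) * ?D j"
        by (simp add: distrib_left mult.assoc)
    qed
    hence "?H (\<lambda>_. int C) \<le> ?H (\<lambda>j. ?D j + int (C * K) * ?D j)" by (rule hilbert_function_mono)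
    also have "\<dots> = ?H ?D" by (rule const) (intro nef_scale nef_sum nefA)
    finally show ?thesis .
  qed
  have card_le: "card Z \<le> ?H ?D" if Z: "finite Z" "Z \<subseteq> Y" for Z
  proof -
    obtain C0 where "\<forall>C\<ge>C0. card Z \<le> ?H (\<lambda>_. int C) \<and> (Z = Y \<longrightarrow> ?H (\<lambda>_. int C) = card Z)"
      using card_points_le_hilbert_function[OF Z] by blast
    hence "card Z \<le> ?H (\<lambda>_. int C0)" by blast
    thus ?thesis using upper[of C0] by linarith
  qed
  have fin: "finite Y"
  proof (rule ccontr)
    assume "infinite Y"
    then obtain Z where "Z \<subseteq> Y" "finite Z" "card Z = Suc (?H ?D)" using infinite_arbitrarily_large by blast
    thus False using card_le[of Z] by simp
  qed
  obtain C0 where C0: "\<And>C. C \<ge> C0 \<Longrightarrow> ?H (\<lambda>_. int C) = card Y"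
    using card_points_le_hilbert_function[OF fin subset_refl] by blast
  \<comment> \<open>Beyond \<open>C0\<close>, where H equals the number of points, and large enough
    for the uniform divisor to dominate \<open>D\<close>.\<close>
  define C where "C = C0 + (\<Sum>j\<in>UNIV. nat \<bar>D j\<bar>)"
  have "class_le v (divisor_class v D) (divisor_class v (\<lambda>_. int C))"
    unfolding class_le_iff_effective
  proof (intro exI allI)
    fix j
    have "nat \<bar>D j\<bar> \<le> (\<Sum>j\<in>UNIV. nat \<bar>D j\<bar>)" by (rule member_le_sum) auto
    hence "nat \<bar>D j\<bar> \<le> C" by (simp add: C_def)
    thus "D j + pairing 0 (v j) \<le> int C" by simp
  qed
  hence "?H D \<le> card Y" using hilbert_function_mono C0[of C] by (fastforce simp: C_def)
  moreover have "?H ?D \<le> ?H D" by (rule hilbert_function_mono[OF le])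
  moreover have "card Y \<le> ?H ?D" using card_le[OF fin subset_refl] .
  ultimately show ?thesis using fin by simp
qed

end

lemma sum_by_card:
  assumes "finite A"
  shows "(\<Sum>s=0..card A. (- 1) ^ s * (\<Sum>J | J \<subseteq> A \<and> card J = s. f J)) = (\<Sum>J\<in>Pow A. (- 1) ^ card J * (f J :: int))"
proof -
  have "(\<Sum>s=0..card A. (- 1) ^ s * (\<Sum>J | J \<subseteq> A \<and> card J = s. f J))
      = (\<Sum>s=0..card A. \<Sum>J\<in>{J\<in>Pow A. card J = s}. (- 1) ^ card J * f J)"
    unfolding sum_distrib_left by (intro sum.cong) auto
  also have "\<dots> = (\<Sum>J\<in>Pow A. (- 1) ^ card J * f J)"
    by (rule sum.group) (use assms in \<open>auto intro: card_mono\<close>)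
  finally show ?thesis .
qed

theorem mainTheorem1:
  fixes \<Sigma> :: "(real ^ 'n) set set"
    and v :: "'r::finite \<Rightarrow> int ^ 'n"
    and Y :: "('r \<Rightarrow> 'k::alg_closed_field) set set"
    and I :: "('r, 'k) cox_ring set"
    and Fs :: "('r, 'k) cox_ring list"
    and \<alpha>s :: "nat \<Rightarrow> 'r divisor set"
  assumes "complete_fan \<Sigma>"
    and "simplicial_fan \<Sigma>"
    and "primitive_ray_generators \<Sigma> v"
    and "torsion_free (Cl v)"
    and "Y \<subseteq> dense_torus v"
    and "is_ideal_of \<Sigma> v Y I"
    and "complete_intersection_ideal v I CARD('n)"
    and "length Fs = CARD('n)"
    and "ideal_gen (set Fs) = I"
    and "\<forall>i<CARD('n). Fs ! i \<in> graded_piece v (\<alpha>s i) \<and> semi_ample TYPE('k) \<Sigma> v (\<alpha>s i)"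
  shows "(\<forall>\<alpha>\<in>carrier (Cl v).
           int (hilbert_function v I \<alpha>) =
             (\<Sum>s=0..CARD('n). (-1) ^ s *
                (\<Sum>J | J \<subseteq> {..<CARD('n)} \<and> card J = s.
                   int (card (lattice_points
                     (class_polytope v (class_diff v \<alpha> (finprod (Cl v) \<alpha>s J)))))))) \<and>
         (\<forall>\<alpha>\<in>carrier (Cl v). (\<forall>i<CARD('n). \<not> class_le v (\<alpha>s i) \<alpha>) \<longrightarrow>
           hilbert_function v I \<alpha> = card (lattice_points (class_polytope v \<alpha>))) \<and>
         (\<forall>\<alpha>\<in>carrier (Cl v). \<forall>\<alpha>'\<in>carrier (Cl v). class_le v \<alpha> \<alpha>' \<longrightarrow>
           hilbert_function v I \<alpha> \<le> hilbert_function v I \<alpha>') \<and>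
         (\<forall>\<alpha>\<in>carrier (Cl v). class_le v (finprod (Cl v) \<alpha>s {..<CARD('n)}) \<alpha> \<longrightarrow>
           finite Y \<and> hilbert_function v I \<alpha> = card Y)"
proof -
  interpret torus_complete_intersection \<Sigma> v Y I Fs \<alpha>s
    by unfold_locales (use assms in auto)
  obtain d where d: "\<And>i. i < CARD('n) \<Longrightarrow> \<alpha>s i = divisor_class v (d i)"
    and nef: "\<And>i. i < CARD('n) \<Longrightarrow> nef (d i)" and eff: "\<And>i j. i < CARD('n) \<Longrightarrow> d i j \<ge> 0"
    and HF: "\<And>D. int (hilbert_function v I (divisor_class v D))
      = (\<Sum>J\<in>Pow {..<CARD('n)}. (- 1) ^ card J * int (card (polytope_points v (\<lambda>j. D j - (\<Sum>i\<in>J. d i j)))))"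
    using effective_representatives by blast
  have fp: "finprod (Cl v) \<alpha>s J = divisor_class v (\<lambda>j. \<Sum>i\<in>J. d i j)" if "J \<subseteq> {..<CARD('n)}" for J
  proof -
    interpret Cl: comm_group "Cl v" by (rule comm_group_Cl)
    have "finprod (Cl v) \<alpha>s J = finprod (Cl v) (\<lambda>i. divisor_class v (d i)) J"
      by (rule Cl.finprod_cong) (use d that in \<open>auto simp: simp_implies_def\<close>)
    also have "\<dots> = divisor_class v (\<lambda>j. \<Sum>i\<in>J. d i j)"
      by (rule finprod_Cl) (use that finite_subset in blast)
    finally show ?thesis .
  qed
  show ?thesis
  proof (intro conjI ballI impI)
    fix \<alpha> assume "\<alpha> \<in> carrier (Cl v)"
    then obtain D where D: "\<alpha> = divisor_class v D" unfolding carrier_Cl by blast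
    have "card (lattice_points (class_polytope v (class_diff v \<alpha> (finprod (Cl v) \<alpha>s J))))
        = card (polytope_points v (\<lambda>j. D j - (\<Sum>i\<in>J. d i j)))" if "J \<in> Pow {..<CARD('n)}" for J
      using that fp[of J] by (simp add: D class_diff_divisor_class card_lattice_points)
    hence "int (hilbert_function v I \<alpha>) = (\<Sum>J\<in>Pow {..<CARD('n)}. (- 1) ^ card J *
        int (card (lattice_points (class_polytope v (class_diff v \<alpha> (finprod (Cl v) \<alpha>s J))))))"
      unfolding D HF by (intro sum.cong) simp_all
    thus "int (hilbert_function v I \<alpha>) = (\<Sum>s=0..CARD('n). (-1) ^ s *
        (\<Sum>J | J \<subseteq> {..<CARD('n)} \<and> card J = s.
           int (card (lattice_points (class_polytope v (class_diff v \<alpha> (finprod (Cl v) \<alpha>s J)))))))"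
      using sum_by_card[of "{..<CARD('n)}"] by simp
    show "finite Y" "hilbert_function v I \<alpha> = card Y"
      if "class_le v (finprod (Cl v) \<alpha>s {..<CARD('n)}) \<alpha>"
      using hilbert_function_eq_card_points[OF d nef eff HF, of D] that fp[of "{..<CARD('n)}"] D by auto
  next
    fix \<alpha> assume "\<alpha> \<in> carrier (Cl v)" "\<forall>i<CARD('n). \<not> class_le v (\<alpha>s i) \<alpha>"
    thus "hilbert_function v I \<alpha> = card (lattice_points (class_polytope v \<alpha>))"
      by (rule hilbert_function_if_not_ge_degrees)
  next
    fix \<alpha> \<alpha>' assume "\<alpha> \<in> carrier (Cl v)" "\<alpha>' \<in> carrier (Cl v)" "class_le v \<alpha> \<alpha>'"
    thus "hilbert_function v I \<alpha> \<le> hilbert_function v I \<alpha>'"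
      unfolding carrier_Cl using hilbert_function_mono by blast
  qed
qed



end
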